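(* Let $q\in\mathbb{T}$ and $b\in\mathbb{D}$, and let $\phi=z+\overline{q\varphi_b}$. Then the following statements are equivalent: (a) $T_\phi$ is complex symmetric. (b) $T_\phi$ is UET. (c) $T_\phi$ is either normal or $C_{\lambda,a}$-symmetric for some $\lambda\in\mathbb{T}$ and $a\in\mathbb{D}$. (d) The curve $\phi(\mathbb{T})$ is nowhere winding. (e) $qb=\bar b$.
   Context: $\mathbb{D}$ is the open unit disk in $\mathbb{C}$, $\mathbb{T}$ its boundary with normalized Haar measure $\sigma$. $H^2$ is the Hardy space of $\mathbb{D}$, identified via boundary functions with a closed subspace of $L^2(\mathbb{T},\sigma)$; $P:L^2\to H^2$ is the orthogonal projection. For $\phi\in L^\infty(\mathbb{T})$, the Toeplitz operator is $T_\phi f=P(\phi f)$ for $f\in H^2$. A conjugation on a Hilbert space $\mathcal{H}$ is a conjugate-linear map $C:\mathcal{H}\to\mathcal{H}$ with $C^2=I$ and $\langle Cx,Cy\rangle=\langle y,x\rangle$ for all $x,y$. A bounded operator $T$ is $C$-symmetric if $CTC=T^*$, and complex symmetric if it is $C$-symmetric for some conjugation $C$. $T$ is called UET if $T$ is unitarily equivalent to $CT^*C$ for some conjugation $C$ on $\mathcal{H}$. For $a\in\mathbb{D}$, $\varphi_a(z)=\frac{a-z}{1-\bar az}$, $K_a(z)=\frac1{1-\bar az}$ and $e_a=\sqrt{1-|a|^2}\,K_a$. The set $\{\varphi_a^me_a:m\ge0\}$ is an orthonormal basis of $H^2$, and for $\lambda\in\mathbb{T}$, $C_{\lambda,a}$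 is the conjugation on $H^2$ defined by $C_{\lambda,a}\big(\sum_{m\ge0}\mu_m\varphi_a^me_a\big)=\sum_{m\ge0}\overline{\mu_m}\,\bar\lambda^m\varphi_a^me_a$. A closed curve $\gamma$ in $\mathbb{C}$ is nowhere winding if its winding number $\mathrm{Ind}_\gamma(z)=\frac1{2\pi i}\int_\gamma\frac{1}{\zeta-z}\,d\zeta$ is $0$ for all $z\in\mathbb{C}\setminus\gamma$. Here $\phi(\mathbb{T})$ is regarded as the closed curve $t\mapsto\phi(e^{it})$, $0\le t\le2\pi$. *)

theory Defs
  imports "HOL-Complex_Analysis.Complex_Analysis" "HOL-Probability.Probability"
begin

section \<open>Complex inner product spaces and operators on them\<close>

text \<open>
  The inner product is linear in the first argument; norm and topology are those of
  the underlying real inner product \<open>Re (cinner x y)\<close>.  Completeness is not part of the class: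
  the two instances below are Hilbert spaces, but none of the notions needs this to be stated.
\<close>

class complex_inner = real_inner +
  fixes scaleC :: "complex \<Rightarrow> 'a \<Rightarrow> 'a"  (infixr "*\<^sub>C" 75)
    and cinner :: "'a \<Rightarrow> 'a \<Rightarrow> complex"
  assumes scaleC_add_right: "c *\<^sub>C (x + y) = c *\<^sub>C x + c *\<^sub>C y"
    and scaleC_add_left: "(c + d) *\<^sub>C x = c *\<^sub>C x + d *\<^sub>C x"
    and scaleC_scaleC: "c *\<^sub>C (d *\<^sub>C x) = (c * d) *\<^sub>C x"
    and scaleR_eq_scaleC: "r *\<^sub>R x = complex_of_real r *\<^sub>C x"
    and cinner_commute: "cinner x y = cnj (cinner y x)"
    and cinner_add_left: "cinner (x + y) z = cinner x z + cinner y z"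
    and cinner_scaleC_left: "cinner (c *\<^sub>C x) y = c * cinner x y"
    and inner_eq_Re_cinner: "inner x y = Re (cinner x y)"

definition bounded_operator :: "('a::complex_inner \<Rightarrow> 'a) \<Rightarrow> bool" where
  "bounded_operator T \<longleftrightarrow> bounded_linear T \<and> (\<forall>c x. T (c *\<^sub>C x) = c *\<^sub>C T x)"

definition cadjoint :: "('a::complex_inner \<Rightarrow> 'a) \<Rightarrow> 'a \<Rightarrow> 'a" where
  "cadjoint T = (THE S. \<forall>x y. cinner (T x) y = cinner x (S y))"

definition conjugation :: "('a::complex_inner \<Rightarrow> 'a) \<Rightarrow> bool" where
  "conjugation C \<longleftrightarrow>
     (\<forall>x y. C (x + y) = C x + C y) \<and> (\<forall>c x. C (c *\<^sub>C x) = cnj c *\<^sub>C C x) \<and>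
     C \<circ> C = id \<and> (\<forall>x y. cinner (C x) (C y) = cinner y x)"

definition C_symmetric :: "('a::complex_inner \<Rightarrow> 'a) \<Rightarrow> ('a \<Rightarrow> 'a) \<Rightarrow> bool" where
  "C_symmetric C T \<longleftrightarrow> bounded_operator T \<and> C \<circ> T \<circ> C = cadjoint T"

definition complex_symmetric :: "('a::complex_inner \<Rightarrow> 'a) \<Rightarrow> bool" where
  "complex_symmetric T \<longleftrightarrow> (\<exists>C. conjugation C \<and> C_symmetric C T)"

definition unitary_operator :: "('a::complex_inner \<Rightarrow> 'a) \<Rightarrow> bool" where
  "unitary_operator U \<longleftrightarrow>
     bounded_operator U \<and> bij U \<and> (\<forall>x y. cinner (U x) (U y) = cinner x y)"

definition unitarily_equivalent :: "('a::complex_inner \<Rightarrow> 'a) \<Rightarrow> ('a \<Rightarrow> 'a) \<Rightarrow> bool" where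
  "unitarily_equivalent S T \<longleftrightarrow> (\<exists>U. unitary_operator U \<and> S = inv U \<circ> T \<circ> U)"

definition UET :: "('a::complex_inner \<Rightarrow> 'a) \<Rightarrow> bool" where
  "UET T \<longleftrightarrow> bounded_operator T \<and>
     (\<exists>C. conjugation C \<and> unitarily_equivalent T (C \<circ> cadjoint T \<circ> C))"

definition normal_operator :: "('a::complex_inner \<Rightarrow> 'a) \<Rightarrow> bool" where
  "normal_operator T \<longleftrightarrow> bounded_operator T \<and> T \<circ> cadjoint T = cadjoint T \<circ> T"


section \<open>The space $L^2$ of the circle\<close>

definition circle_measure :: "complex measure" where
  "circle_measure =
     distr (uniform_measure lborel {0..2*pi}) (restrict_space borel (sphere 0 1)) cis"

lemma space_circle_measure: "space circle_measure = sphere 0 1"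
  by (simp add: circle_measure_def space_restrict_space)

lemma sets_circle_measure [measurable_cong]:
  "sets circle_measure = sets (restrict_space borel (sphere 0 1))"
  by (simp add: circle_measure_def)

lemma prob_space_circle_measure: "prob_space circle_measure"
proof -
  have "cis \<in> borel_measurable borel"
    by (intro borel_measurable_continuous_onI continuous_intros)
  then have "cis \<in> measurable (uniform_measure lborel {0..2*pi}) borel"
    by (subst measurable_cong_sets[where M' = borel and N' = borel]) simp_all
  then have "cis \<in> measurable (uniform_measure lborel {0..2*pi}) (restrict_space borel (sphere 0 1))"
    by (intro measurable_restrict_space2) auto
  moreover have "prob_space (uniform_measure lborel {0..2*pi})"
    by (rule prob_space_uniform_measure) auto
  ultimately show ?thesis
    unfolding circle_measure_def by (rule prob_space.prob_space_distr[rotated])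
qed

definition square_integrable :: "(complex \<Rightarrow> complex) \<Rightarrow> bool" where
  "square_integrable f \<longleftrightarrow> f \<in> borel_measurable circle_measure \<and>
     integrable circle_measure (\<lambda>z. (cmod (f z))\<^sup>2)"

lemma square_integrable_zero: "square_integrable (\<lambda>_. 0)"
  by (simp add: square_integrable_def)

lemma square_integrable_scale:
  assumes "square_integrable f"
  shows "square_integrable (\<lambda>z. c * f z)"
proof -
  have [measurable]: "f \<in> borel_measurable circle_measure"
    using assms by (simp add: square_integrable_def)
  have "integrable circle_measure (\<lambda>z. (cmod c)\<^sup>2 * (cmod (f z))\<^sup>2)"
    using assms by (simp add: square_integrable_def)
  then show ?thesis
    by (simp add: square_integrable_def norm_mult power_mult_distrib)
qed

lemma cmod_add_square_le: "(cmod (a + b))\<^sup>2 \<le> 2 * (cmod a)\<^sup>2 + 2 * (cmod b)\<^sup>2"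
proof -
  have "(cmod (a + b))\<^sup>2 \<le> (cmod a + cmod b)\<^sup>2"
    by (simp add: norm_triangle_ineq power_mono)
  also have "\<dots> \<le> 2 * (cmod a)\<^sup>2 + 2 * (cmod b)\<^sup>2"
    using zero_le_power2[of "cmod a - cmod b"] by (simp add: power2_eq_square algebra_simps)
  finally show ?thesis .
qed

lemma square_integrable_add:
  assumes "square_integrable f" "square_integrable g"
  shows "square_integrable (\<lambda>z. f z + g z)"
proof -
  have m [measurable]: "f \<in> borel_measurable circle_measure" "g \<in> borel_measurable circle_measure"
    using assms by (auto simp: square_integrable_def)
  have "integrable circle_measure (\<lambda>z. 2 * (cmod (f z))\<^sup>2 + 2 * (cmod (g z))\<^sup>2)"
    using assms by (auto simp: square_integrable_def)
  then have "integrable circle_measure (\<lambda>z. (cmod (f z + g z))\<^sup>2)"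
    by (rule Bochner_Integration.integrable_bound) (auto intro: order_trans[OF cmod_add_square_le])
  then show ?thesis
    by (simp add: square_integrable_def)
qed

lemma square_integrable_prod:
  assumes "square_integrable f" "square_integrable g"
  shows "integrable circle_measure (\<lambda>z. f z * cnj (g z))"
proof -
  have m [measurable]: "f \<in> borel_measurable circle_measure" "g \<in> borel_measurable circle_measure"
    using assms by (auto simp: square_integrable_def)
  have le: "cmod a * cmod b \<le> (cmod a)\<^sup>2 + (cmod b)\<^sup>2" for a b
    using zero_le_power2[of "cmod a - cmod b"] zero_le_power2[of "cmod a"] zero_le_power2[of "cmod b"]
    unfolding power2_diff by linarith
  have cm: "(\<lambda>z. cnj (g z)) \<in> borel_measurable circle_measure"
    by (rule borel_measurable_continuous_on[OF _ m(2)]) (intro continuous_intros)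
  have "integrable circle_measure (\<lambda>z. (cmod (f z))\<^sup>2 + (cmod (g z))\<^sup>2)"
    using assms by (auto simp: square_integrable_def)
  then show ?thesis
    by (rule Bochner_Integration.integrable_bound) (use cm in \<open>auto simp: norm_mult le\<close>)
qed

quotient_type circle_L2 = "complex \<Rightarrow> complex" / partial:
  "\<lambda>f g. square_integrable f \<and> square_integrable g \<and> (AE z in circle_measure. f z = g z)"
proof (rule part_equivpI)
  show "\<exists>f. square_integrable f \<and> square_integrable f \<and> (AE z in circle_measure. f z = f z)"
    using square_integrable_zero by auto
  show "symp (\<lambda>f g. square_integrable f \<and> square_integrable g \<and> (AE z in circle_measure. f z = g z))"
    by (rule sympI) (auto elim: eventually_mono)
  show "transp (\<lambda>f g. square_integrable f \<and> square_integrable g \<and> (AE z in circle_measure. f z = g z))"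
    by (rule transpI) (auto elim: eventually_elim2)
qed

instantiation circle_L2 :: complex_inner
begin

lift_definition zero_circle_L2 :: circle_L2 is "\<lambda>_. 0"
  by (simp add: square_integrable_zero)

lift_definition plus_circle_L2 :: "circle_L2 \<Rightarrow> circle_L2 \<Rightarrow> circle_L2" is "\<lambda>f g z. f z + g z"
  by (auto simp: square_integrable_add elim: eventually_elim2)

lift_definition scaleC_circle_L2 :: "complex \<Rightarrow> circle_L2 \<Rightarrow> circle_L2" is "\<lambda>c f z. c * f z"
  by (auto simp: square_integrable_scale elim: eventually_mono)

lift_definition cinner_circle_L2 :: "circle_L2 \<Rightarrow> circle_L2 \<Rightarrow> complex" is
  "\<lambda>f g. \<integral>z. f z * cnj (g z) \<partial>circle_measure"
proof -
  fix f f' g g'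
  assume f: "square_integrable f \<and> square_integrable f' \<and> (AE z in circle_measure. f z = f' z)"
    and g: "square_integrable g \<and> square_integrable g' \<and> (AE z in circle_measure. g z = g' z)"
  show "(\<integral>z. f z * cnj (g z) \<partial>circle_measure) = (\<integral>z. f' z * cnj (g' z) \<partial>circle_measure)"
    using f g
    by (intro integral_cong_AE)
       (auto intro!: borel_measurable_integrable square_integrable_prod elim: eventually_elim2)
qed

definition uminus_circle_L2 :: "circle_L2 \<Rightarrow> circle_L2" where
  "uminus_circle_L2 f = (-1) *\<^sub>C f"

definition minus_circle_L2 :: "circle_L2 \<Rightarrow> circle_L2 \<Rightarrow> circle_L2" where
  "minus_circle_L2 f g = f + (-1) *\<^sub>C g"

definition scaleR_circle_L2 :: "real \<Rightarrow> circle_L2 \<Rightarrow> circle_L2" where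
  "scaleR_circle_L2 r f = complex_of_real r *\<^sub>C f"

definition inner_circle_L2 :: "circle_L2 \<Rightarrow> circle_L2 \<Rightarrow> real" where
  "inner_circle_L2 f g = Re (cinner f g)"

definition norm_circle_L2 :: "circle_L2 \<Rightarrow> real" where
  "norm_circle_L2 f = sqrt (inner f f)"

definition dist_circle_L2 :: "circle_L2 \<Rightarrow> circle_L2 \<Rightarrow> real" where
  "dist_circle_L2 f g = norm (f - g)"

definition sgn_circle_L2 :: "circle_L2 \<Rightarrow> circle_L2" where
  "sgn_circle_L2 f = inverse (norm f) *\<^sub>R f"

definition uniformity_circle_L2 :: "(circle_L2 \<times> circle_L2) filter" where
  "uniformity_circle_L2 = (INF e\<in>{0<..}. principal {(f, g). dist f g < e})"

definition open_circle_L2 :: "circle_L2 set \<Rightarrow> bool" where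
  "open_circle_L2 U \<longleftrightarrow> (\<forall>f\<in>U. eventually (\<lambda>(f', g). f' = f \<longrightarrow> g \<in> U) uniformity)"

instance
proof
  fix f g h :: circle_L2 and c d :: complex and r s :: real
  show add: "f + g + h = f + (g + h)" "f + g = g + f" "0 + f = f" for f g h :: circle_L2
    by (transfer, simp add: square_integrable_add add_ac)+
  show add_right: "c *\<^sub>C (f + g) = c *\<^sub>C f + c *\<^sub>C g" for c and f g :: circle_L2
    by transfer (simp add: square_integrable_add square_integrable_scale distrib_left)
  show add_left: "(c + d) *\<^sub>C f = c *\<^sub>C f + d *\<^sub>C f" for c d and f :: circle_L2
    by transfer (simp add: square_integrable_add square_integrable_scale distrib_right)
  show scale: "c *\<^sub>C d *\<^sub>C f = (c * d) *\<^sub>C f" for c d and f :: circle_L2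
    by transfer (simp add: square_integrable_scale mult.assoc)
  have one: "1 *\<^sub>C f = f" for f :: circle_L2
    by transfer simp
  have zero: "0 *\<^sub>C f = 0" for f :: circle_L2
    by transfer (simp add: square_integrable_zero)
  show "r *\<^sub>R f = complex_of_real r *\<^sub>C f"
    by (simp add: scaleR_circle_L2_def)
  show "- f + f = 0"
    using add_left[of "-1" 1 f] by (simp add: uminus_circle_L2_def one zero)
  show "f - g = f + - g"
    by (simp add: uminus_circle_L2_def minus_circle_L2_def)
  show "r *\<^sub>R (f + g) = r *\<^sub>R f + r *\<^sub>R g"
    by (simp add: scaleR_circle_L2_def add_right)
  show "(r + s) *\<^sub>R f = r *\<^sub>R f + s *\<^sub>R f"
    by (simp add: scaleR_circle_L2_def add_left)
  show "r *\<^sub>R s *\<^sub>R f = (r * s) *\<^sub>R f"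
    by (simp add: scaleR_circle_L2_def scale)
  show "1 *\<^sub>R f = f"
    by (simp add: scaleR_circle_L2_def one)
  show "sgn f = inverse (norm f) *\<^sub>R f"
    by (simp add: sgn_circle_L2_def)
  show "dist f g = norm (f - g)"
    by (simp add: dist_circle_L2_def)
  show "uniformity = (INF e\<in>{0<..}. principal {(f, g :: circle_L2). dist f g < e})"
    by (simp add: uniformity_circle_L2_def)
  show "open U \<longleftrightarrow> (\<forall>f\<in>U. eventually (\<lambda>(f', g). f' = f \<longrightarrow> g \<in> U) uniformity)"
    for U :: "circle_L2 set"
    by (simp add: open_circle_L2_def)
  show cc: "cinner f g = cnj (cinner g f)" for f g :: circle_L2
  proof transfer
    fix f g :: "complex \<Rightarrow> complex"
    show "(\<integral>z. f z * cnj (g z) \<partial>circle_measure) = cnj (\<integral>z. g z * cnj (f z) \<partial>circle_measure)"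
      by (simp add: Bochner_Integration.integral_cnj[symmetric] mult.commute del: Bochner_Integration.integral_cnj)
  qed
  show ca: "cinner (f + g) h = cinner f h + cinner g h" for f g h :: circle_L2
    by transfer (simp add: distrib_right square_integrable_prod)
  show cs: "cinner (c *\<^sub>C f) g = c * cinner f g" for c and f g :: circle_L2
    by transfer (simp add: mult.assoc)
  show "inner f g = Re (cinner f g)"
    by (simp add: inner_circle_L2_def)
  show "inner f g = inner g f"
    using arg_cong[OF cc[of f g], of Re] by (simp add: inner_circle_L2_def)
  show "inner (f + g) h = inner f h + inner g h"
    by (simp add: inner_circle_L2_def ca)
  show "inner (r *\<^sub>R f) g = r * inner f g"
    by (simp add: inner_circle_L2_def scaleR_circle_L2_def cs)
  have sq: "(\<integral>z. f z * cnj (f z) \<partial>circle_measure) =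
            complex_of_real (\<integral>z. (cmod (f z))\<^sup>2 \<partial>circle_measure)" for f :: "complex \<Rightarrow> complex"
    by (simp add: complex_norm_square[symmetric] del: of_real_power)
  show "0 \<le> inner f f"
    unfolding inner_circle_L2_def by transfer (simp add: sq)
  show "inner f f = 0 \<longleftrightarrow> f = 0"
    unfolding inner_circle_L2_def
    by transfer (auto simp: sq square_integrable_zero integral_nonneg_eq_0_iff_AE square_integrable_def)
  show "norm f = sqrt (inner f f)"
    by (simp add: norm_circle_L2_def)
qed

end

lemma L2_add:
  assumes "square_integrable f" "square_integrable g"
  shows "abs_circle_L2 (\<lambda>z. f z + g z) = abs_circle_L2 f + abs_circle_L2 g"
  using assms by (simp add: plus_circle_L2.abs_eq)

lemma L2_scale:
  assumes "square_integrable f"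
  shows "abs_circle_L2 (\<lambda>z. c * f z) = c *\<^sub>C abs_circle_L2 f"
  using assms by (simp add: scaleC_circle_L2.abs_eq)

lemma tendsto_scaleC:
  fixes f :: "'b \<Rightarrow> 'a::complex_inner"
  assumes "(f \<longlongrightarrow> l) F"
  shows "((\<lambda>x. c *\<^sub>C f x) \<longlongrightarrow> c *\<^sub>C l) F"
proof -
  have n: "norm (c *\<^sub>C x) = cmod c * norm x" for x :: 'a
  proof -
    have cr: "cinner x (c *\<^sub>C x) = cnj c * cinner x x" for x :: 'a
      using cinner_commute[of x "c *\<^sub>C x"] cinner_commute[of x x]
      by (simp add: cinner_scaleC_left)
    have "inner (c *\<^sub>C x) (c *\<^sub>C x) = (cmod c)\<^sup>2 * inner x x"
      by (simp add: inner_eq_Re_cinner cinner_scaleC_left cr mult.assoc[symmetric]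
            complex_norm_square[symmetric] del: of_real_power)
    then show ?thesis
      by (simp add: norm_eq_sqrt_inner real_sqrt_mult)
  qed
  have "bounded_linear (\<lambda>x::'a. c *\<^sub>C x)"
    by (rule bounded_linear_intro[where K = "cmod c"])
       (simp_all add: scaleC_add_right scaleR_eq_scaleC scaleC_scaleC n mult.commute)
  then show ?thesis
    using assms by (rule bounded_linear.tendsto)
qed


section \<open>The Hardy space\<close>

definition hardy_function :: "(complex \<Rightarrow> complex) \<Rightarrow> bool" where
  "hardy_function F \<longleftrightarrow> F holomorphic_on ball 0 1 \<and>
     bdd_above ((\<lambda>r. \<integral>z. (cmod (F (of_real r * z)))\<^sup>2 \<partial>circle_measure) ` {0..<1})"

text \<open>
  The boundary function of a member \<open>F\<close> of the Hardy space is the limit in $L^2$ of the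
  dilates $z \mapsto F(rz)$ as $r \to 1^-$; it is almost everywhere equal to the radial limit.
\<close>

definition has_boundary_function :: "(complex \<Rightarrow> complex) \<Rightarrow> circle_L2 \<Rightarrow> bool" where
  "has_boundary_function F f \<longleftrightarrow>
     ((\<lambda>r. abs_circle_L2 (\<lambda>z. F (of_real r * z))) \<longlongrightarrow> f) (at_left 1)"

lemma square_integrable_dilate:
  assumes F: "F holomorphic_on ball 0 1" and r: "0 \<le> r" "r < 1"
  shows "square_integrable (\<lambda>z. F (of_real r * z))"
proof -
  interpret prob_space circle_measure by (rule prob_space_circle_measure)
  have cont: "continuous_on (sphere 0 1) (\<lambda>z. F (of_real r * z))"
    using r by (intro continuous_on_compose2[OF holomorphic_on_imp_continuous_on[OF F]]
      continuous_intros) (auto simp: norm_mult)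
  then have meas: "(\<lambda>z. F (of_real r * z)) \<in> borel_measurable circle_measure"
    by (subst measurable_cong_sets[OF sets_circle_measure refl])
       (rule borel_measurable_continuous_on_restrict)
  have "compact ((\<lambda>z. F (of_real r * z)) ` sphere 0 1)"
    by (rule compact_continuous_image[OF cont]) (rule compact_sphere)
  then have "bounded ((\<lambda>z. F (of_real r * z)) ` sphere 0 1)"
    by (rule compact_imp_bounded)
  then obtain B where "\<forall>w\<in>(\<lambda>z. F (of_real r * z)) ` sphere 0 1. cmod w \<le> B"
    unfolding bounded_iff ..
  then have B: "\<And>z. z \<in> sphere 0 1 \<Longrightarrow> cmod (F (of_real r * z)) \<le> B"
    by simp
  have "integrable circle_measure (\<lambda>z. (cmod (F (of_real r * z)))\<^sup>2)"
  proof (rule integrable_const_bound)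
    show "AE z in circle_measure. norm ((cmod (F (of_real r * z)))\<^sup>2) \<le> B\<^sup>2"
      by (rule AE_I2) (auto simp: space_circle_measure intro!: power_mono B)
  qed (use meas in measurable)
  then show ?thesis
    using meas by (simp add: square_integrable_def)
qed

lemma hardy_add:
  assumes "hardy_function F" "hardy_function G"
  shows "hardy_function (\<lambda>z. F z + G z)"
proof -
  let ?I = "\<lambda>F r. \<integral>z. (cmod (F (complex_of_real r * z)))\<^sup>2 \<partial>circle_measure"
  obtain A B where AB: "\<And>r. r \<in> {0..<1} \<Longrightarrow> ?I F r \<le> A" "\<And>r. r \<in> {0..<1} \<Longrightarrow> ?I G r \<le> B"
    using assms unfolding hardy_function_def bdd_above_def by fast
  have "?I (\<lambda>z. F z + G z) r \<le> 2 * A + 2 * B" if r: "r \<in> {0..<1}" for r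
  proof -
    have sq: "square_integrable (\<lambda>z. F (of_real r * z))" "square_integrable (\<lambda>z. G (of_real r * z))"
      using assms r by (auto simp: hardy_function_def intro!: square_integrable_dilate)
    have "?I (\<lambda>z. F z + G z) r \<le>
        (\<integral>z. 2 * (cmod (F (of_real r * z)))\<^sup>2 + 2 * (cmod (G (of_real r * z)))\<^sup>2 \<partial>circle_measure)"
      using sq square_integrable_add[OF sq]
      by (intro integral_mono cmod_add_square_le) (auto simp: square_integrable_def)
    also have "\<dots> = 2 * ?I F r + 2 * ?I G r"
      using sq by (simp add: square_integrable_def)
    finally show ?thesis
      using AB[OF r] by linarith
  qed
  then show ?thesis
    using assms unfolding hardy_function_def
    by (auto intro!: holomorphic_intros bdd_aboveI2[where M = "2 * A + 2 * B"])
qed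

lemma hardy_scale:
  assumes "hardy_function F"
  shows "hardy_function (\<lambda>z. c * F z)"
proof -
  let ?I = "\<lambda>F r. \<integral>z. (cmod (F (complex_of_real r * z)))\<^sup>2 \<partial>circle_measure"
  obtain A where A: "\<And>r. r \<in> {0..<1} \<Longrightarrow> ?I F r \<le> A"
    using assms unfolding hardy_function_def bdd_above_def by fast
  have "?I (\<lambda>z. c * F z) r \<le> (cmod c)\<^sup>2 * A" if "r \<in> {0..<1}" for r
    using A[OF that] by (simp add: norm_mult power_mult_distrib mult_left_mono)
  then show ?thesis
    using assms unfolding hardy_function_def
    by (auto intro!: holomorphic_intros bdd_aboveI2[where M = "(cmod c)\<^sup>2 * A"])
qed

lemma eventually_dilate:
  assumes "hardy_function F"
  shows "eventually (\<lambda>r. square_integrable (\<lambda>z. F (of_real r * z))) (at_left 1)"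
proof (rule eventually_mono)
  show "\<forall>\<^sub>F r in at_left 1. r \<in> {0<..<1::real}"
    by (rule eventually_at_left_real) simp
  show "square_integrable (\<lambda>z. F (of_real r * z))" if "r \<in> {0<..<1}" for r
    using assms that by (auto simp: hardy_function_def intro: square_integrable_dilate)
qed

lemma has_boundary_function_add:
  assumes "hardy_function F" "hardy_function G"
    "has_boundary_function F f" "has_boundary_function G g"
  shows "has_boundary_function (\<lambda>z. F z + G z) (f + g)"
  unfolding has_boundary_function_def
proof (rule Lim_transform_eventually)
  show "((\<lambda>r. abs_circle_L2 (\<lambda>z. F (of_real r * z)) + abs_circle_L2 (\<lambda>z. G (of_real r * z)))
          \<longlongrightarrow> f + g) (at_left 1)"
    using assms unfolding has_boundary_function_def by (intro tendsto_add)
  show "\<forall>\<^sub>F r in at_left 1. abs_circle_L2 (\<lambda>z. F (of_real r * z)) + abs_circle_L2 (\<lambda>z. G (of_real r * z))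
          = abs_circle_L2 (\<lambda>z. F (of_real r * z) + G (of_real r * z))"
    using eventually_dilate[OF assms(1)] eventually_dilate[OF assms(2)]
    by eventually_elim (simp add: L2_add)
qed

lemma has_boundary_function_scale:
  assumes "hardy_function F" "has_boundary_function F f"
  shows "has_boundary_function (\<lambda>z. c * F z) (c *\<^sub>C f)"
  unfolding has_boundary_function_def
proof (rule Lim_transform_eventually)
  show "((\<lambda>r. c *\<^sub>C abs_circle_L2 (\<lambda>z. F (of_real r * z))) \<longlongrightarrow> c *\<^sub>C f) (at_left 1)"
    using assms unfolding has_boundary_function_def by (intro tendsto_scaleC)
  show "\<forall>\<^sub>F r in at_left 1. c *\<^sub>C abs_circle_L2 (\<lambda>z. F (of_real r * z))
          = abs_circle_L2 (\<lambda>z. c * F (of_real r * z))"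
    using eventually_dilate[OF assms(1)] by eventually_elim (simp add: L2_scale)
qed

typedef hardy2 = "{f. \<exists>F. hardy_function F \<and> has_boundary_function F f}"
proof -
  have "abs_circle_L2 (\<lambda>_. 0) = 0"
    by (simp add: zero_circle_L2_def)
  then have "hardy_function (\<lambda>_. 0) \<and> has_boundary_function (\<lambda>_. 0) 0"
    by (auto simp: hardy_function_def has_boundary_function_def intro: bdd_aboveI2[where M = 0])
  then show ?thesis
    by blast
qed

setup_lifting type_definition_hardy2

instantiation hardy2 :: complex_inner
begin

lift_definition zero_hardy2 :: hardy2 is 0
proof -
  obtain F and f :: circle_L2 where "hardy_function F" "has_boundary_function F f"
    using Rep_hardy2 by blast
  then have "hardy_function (\<lambda>z. 0 * F z) \<and> has_boundary_function (\<lambda>z. 0 * F z) (0 *\<^sub>C f)"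
    by (blast intro: hardy_scale has_boundary_function_scale)
  moreover have "0 *\<^sub>C f = 0"
    using scaleR_eq_scaleC[of 0 f] by simp
  ultimately show "\<exists>F. hardy_function F \<and> has_boundary_function F 0"
    by auto
qed

lift_definition plus_hardy2 :: "hardy2 \<Rightarrow> hardy2 \<Rightarrow> hardy2" is "(+)"
  by (blast intro: hardy_add has_boundary_function_add)

lift_definition scaleC_hardy2 :: "complex \<Rightarrow> hardy2 \<Rightarrow> hardy2" is "(*\<^sub>C)"
  by (blast intro: hardy_scale has_boundary_function_scale)

lift_definition cinner_hardy2 :: "hardy2 \<Rightarrow> hardy2 \<Rightarrow> complex" is cinner .

definition uminus_hardy2 :: "hardy2 \<Rightarrow> hardy2" where
  "uminus_hardy2 f = (-1) *\<^sub>C f"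

definition minus_hardy2 :: "hardy2 \<Rightarrow> hardy2 \<Rightarrow> hardy2" where
  "minus_hardy2 f g = f + (-1) *\<^sub>C g"

definition scaleR_hardy2 :: "real \<Rightarrow> hardy2 \<Rightarrow> hardy2" where
  "scaleR_hardy2 r f = complex_of_real r *\<^sub>C f"

definition inner_hardy2 :: "hardy2 \<Rightarrow> hardy2 \<Rightarrow> real" where
  "inner_hardy2 f g = Re (cinner f g)"

definition norm_hardy2 :: "hardy2 \<Rightarrow> real" where
  "norm_hardy2 f = sqrt (inner f f)"

definition dist_hardy2 :: "hardy2 \<Rightarrow> hardy2 \<Rightarrow> real" where
  "dist_hardy2 f g = norm (f - g)"

definition sgn_hardy2 :: "hardy2 \<Rightarrow> hardy2" where
  "sgn_hardy2 f = inverse (norm f) *\<^sub>R f"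

definition uniformity_hardy2 :: "(hardy2 \<times> hardy2) filter" where
  "uniformity_hardy2 = (INF e\<in>{0<..}. principal {(f, g). dist f g < e})"

definition open_hardy2 :: "hardy2 set \<Rightarrow> bool" where
  "open_hardy2 U \<longleftrightarrow> (\<forall>f\<in>U. eventually (\<lambda>(f', g). f' = f \<longrightarrow> g \<in> U) uniformity)"

instance
proof
  fix f g h :: hardy2 and c d :: complex and r s :: real
  have one: "1 *\<^sub>C x = x" for x :: circle_L2
    using scaleR_eq_scaleC[of 1 x] by simp
  have zero: "0 *\<^sub>C x = 0" for x :: circle_L2
    using scaleR_eq_scaleC[of 0 x] by simp
  show "f + g + h = f + (g + h)" "f + g = g + f" "0 + f = f"
    by (transfer, simp add: add_ac)+
  show "c *\<^sub>C (f + g) = c *\<^sub>C f + c *\<^sub>C g"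
    by transfer (rule scaleC_add_right)
  show "(c + d) *\<^sub>C f = c *\<^sub>C f + d *\<^sub>C f"
    by transfer (rule scaleC_add_left)
  show "c *\<^sub>C d *\<^sub>C f = (c * d) *\<^sub>C f"
    by transfer (rule scaleC_scaleC)
  show "r *\<^sub>R f = complex_of_real r *\<^sub>C f"
    by (simp add: scaleR_hardy2_def)
  show "- f + f = 0"
    unfolding uminus_hardy2_def
  proof transfer
    fix x :: circle_L2
    show "(-1) *\<^sub>C x + x = 0"
      using scaleC_add_left[of "-1" 1 x] by (simp add: one zero)
  qed
  show "f - g = f + - g"
    by (simp add: uminus_hardy2_def minus_hardy2_def)
  show "r *\<^sub>R (f + g) = r *\<^sub>R f + r *\<^sub>R g"
    unfolding scaleR_hardy2_def by transfer (rule scaleC_add_right)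
  show "(r + s) *\<^sub>R f = r *\<^sub>R f + s *\<^sub>R f"
    unfolding scaleR_hardy2_def by transfer (simp add: scaleC_add_left)
  show "r *\<^sub>R s *\<^sub>R f = (r * s) *\<^sub>R f"
    unfolding scaleR_hardy2_def by transfer (simp add: scaleC_scaleC)
  show "1 *\<^sub>R f = f"
    unfolding scaleR_hardy2_def by transfer (simp add: one)
  show "sgn f = inverse (norm f) *\<^sub>R f"
    by (simp add: sgn_hardy2_def)
  show "dist f g = norm (f - g)"
    by (simp add: dist_hardy2_def)
  show "uniformity = (INF e\<in>{0<..}. principal {(f, g :: hardy2). dist f g < e})"
    by (simp add: uniformity_hardy2_def)
  show "open U \<longleftrightarrow> (\<forall>f\<in>U. eventually (\<lambda>(f', g). f' = f \<longrightarrow> g \<in> U) uniformity)"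
    for U :: "hardy2 set"
    by (simp add: open_hardy2_def)
  show "cinner f g = cnj (cinner g f)"
    by transfer (rule cinner_commute)
  show "cinner (f + g) h = cinner f h + cinner g h"
    by transfer (rule cinner_add_left)
  show "cinner (c *\<^sub>C f) g = c * cinner f g"
    by transfer (rule cinner_scaleC_left)
  show "inner f g = Re (cinner f g)"
    by (simp add: inner_hardy2_def)
  show "inner f g = inner g f"
    unfolding inner_hardy2_def
    by transfer (simp add: inner_eq_Re_cinner[symmetric] inner_commute)
  show "inner (f + g) h = inner f h + inner g h"
    unfolding inner_hardy2_def by transfer (simp add: cinner_add_left)
  show "inner (r *\<^sub>R f) g = r * inner f g"
    unfolding inner_hardy2_def scaleR_hardy2_def by transfer (simp add: cinner_scaleC_left)
  show "0 \<le> inner f f"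
    unfolding inner_hardy2_def by transfer (simp add: inner_eq_Re_cinner[symmetric])
  show "inner f f = 0 \<longleftrightarrow> f = 0"
    unfolding inner_hardy2_def by transfer (simp add: inner_eq_Re_cinner[symmetric])
  show "norm f = sqrt (inner f f)"
    by (simp add: norm_hardy2_def)
qed

end


section \<open>Toeplitz operators and the conjugations $C_{\omega,a}$\<close>

definition hardy_projection :: "circle_L2 \<Rightarrow> hardy2" where
  "hardy_projection f = (THE h. \<forall>g. cinner (f - Rep_hardy2 h) (Rep_hardy2 g) = 0)"

text \<open>
  Only values of the symbol on the unit circle matter, and the definition is meaningful for
  symbols that are measurable and essentially bounded there.
\<close>

definition toeplitz :: "(complex \<Rightarrow> complex) \<Rightarrow> hardy2 \<Rightarrow> hardy2" where
  "toeplitz \<phi> f =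
     hardy_projection (abs_circle_L2 (\<lambda>z. \<phi> z * rep_circle_L2 (Rep_hardy2 f) z))"

definition disk_involution :: "complex \<Rightarrow> complex \<Rightarrow> complex" where
  "disk_involution a z = (a - z) / (1 - cnj a * z)"

definition normalized_kernel :: "complex \<Rightarrow> complex \<Rightarrow> complex" where
  "normalized_kernel a z = of_real (sqrt (1 - (cmod a)\<^sup>2)) * (1 / (1 - cnj a * z))"

definition hardy_basis :: "complex \<Rightarrow> nat \<Rightarrow> hardy2" where
  "hardy_basis a m =
     Abs_hardy2 (abs_circle_L2 (\<lambda>z. disk_involution a z ^ m * normalized_kernel a z))"

text \<open>
  The vectors \<open>hardy_basis a m\<close> form an orthonormal basis when \<open>cmod a < 1\<close>, so the
  coefficients \<open>\<mu>\<close> and the value exist and are unique for every \<open>f\<close>.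
\<close>

definition C_conj :: "complex \<Rightarrow> complex \<Rightarrow> hardy2 \<Rightarrow> hardy2" where
  "C_conj \<omega> a f = (THE g. \<exists>\<mu>. (\<lambda>m. \<mu> m *\<^sub>C hardy_basis a m) sums f \<and>
                          (\<lambda>m. (cnj (\<mu> m) * cnj \<omega> ^ m) *\<^sub>C hardy_basis a m) sums g)"


section \<open>Nowhere winding curves\<close>

text \<open>
  Curves are parametrized over $[0,1]$; \<open>winding_number\<close> is the Cauchy integral
  whenever the curve is piecewise continuously differentiable (\<open>winding_number_valid_path\<close>).
\<close>

definition nowhere_winding :: "(real \<Rightarrow> complex) \<Rightarrow> bool" where
  "nowhere_winding \<gamma> \<longleftrightarrow> path \<gamma> \<and> pathfinish \<gamma> = pathstart \<gamma> \<and>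
     (\<forall>z. z \<notin> path_image \<gamma> \<longrightarrow> winding_number \<gamma> z = 0)"

end

theory Submission
  imports Defs
begin

text \<open>
  On the circle the symbol is the rational function \<open>\<Phi>(z) = z + R(z)\<close> with
  \<open>R(z) = cnj q * (1 - cnj b * z) / (b - z)\<close>, and clearing denominators turns \<open>\<Phi>(z) = w\<close> into a quadratic
  equation whose roots satisfy \<open>z1 + z2 = w + \<beta>\<close> and \<open>z1 * z2 = w * b - cnj q\<close>, where
  \<open>\<beta> = b - cnj q * cnj b\<close>.  The winding number about \<open>w\<close> is the number of roots in the disc minus one
  (\<open>winding_number_symbol\<close>), and \<open>\<beta> = 0\<close> is the condition \<open>q * b = cnj b\<close>.

  If \<open>\<beta> = 0\<close>, then \<open>z2 = R(z1)\<close> and \<open>R\<close> exchanges the inside and the outside of the circle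
  (\<open>paired_roots\<close>), so the curve is nowhere winding.  Moreover \<open>z \<mapsto> cnj (q * disk_involution b z)\<close>, which agrees
  with \<open>R\<close> on the circle, is an antiholomorphic involution of the disc.  It has a fixed point \<open>a\<close> in the
  disc, around which it is conjugate to a reflection in a line.  Consequently the conjugation \<open>C_conj \<omega> a\<close> with
  \<open>\<omega> = - cnj q\<close> intertwines the shift with \<open>q\<close> times multiplication by \<open>disk_involution b\<close>
  (\<open>C_conj_shift\<close>), and taking adjoints gives the symmetry of the operator (\<open>toep_C_symmetric\<close>).

  If \<open>\<beta> \<noteq> 0\<close>, there is a point \<open>w\<close> with both roots in the disc (\<open>two_roots_in_disk\<close>).  There the winding
  number is 1, and correspondingly $T - w$ has index $-1$: it is injective (\<open>toep_no_eigenvector\<close>)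
  while $T^* - \bar w$ is not (\<open>toep_adj_eigenvector\<close>).  For a UET operator these two kernels are
  isomorphic (\<open>UET_eigenvector\<close>), so the operator is not UET, still less complex symmetric.
  It is not normal either, since normality forces \<open>b = 0\<close> (\<open>normal_toep_imp_zero\<close>).

  All of this is a computation with holomorphic functions once an element of \<open>hardy2\<close> is identified with
  its values in the disc (\<open>ev\<close>) and the operator is written through multiplication operators and
  their adjoints (\<open>toeplitz_eq_toep\<close>).  What needs analysis is that \<open>C_conj\<close> is a conjugation: the
  systems \<open>hardy_basis a\<close> have to be total (\<open>hardy_basis_total\<close>), and every square summable sequence of
  coefficients has to belong to a vector, for which \<open>hardy2\<close> is shown to be complete.
\<close>

section \<open>Complex inner product spaces\<close>

lemma scaleC_one [simp]: "1 *\<^sub>C x = (x::'a::complex_inner)"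
  using scaleR_eq_scaleC[of 1 x] by simp

lemma scaleC_zero_left [simp]: "0 *\<^sub>C x = (0::'a::complex_inner)"
  using scaleR_eq_scaleC[of 0 x] by simp

lemma scaleC_zero_right [simp]: "c *\<^sub>C 0 = (0::'a::complex_inner)"
  using scaleC_add_right[of c 0 0] by simp

lemma scaleC_minus_one: "(-1) *\<^sub>C x = - (x::'a::complex_inner)"
  using scaleR_eq_scaleC[of "-1" x] by simp

lemma cinner_zero_left [simp]: "cinner 0 (x::'a::complex_inner) = 0"
  using cinner_scaleC_left[of 0 0 x] by simp

lemma cinner_add_right: "cinner x (y + z) = cinner x y + cinner x (z::'a::complex_inner)"
  by (metis cinner_add_left cinner_commute complex_cnj_add)

lemma cinner_scaleC_right: "cinner x (c *\<^sub>C y) = cnj c * cinner x (y::'a::complex_inner)"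
  by (metis cinner_scaleC_left cinner_commute complex_cnj_mult)

lemma cinner_zero_right [simp]: "cinner (x::'a::complex_inner) 0 = 0"
  using cinner_commute[of x 0] by simp

lemma cinner_minus_left: "cinner (- x) y = - cinner x (y::'a::complex_inner)"
  using cinner_scaleC_left[of "-1" x y] by (simp add: scaleC_minus_one)

lemma cinner_minus_right: "cinner x (- y) = - cinner x (y::'a::complex_inner)"
  using cinner_scaleC_right[of x "-1" y] by (simp add: scaleC_minus_one)

lemma cinner_diff_left: "cinner (x - y) z = cinner x z - cinner y (z::'a::complex_inner)"
  using cinner_add_left[of x "- y" z] by (simp add: cinner_minus_left)

lemma cinner_diff_right: "cinner x (y - z) = cinner x y - cinner x (z::'a::complex_inner)"
  using cinner_add_right[of x y "- z"] by (simp add: cinner_minus_right)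

lemma cinner_sum_left: "cinner (\<Sum>i\<in>A. f i) y = (\<Sum>i\<in>A. cinner (f i) (y::'a::complex_inner))"
  by (induction A rule: infinite_finite_induct) (simp_all add: cinner_add_left)

lemma cinner_self: "cinner x x = of_real ((norm (x::'a::complex_inner))\<^sup>2)"
  using cinner_commute[of x x] inner_eq_Re_cinner[of x x]
  by (simp add: complex_eq_iff power2_norm_eq_inner)

lemma norm_scaleC: "norm (c *\<^sub>C x) = cmod c * norm (x::'a::complex_inner)"
proof -
  have "cinner (c *\<^sub>C x) (c *\<^sub>C x) = (c * cnj c) * cinner x x"
    by (simp add: cinner_scaleC_left cinner_scaleC_right)
  then have "complex_of_real ((norm (c *\<^sub>C x))\<^sup>2) = of_real ((cmod c * norm x)\<^sup>2)"
    by (simp only: cinner_self complex_norm_square[symmetric] of_real_mult[symmetric] power_mult_distrib)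
  then show ?thesis
    by (simp only: of_real_eq_iff power2_eq_iff_nonneg norm_ge_zero mult_nonneg_nonneg)
qed

lemma cinner_Cauchy_Schwarz: "cmod (cinner x y) \<le> norm x * norm (y::'a::complex_inner)"
proof (cases "cinner x y = 0")
  case False
  \<comment> \<open>Rotating \<open>x\<close> makes the inner product nonnegative, so that the real inequality applies.\<close>
  define c where "c = cnj (sgn (cinner x y))"
  have c: "cmod c = 1"
    using False by (simp add: c_def norm_sgn)
  have "c * cinner x y = of_real (cmod (cinner x y))"
    using False
    by (simp add: c_def sgn_eq mult.commute[of _ "cinner x y"] complex_norm_square[symmetric] power2_eq_square)
  then have "cmod (cinner x y) = inner (c *\<^sub>C x) y"
    by (simp add: inner_eq_Re_cinner cinner_scaleC_left)
  also have "\<dots> \<le> norm (c *\<^sub>C x) * norm y"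
    by (rule norm_cauchy_schwarz)
  finally show ?thesis
    by (simp add: norm_scaleC c)
qed simp

lemma bounded_linear_cinner_left: "bounded_linear (\<lambda>x. cinner x (y::'a::complex_inner))"
proof (rule bounded_linear_intro[where K = "norm y"])
  show "cmod (cinner x y) \<le> norm x * norm y" for x
    by (rule cinner_Cauchy_Schwarz)
qed (simp_all add: cinner_add_left scaleR_eq_scaleC cinner_scaleC_left scaleR_conv_of_real)

lemma cadjoint_eqI:
  fixes T S :: "'a::complex_inner \<Rightarrow> 'a"
  assumes "\<And>x y. cinner (T x) y = cinner x (S y)"
  shows "cadjoint T = S"
  unfolding cadjoint_def
proof (rule the_equality)
  show "\<forall>x y. cinner (T x) y = cinner x (S y)"
    using assms by blast
next
  fix S' assume S': "\<forall>x y. cinner (T x) y = cinner x (S' y)"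
  show "S' = S"
  proof
    fix y
    have "cinner (S' y - S y) (S' y - S y) = 0"
      using S' assms cinner_diff_right by (metis cancel_comm_monoid_add_class.diff_cancel)
    then show "S' y = S y"
      by (simp add: cinner_self)
  qed
qed

section \<open>Orthonormal series\<close>

definition orthonormal_seq :: "(nat \<Rightarrow> 'a::complex_inner) \<Rightarrow> bool" where
  "orthonormal_seq e \<longleftrightarrow> (\<forall>m n. cinner (e m) (e n) = (if m = n then 1 else 0))"

lemma norm_orthonormal_sum:
  fixes e :: "nat \<Rightarrow> 'a::complex_inner"
  assumes "orthonormal_seq e" "finite A"
  shows "(norm (\<Sum>m\<in>A. c m *\<^sub>C e m))\<^sup>2 = (\<Sum>m\<in>A. (cmod (c m))\<^sup>2)"
proof -
  have "cinner (e m) (\<Sum>n\<in>A. c n *\<^sub>C e n) = cnj (c m)" if "m \<in> A" for m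
  proof -
    have "cinner (\<Sum>n\<in>A. c n *\<^sub>C e n) (e m) = (\<Sum>n\<in>A. if n = m then c n else 0)"
      using assms(1) unfolding cinner_sum_left cinner_scaleC_left orthonormal_seq_def
      by (intro sum.cong) auto
    also have "\<dots> = c m"
      using that assms(2) by simp
    finally show ?thesis
      using cinner_commute[of "e m"] by metis
  qed
  then have "cinner (\<Sum>m\<in>A. c m *\<^sub>C e m) (\<Sum>n\<in>A. c n *\<^sub>C e n) = (\<Sum>m\<in>A. c m * cnj (c m))"
    by (simp add: cinner_sum_left[of _ A] cinner_scaleC_left)
  also have "\<dots> = of_real (\<Sum>m\<in>A. (cmod (c m))\<^sup>2)"
    by (simp only: of_real_sum complex_norm_square)
  finally show ?thesis
    by (simp only: cinner_self of_real_eq_iff)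
qed

lemma orthonormal_sums_coefficient:
  fixes e :: "nat \<Rightarrow> 'a::complex_inner"
  assumes "orthonormal_seq e" "(\<lambda>m. c m *\<^sub>C e m) sums x"
  shows "cinner x (e n) = c n"
proof -
  have "(\<lambda>m. cinner (c m *\<^sub>C e m) (e n)) sums cinner x (e n)"
    using bounded_linear.sums[OF bounded_linear_cinner_left assms(2)] .
  moreover have "(\<lambda>m. cinner (c m *\<^sub>C e m) (e n)) = (\<lambda>m. if m = n then c m else 0)"
    using assms(1) by (auto simp: orthonormal_seq_def cinner_scaleC_left)
  ultimately show ?thesis
    using sums_single[of n c] sums_unique2 by metis
qed

lemma Bessel:
  fixes e :: "nat \<Rightarrow> 'a::complex_inner"
  assumes "orthonormal_seq e"
  shows "(\<Sum>m<n. (cmod (cinner x (e m)))\<^sup>2) \<le> (norm x)\<^sup>2"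
proof -
  define s where "s = (\<Sum>m<n. cinner x (e m) *\<^sub>C e m)"
  have s: "(norm s)\<^sup>2 = (\<Sum>m<n. (cmod (cinner x (e m)))\<^sup>2)"
    unfolding s_def using assms by (intro norm_orthonormal_sum) auto
  have "cinner s x = of_real ((norm s)\<^sup>2)"
    unfolding s unfolding s_def cinner_sum_left cinner_scaleC_left of_real_sum complex_norm_square
    by (intro sum.cong refl arg_cong2[where f = "(*)"]) (rule cinner_commute)
  then have "inner s x = (norm s)\<^sup>2"
    by (simp add: inner_eq_Re_cinner)
  then have "(norm s)\<^sup>2 \<le> norm s * norm x"
    using norm_cauchy_schwarz[of s x] by simp
  then have "norm s \<le> norm x"
    by (cases "norm s = 0") (auto simp: power2_eq_square)
  then show ?thesis
    using s power_mono[of "norm s" "norm x" 2] by simp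
qed

lemma orthonormal_summable:
  fixes e :: "nat \<Rightarrow> 'a::{complex_inner, banach}"
  assumes "orthonormal_seq e" "summable (\<lambda>m. (cmod (c m))\<^sup>2)"
  shows "summable (\<lambda>m. c m *\<^sub>C e m)"
  unfolding summable_Cauchy
proof (intro allI impI)
  fix r :: real assume r: "r > 0"
  then have "r\<^sup>2 > 0"
    by simp
  then obtain N where N: "\<And>m n. m \<ge> N \<Longrightarrow> norm (\<Sum>k\<in>{m..<n}. (cmod (c k))\<^sup>2) < r\<^sup>2"
    using assms(2) unfolding summable_Cauchy by meson
  have "norm (\<Sum>k\<in>{m..<n}. c k *\<^sub>C e k) < r" if "m \<ge> N" for m n
  proof -
    have "(norm (\<Sum>k\<in>{m..<n}. c k *\<^sub>C e k))\<^sup>2 < r\<^sup>2"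
      using N[OF that, of n] norm_orthonormal_sum[OF assms(1), of "{m..<n}" c] by simp
    then show ?thesis
      using r by (simp add: power_less_imp_less_base)
  qed
  then show "\<exists>N. \<forall>m\<ge>N. \<forall>n. norm (\<Sum>k\<in>{m..<n}. c k *\<^sub>C e k) < r"
    by blast
qed

lemma orthonormal_expansion_summable:
  fixes e :: "nat \<Rightarrow> 'a::{complex_inner, banach}"
  assumes "orthonormal_seq e"
  shows "summable (\<lambda>m. cinner x (e m) *\<^sub>C e m)"
proof (rule orthonormal_summable[OF assms])
  show "summable (\<lambda>m. (cmod (cinner x (e m)))\<^sup>2)"
    by (rule summableI_nonneg_bounded[where x = "(norm x)\<^sup>2"]) (simp_all add: Bessel[OF assms])
qed


section \<open>The space $L^2$ of the circle\<close>

interpretation circle: prob_space circle_measure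
  by (rule prob_space_circle_measure)

lemma circle_measurable_continuous:
  assumes "continuous_on (sphere 0 1) f"
  shows "f \<in> borel_measurable circle_measure"
  by (subst measurable_cong_sets[OF sets_circle_measure refl])
     (rule borel_measurable_continuous_on_restrict[OF assms])

lemma square_integrable_bounded:
  assumes "f \<in> borel_measurable circle_measure" "\<And>z. cmod z = 1 \<Longrightarrow> cmod (f z) \<le> B"
  shows "square_integrable f"
proof -
  have "integrable circle_measure (\<lambda>z. (cmod (f z))\<^sup>2)"
  proof (rule circle.integrable_const_bound)
    show "AE z in circle_measure. norm ((cmod (f z))\<^sup>2) \<le> B\<^sup>2"
      by (rule AE_I2) (auto simp: space_circle_measure intro!: power_mono assms)
  qed (use assms in measurable)
  then show ?thesis
    using assms by (simp add: square_integrable_def)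
qed

lemma bounded_on_circle:
  assumes "continuous_on (sphere 0 1) (f :: complex \<Rightarrow> complex)"
  obtains B where "\<And>z. cmod z = 1 \<Longrightarrow> cmod (f z) \<le> B"
proof -
  have "bounded (f ` sphere 0 1)"
    by (rule compact_imp_bounded[OF compact_continuous_image[OF assms]]) simp
  then show ?thesis
    using that by (force simp: bounded_iff)
qed

lemma square_integrable_continuous:
  assumes "continuous_on (sphere 0 1) f"
  shows "square_integrable f"
  using bounded_on_circle[OF assms] square_integrable_bounded circle_measurable_continuous[OF assms]
  by metis

lemma square_integrable_mult_bounded:
  assumes g: "g \<in> borel_measurable circle_measure" "\<And>z. cmod z = 1 \<Longrightarrow> cmod (g z) \<le> B"
    and f: "square_integrable f"
  shows "square_integrable (\<lambda>z. g z * f z)"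
proof -
  have m [measurable]: "f \<in> borel_measurable circle_measure" "g \<in> borel_measurable circle_measure"
    using f g by (auto simp: square_integrable_def)
  have "integrable circle_measure (\<lambda>z. B\<^sup>2 * (cmod (f z))\<^sup>2)"
    using f by (auto simp: square_integrable_def)
  then have "integrable circle_measure (\<lambda>z. (cmod (g z * f z))\<^sup>2)"
    by (rule Bochner_Integration.integrable_bound)
       (auto simp: space_circle_measure norm_mult power_mult_distrib
         intro!: AE_I2 mult_right_mono power_mono g(2))
  then show ?thesis
    by (simp add: square_integrable_def)
qed

lemma abs_circle_L2_eqI:
  assumes "square_integrable f" "square_integrable g" "AE z in circle_measure. f z = g z"
  shows "abs_circle_L2 f = abs_circle_L2 g"
  using assms by (intro Quotient_rel_abs[OF Quotient_circle_L2]) auto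

text \<open>
  Only the values on the circle matter, which leaves the freedom to compare functions given
  by different formulas off the circle.
\<close>

lemma abs_circle_L2_cong:
  assumes "square_integrable g" "\<And>z. cmod z = 1 \<Longrightarrow> f z = g z"
  shows "abs_circle_L2 f = abs_circle_L2 g"
proof (rule abs_circle_L2_eqI[OF _ assms(1)])
  have eq: "f z = g z" if "z \<in> space circle_measure" for z
    using that assms(2) by (simp add: space_circle_measure)
  show "square_integrable f"
    using assms(1) eq measurable_cong[of circle_measure f g borel]
      Bochner_Integration.integrable_cong[of circle_measure circle_measure "\<lambda>z. (cmod (f z))\<^sup>2" "\<lambda>z. (cmod (g z))\<^sup>2"]
    unfolding square_integrable_def by auto
  show "AE z in circle_measure. f z = g z"
    using eq by (rule AE_I2)
qed

lemma square_integrable_rep [simp]: "square_integrable (rep_circle_L2 f)"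
  using Quotient_rep_reflp[OF Quotient_circle_L2, of f] by simp

lemma abs_rep_circle_L2 [simp]: "abs_circle_L2 (rep_circle_L2 f) = f"
  by (rule Quotient_abs_rep[OF Quotient_circle_L2])

lemma rep_abs_circle_L2:
  assumes "square_integrable f"
  shows "AE z in circle_measure. rep_circle_L2 (abs_circle_L2 f) z = f z"
  using Quotient_rep_abs[OF Quotient_circle_L2, of f] assms by simp

lemma L2_diff:
  assumes "square_integrable f" "square_integrable g"
  shows "abs_circle_L2 (\<lambda>z. f z - g z) = abs_circle_L2 f - abs_circle_L2 g"
  using L2_add[OF assms(1) square_integrable_scale[OF assms(2), of "-1"]] L2_scale[OF assms(2), of "-1"]
  by (simp add: scaleC_minus_one)

lemma square_integrable_diff:
  assumes "square_integrable f" "square_integrable g"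
  shows "square_integrable (\<lambda>z. f z - g z)"
  using square_integrable_add[OF assms(1) square_integrable_scale[OF assms(2), of "-1"]] by simp

lemma cinner_L2:
  assumes "square_integrable f" "square_integrable g"
  shows "cinner (abs_circle_L2 f) (abs_circle_L2 g) = (\<integral>z. f z * cnj (g z) \<partial>circle_measure)"
  using assms by (simp add: cinner_circle_L2.abs_eq)

lemma norm_L2:
  assumes "square_integrable f"
  shows "(norm (abs_circle_L2 f))\<^sup>2 = (\<integral>z. (cmod (f z))\<^sup>2 \<partial>circle_measure)"
proof -
  have "complex_of_real ((norm (abs_circle_L2 f))\<^sup>2) = (\<integral>z. of_real ((cmod (f z))\<^sup>2) \<partial>circle_measure)"
    unfolding cinner_self[symmetric] cinner_L2[OF assms assms] complex_norm_square ..
  then show ?thesis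
    by (simp only: integral_complex_of_real of_real_eq_iff)
qed

lemma norm_L2_mult_le:
  assumes g: "g \<in> borel_measurable circle_measure" "\<And>z. cmod z = 1 \<Longrightarrow> cmod (g z) \<le> B"
    and f: "square_integrable f"
  shows "norm (abs_circle_L2 (\<lambda>z. g z * f z)) \<le> B * norm (abs_circle_L2 f)"
proof (rule power2_le_imp_le)
  have sq: "square_integrable (\<lambda>z. g z * f z)"
    by (rule square_integrable_mult_bounded[OF assms])
  have B: "0 \<le> B"
    using g(2)[of 1] order_trans[OF norm_ge_zero] by simp blast
  show "(norm (abs_circle_L2 (\<lambda>z. g z * f z)))\<^sup>2 \<le> (B * norm (abs_circle_L2 f))\<^sup>2"
    unfolding power_mult_distrib norm_L2[OF sq] norm_L2[OF f]
      Bochner_Integration.integral_mult_right_zero[symmetric]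
    using sq f g(2)
    by (intro integral_mono)
       (auto simp: square_integrable_def norm_mult power_mult_distrib space_circle_measure
         intro!: mult_right_mono power_mono)
  show "0 \<le> B * norm (abs_circle_L2 f)"
    using B by simp
qed

lemma norm_L2_le:
  assumes "f \<in> borel_measurable circle_measure" "\<And>z. cmod z = 1 \<Longrightarrow> cmod (f z) \<le> B"
  shows "norm (abs_circle_L2 f) \<le> B"
proof -
  have 1: "square_integrable (\<lambda>_. 1)"
    by (rule square_integrable_continuous) simp
  then have "(norm (abs_circle_L2 (\<lambda>_. 1)))\<^sup>2 = 1"
    by (simp add: norm_L2 circle.prob_space)
  then have "norm (abs_circle_L2 (\<lambda>_. 1)) = 1"
    by (simp add: power2_eq_1_iff) (use norm_ge_zero[of "abs_circle_L2 (\<lambda>_. 1)"] in linarith)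
  then show ?thesis
    using norm_L2_mult_le[OF assms 1] by simp
qed

text \<open>
  Riesz--Fischer: along a subsequence with geometrically decreasing steps, the sum of the
  absolute differences is integrable and hence finite almost everywhere, so the
  subsequence converges pointwise, and Fatou's lemma upgrades this to convergence in norm.
\<close>

instance circle_L2 :: complete_space
proof
  fix X :: "nat \<Rightarrow> circle_L2"
  assume X: "Cauchy X"
  have "\<exists>N. \<forall>m\<ge>N. \<forall>n\<ge>N. norm (X m - X n) < (1/2)^k" for k
    using CauchyD[OF X, of "(1/2)^k"] by simp
  then obtain N where N: "\<And>k m n. m \<ge> N k \<Longrightarrow> n \<ge> N k \<Longrightarrow> norm (X m - X n) < (1/2)^k"
    by metis
  \<comment> \<open>The maximum makes one index serve for all coarser tolerances as well, which plays the role of monotonicity.\<close>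
  define K where "K k = Max (N ` {..k})" for k
  have KN: "N j \<le> K k" if "j \<le> k" for j k
    unfolding K_def using that by (intro Max_ge) auto
  define f where "f k = rep_circle_L2 (X (K k))" for k
  have sq: "square_integrable (f k)" for k
    by (simp add: f_def)
  have [measurable]: "f k \<in> borel_measurable circle_measure" for k
    using sq by (simp add: square_integrable_def)
  have Xf: "X (K k) = abs_circle_L2 (f k)" for k
    by (simp add: f_def)
  have close: "norm (abs_circle_L2 (f m) - abs_circle_L2 (f n)) < (1/2)^k" if "k \<le> m" "k \<le> n" for k m n
    unfolding Xf[symmetric] using that by (intro N KN)
  have nn2: "(\<integral>\<^sup>+z. ennreal ((cmod (f m z - f n z))\<^sup>2) \<partial>circle_measure)
      = ennreal ((norm (abs_circle_L2 (f m) - abs_circle_L2 (f n)))\<^sup>2)" for m n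
    using square_integrable_diff[OF sq sq, of m n]
    unfolding L2_diff[OF sq sq, symmetric] norm_L2[OF square_integrable_diff[OF sq sq]]
    by (intro nn_integral_eq_integral) (auto simp: square_integrable_def)
  define d where "d k z = cmod (f (Suc k) z - f k z)" for k z
  have [measurable]: "d k \<in> borel_measurable circle_measure" for k
    unfolding d_def by measurable
  have d_le: "(\<integral>\<^sup>+z. ennreal (d k z) \<partial>circle_measure) \<le> ennreal ((1/2)^k)" for k
  proof -
    define t :: real where "t = (1/2)^k"
    have t: "t > 0"
      by (simp add: t_def)
    have sqd: "square_integrable (\<lambda>z. f (Suc k) z - f k z)"
      by (rule square_integrable_diff[OF sq sq])
    have int2: "integrable circle_measure (\<lambda>z. (d k z)\<^sup>2)"
      using sqd by (simp add: square_integrable_def d_def)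
    \<comment> \<open>Since the circle has mass one, this pointwise bound turns the $L^2$ bound \<open>t\<close> on \<open>d k\<close> into an $L^1$ bound \<open>t\<close>.\<close>
    have le: "d k z \<le> (d k z)\<^sup>2 / (2 * t) + t / 2" for z
      using t zero_le_power2[of "d k z - t"] by (simp add: power2_diff field_simps power2_eq_square)
    have i: "integrable circle_measure (\<lambda>z. (d k z)\<^sup>2 / (2 * t) + t / 2)"
      using int2 by auto
    then have int1: "integrable circle_measure (d k)"
      by (rule Bochner_Integration.integrable_bound) (use le in \<open>auto simp: d_def intro!: AE_I2 order_trans[OF _ abs_ge_self]\<close>)
    have "(\<integral>z. d k z \<partial>circle_measure) \<le> (\<integral>z. (d k z)\<^sup>2 / (2 * t) + t / 2 \<partial>circle_measure)"
      by (rule integral_mono[OF int1 i le])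
    also have "\<dots> = (\<integral>z. (d k z)\<^sup>2 \<partial>circle_measure) / (2 * t) + t / 2"
      using int2 by (simp add: circle.prob_space)
    also have "(\<integral>z. (d k z)\<^sup>2 \<partial>circle_measure) = (norm (abs_circle_L2 (f (Suc k)) - abs_circle_L2 (f k)))\<^sup>2"
      unfolding L2_diff[OF sq sq, symmetric] norm_L2[OF sqd] d_def ..
    also have "\<dots> / (2 * t) + t / 2 \<le> t\<^sup>2 / (2 * t) + t / 2"
      using close[of k "Suc k" k] t
      by (intro add_right_mono divide_right_mono power_mono) (auto simp: t_def less_imp_le)
    also have "\<dots> = t"
      using t by (simp add: power2_eq_square)
    finally show ?thesis
      using int1 by (subst nn_integral_eq_integral) (auto simp: t_def ennreal_leI, simp add: d_def)
  qed
  have "(\<integral>\<^sup>+z. (\<Sum>k. ennreal (d k z)) \<partial>circle_measure) = (\<Sum>k. \<integral>\<^sup>+z. ennreal (d k z) \<partial>circle_measure)"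
    by (rule nn_integral_suminf) measurable
  also have "\<dots> \<le> (\<Sum>k. ennreal ((1/2)^k))"
    by (rule suminf_le[OF d_le]) auto
  also have "\<dots> = ennreal (\<Sum>k. (1/2)^k)"
    by (rule suminf_ennreal2) (auto intro: summable_geometric)
  finally have "(\<integral>\<^sup>+z. (\<Sum>k. ennreal (d k z)) \<partial>circle_measure) \<noteq> \<infinity>"
    by (auto simp: top_unique)
  then have "AE z in circle_measure. (\<Sum>k. ennreal (d k z)) \<noteq> \<infinity>"
    by (intro nn_integral_PInf_AE) measurable
  then have conv: "AE z in circle_measure. convergent (\<lambda>k. f k z)"
  proof eventually_elim
    case (elim z)
    then have "summable (\<lambda>k. d k z)"
      by (intro summable_suminf_not_top) (auto simp: d_def)
    then have "summable (\<lambda>k. f (Suc k) z - f k z)"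
      unfolding d_def by (rule summable_norm_cancel)
    then have "convergent (\<lambda>n. f n z - f 0 z)"
      by (simp add: summable_iff_convergent sum_lessThan_telescope[of "\<lambda>k. f k z"])
    then show ?case
      using convergent_add[OF _ convergent_const[of "f 0 z"]] by fastforce
  qed
  define g where "g z = lim (\<lambda>k. f k z)" for z
  have [measurable]: "g \<in> borel_measurable circle_measure"
    unfolding g_def by (rule borel_measurable_lim_metric) measurable
  have lim: "AE z in circle_measure. (\<lambda>k. f k z) \<longlonglongrightarrow> g z"
    using conv by eventually_elim (simp add: g_def convergent_LIMSEQ_iff)
  have fatou: "(\<integral>\<^sup>+z. ennreal ((cmod (f k z - g z))\<^sup>2) \<partial>circle_measure) \<le> ennreal (((1/2)^k)\<^sup>2)" for k
  proof -
    have "(\<integral>\<^sup>+z. ennreal ((cmod (f k z - g z))\<^sup>2) \<partial>circle_measure)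
        = (\<integral>\<^sup>+z. liminf (\<lambda>m. ennreal ((cmod (f k z - f m z))\<^sup>2)) \<partial>circle_measure)"
    proof (rule nn_integral_cong_AE)
      show "AE z in circle_measure. ennreal ((cmod (f k z - g z))\<^sup>2)
          = liminf (\<lambda>m. ennreal ((cmod (f k z - f m z))\<^sup>2))"
        using lim
      proof eventually_elim
        case (elim z)
        then have "(\<lambda>m. ennreal ((cmod (f k z - f m z))\<^sup>2)) \<longlonglongrightarrow> ennreal ((cmod (f k z - g z))\<^sup>2)"
          by (intro tendsto_intros)
        then show ?case
          using lim_imp_Liminf[OF sequentially_bot] by metis
      qed
    qed
    also have "\<dots> \<le> liminf (\<lambda>m. \<integral>\<^sup>+z. ennreal ((cmod (f k z - f m z))\<^sup>2) \<partial>circle_measure)"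
      by (rule nn_integral_liminf) measurable
    also have "\<dots> \<le> ennreal (((1/2)^k)\<^sup>2)"
    proof (rule Liminf_le)
      show "\<forall>\<^sub>F m in sequentially. (\<integral>\<^sup>+z. ennreal ((cmod (f k z - f m z))\<^sup>2) \<partial>circle_measure) \<le> ennreal (((1/2)^k)\<^sup>2)"
        using eventually_ge_at_top[of k]
        by eventually_elim (auto simp: nn2 intro!: ennreal_leI power_mono less_imp_le[OF close])
    qed simp
    finally show ?thesis .
  qed
  have sqk: "square_integrable (\<lambda>z. f k z - g z)" for k
    unfolding square_integrable_def
  proof
    show "integrable circle_measure (\<lambda>z. (cmod (f k z - g z))\<^sup>2)"
      using fatou[of k] by (intro integrableI_bounded) (auto simp: le_less_trans[OF _ ennreal_less_top])
  qed measurable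
  have sqg: "square_integrable g"
    using square_integrable_diff[OF sq[of 0] sqk[of 0]] by simp
  have norm_le: "norm (X (K k) - abs_circle_L2 g) \<le> (1/2)^k" for k
  proof (rule power2_le_imp_le)
    have "ennreal ((norm (X (K k) - abs_circle_L2 g))\<^sup>2) = (\<integral>\<^sup>+z. ennreal ((cmod (f k z - g z))\<^sup>2) \<partial>circle_measure)"
      unfolding Xf L2_diff[OF sq sqg, symmetric] norm_L2[OF sqk]
      using sqk[of k] by (intro nn_integral_eq_integral[symmetric]) (auto simp: square_integrable_def)
    then show "(norm (X (K k) - abs_circle_L2 g))\<^sup>2 \<le> ((1/2)^k)\<^sup>2"
      using fatou[of k] by (metis ennreal_le_iff zero_le_power2)
  qed simp
  have "X \<longlonglongrightarrow> abs_circle_L2 g"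
    unfolding LIMSEQ_iff
  proof (intro allI impI)
    fix r :: real assume "r > 0"
    then obtain k where k: "(1/2)^k < r / 2"
      using real_arch_pow_inv[of "r/2" "1/2"] by auto
    have "norm (X n - abs_circle_L2 g) < r" if "n \<ge> K k" for n
    proof -
      have "norm (X n - X (K k)) < (1/2)^k"
        using that KN[of k k] by (intro N) auto
      then show ?thesis
        using norm_le[of k] k norm_triangle_ineq[of "X n - X (K k)" "X (K k) - abs_circle_L2 g"] by simp
    qed
    then show "\<exists>no. \<forall>n\<ge>no. norm (X n - abs_circle_L2 g) < r"
      by blast
  qed
  then show "convergent X"
    by (auto simp: convergent_def)
qed

instance circle_L2 :: banach ..

section \<open>Cauchy's formula on the circle\<close>

lemma circle_integral_eq_contour_integral:
  fixes h :: "complex \<Rightarrow> complex"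
  assumes "continuous_on (sphere 0 1) h"
  shows "(\<integral>z. h z \<partial>circle_measure) = contour_integral (circlepath 0 1) (\<lambda>z. h z / z) / (2 * of_real pi * \<i>)"
proof -
  have hm: "h \<in> borel_measurable (restrict_space borel (sphere 0 1))"
    by (rule borel_measurable_continuous_on_restrict[OF assms])
  have cc: "continuous_on UNIV (\<lambda>t. h (cis t))"
    by (intro continuous_on_compose2[OF assms] continuous_intros) auto
  then have hc [measurable]: "(\<lambda>t. h (cis t)) \<in> borel_measurable borel"
    by (rule borel_measurable_continuous_onI)
  have "cis \<in> borel_measurable borel"
    by (intro borel_measurable_continuous_onI continuous_intros)
  then have "cis \<in> measurable (uniform_measure lborel {0..2*pi}) (restrict_space borel (sphere 0 1))"
    by (intro measurable_restrict_space2) (auto simp: measurable_cong_sets[OF sets_uniform_measure refl])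
  then have "(\<integral>z. h z \<partial>circle_measure) = (\<integral>t. h (cis t) \<partial>uniform_measure lborel {0..2*pi})"
    unfolding circle_measure_def using hm by (rule integral_distr)
  also have "uniform_measure lborel {0..2*pi} = density lborel (\<lambda>t. ennreal (indicator {0..2*pi} t / (2*pi)))"
    unfolding uniform_measure_def
    by (intro density_cong AE_I2) (auto simp: divide_ennreal[symmetric] indicator_def)
  also have "(\<integral>t. h (cis t) \<partial>\<dots>) = (\<integral>t. (indicator {0..2*pi} t / (2*pi)) *\<^sub>R h (cis t) \<partial>lborel)"
    by (rule integral_density) (auto simp: indicator_def)
  also have "\<dots> = (LINT t:{0..2*pi}|lborel. h (cis t)) / of_real (2*pi)"
    unfolding set_lebesgue_integral_def Bochner_Integration.integral_divide_zero[symmetric]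
    by (rule Bochner_Integration.integral_cong) (auto simp: scaleR_conv_of_real field_simps)
  also have "(LINT t:{0..2*pi}|lborel. h (cis t)) = integral {0..2*pi} (\<lambda>t. h (cis t))"
    by (intro set_borel_integral_eq_integral borel_integrable_atLeastAtMost' continuous_on_subset[OF cc]) auto
  also have "\<i> * integral {0..2*pi} (\<lambda>t. h (cis t)) = contour_integral (circlepath 0 1) (\<lambda>z. h z / z)"
    unfolding circlepath_def
    by (subst contour_integral_part_circlepath_eq) (simp_all add: mult.commute)
  then have "integral {0..2*pi} (\<lambda>t. h (cis t)) = contour_integral (circlepath 0 1) (\<lambda>z. h z / z) / \<i>"
    by (metis complex_i_not_zero nonzero_mult_div_cancel_left)
  finally show ?thesis
    by (simp only: divide_divide_eq_left of_real_mult of_real_numeral mult_ac)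
qed

text \<open>
  On the circle \<open>cnj z = 1 / z\<close>, so the conjugated kernel divided by \<open>z\<close> is the Cauchy
  kernel \<open>1 / (z - w)\<close>.
\<close>

lemma circle_Cauchy_formula:
  assumes "continuous_on (cball 0 1) h" "h holomorphic_on ball 0 1" "cmod w < 1"
  shows "(\<integral>z. h z * cnj (1 / (1 - cnj w * z)) \<partial>circle_measure) = h w"
proof -
  have ne: "1 - cnj w * z \<noteq> 0" "1 - w * cnj z \<noteq> 0" if "cmod z = 1" for z
  proof -
    have "cmod (cnj w * z) < 1" "cmod (w * cnj z) < 1"
      using that assms(3) by (simp_all add: norm_mult)
    then show "1 - cnj w * z \<noteq> 0" "1 - w * cnj z \<noteq> 0"
      by (auto simp: dest!: sym[of _ "1::complex"])
  qed
  have c: "continuous_on (sphere 0 1) (\<lambda>z. h z * cnj (1 / (1 - cnj w * z)))"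
    by (intro continuous_intros continuous_on_subset[OF assms(1)]) (use ne in auto)
  have eq: "h z * cnj (1 / (1 - cnj w * z)) / z = h z / (z - w)" if "cmod z = 1" for z
  proof -
    have "z * cnj z = 1"
      using that by (simp add: complex_norm_square[symmetric])
    then have "(1 - w * cnj z) * z = z - w"
      by (simp add: algebra_simps)
    then show ?thesis
      by (metis complex_cnj_cnj complex_cnj_diff complex_cnj_divide complex_cnj_mult complex_cnj_one
          divide_divide_eq_left mult.right_neutral times_divide_eq_right)
  qed
  have "contour_integral (circlepath 0 1) (\<lambda>z. h z * cnj (1 / (1 - cnj w * z)) / z)
      = contour_integral (circlepath 0 1) (\<lambda>z. h z / (z - w))"
    by (rule contour_integral_cong) (auto simp: eq simp del: complex_cnj_divide)
  also have "\<dots> = 2 * of_real pi * \<i> * h w"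
    using Cauchy_integral_circlepath[OF assms(1,2), of w] assms(3)
    by (simp add: contour_integral_unique)
  finally show ?thesis
    unfolding circle_integral_eq_contour_integral[OF c] by simp
qed

section \<open>Evaluation on the disc\<close>

lemma kernel_denominator_nonzero:
  assumes "cmod w < 1" "cmod z \<le> 1"
  shows "1 - cnj w * z \<noteq> 0"
proof -
  have "cmod (cnj w * z) < 1"
    using assms mult_mono[of "cmod w" "cmod w" "cmod z" 1] by (simp add: norm_mult)
  then show ?thesis
    by (auto dest!: sym[of _ "1::complex"])
qed

lemma kernel_bound:
  assumes "cmod w < 1" "cmod z \<le> 1"
  shows "cmod (1 / (1 - cnj w * z)) \<le> 1 / (1 - cmod w)"
proof -
  have "cmod (cnj w * z) \<le> cmod w"
    using assms mult_left_mono[of "cmod z" 1 "cmod w"] by (simp add: norm_mult)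
  then have "1 - cmod w \<le> cmod (1 - cnj w * z)"
    using norm_triangle_ineq2[of 1 "cnj w * z"] by simp
  then show ?thesis
    using assms by (simp add: norm_divide frac_le)
qed

lemma continuous_kernel:
  assumes "cmod w < 1"
  shows "continuous_on (cball 0 1) (\<lambda>z. 1 / (1 - cnj w * z))"
  by (intro continuous_intros) (use kernel_denominator_nonzero[OF assms] in auto)

lemma square_integrable_kernel:
  assumes "cmod w < 1"
  shows "square_integrable (\<lambda>z. 1 / (1 - cnj w * z))"
  by (rule square_integrable_continuous) (rule continuous_on_subset[OF continuous_kernel[OF assms]], auto)

lemma norm_kernel_le:
  assumes "cmod w < 1"
  shows "norm (abs_circle_L2 (\<lambda>z. 1 / (1 - cnj w * z))) \<le> 1 / (1 - cmod w)"
  using kernel_bound[OF assms] square_integrable_kernel[OF assms]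
  by (intro norm_L2_le) (auto simp: square_integrable_def)

lemma at_left_1_unit_interval: "\<forall>\<^sub>F r in at_left (1::real). 0 < r \<and> r < 1"
  using eventually_at_left_real[of 0 "1::real"] by (auto elim: eventually_mono)

lemma continuous_dilate:
  assumes "F holomorphic_on ball 0 1" "0 \<le> r" "r < 1"
  shows "continuous_on (cball 0 1) (\<lambda>z. F (of_real r * z))"
proof (rule continuous_on_compose2[OF holomorphic_on_imp_continuous_on[OF assms(1)]])
  show "(\<lambda>z. of_real r * z) ` cball 0 1 \<subseteq> ball (0::complex) 1"
  proof clarsimp
    fix z :: complex assume "cmod z \<le> 1"
    then show "cmod (of_real r * z) < 1"
      using assms mult_left_mono[of "cmod z" 1 r] by (simp add: norm_mult)
  qed
qed (intro continuous_intros)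

lemma holomorphic_dilate:
  assumes "F holomorphic_on ball 0 1" "0 \<le> r" "r < 1"
  shows "(\<lambda>z. F (of_real r * z)) holomorphic_on ball 0 1"
proof (rule holomorphic_on_compose_gen[OF _ assms(1), unfolded o_def])
  show "(\<lambda>z. of_real r * z) ` ball 0 1 \<subseteq> ball (0::complex) 1"
  proof clarsimp
    fix z :: complex assume "cmod z < 1"
    then show "cmod (of_real r * z) < 1"
      using assms mult_left_mono[of "cmod z" 1 r] by (simp add: norm_mult)
  qed
qed (intro holomorphic_intros)

text \<open>
  Cauchy's formula holds for every dilate of \<open>F\<close> and survives the $L^2$ limit.  Hence the boundary
  function determines \<open>F\<close>, and its values are inner products with the Szego kernels.
\<close>

lemma boundary_function_Cauchy:
  assumes F: "F holomorphic_on ball 0 1" and f: "has_boundary_function F f" and w: "cmod w < 1"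
  shows "cinner f (abs_circle_L2 (\<lambda>z. 1 / (1 - cnj w * z))) = F w"
proof (rule tendsto_unique[OF trivial_limit_at_left_real])
  show "((\<lambda>r. cinner (abs_circle_L2 (\<lambda>z. F (of_real r * z))) (abs_circle_L2 (\<lambda>z. 1 / (1 - cnj w * z))))
      \<longlongrightarrow> cinner f (abs_circle_L2 (\<lambda>z. 1 / (1 - cnj w * z)))) (at_left 1)"
    using f unfolding has_boundary_function_def
    by (rule bounded_linear.tendsto[OF bounded_linear_cinner_left])
  have "isCont F w"
    using F w holomorphic_on_imp_continuous_on continuous_on_interior by fastforce
  then have "isCont F (of_real 1 * w)"
    by simp
  then have "((\<lambda>r. F (of_real r * w)) \<longlongrightarrow> F (of_real 1 * w)) (at_left 1)"
    by (rule isCont_tendsto_compose) (intro tendsto_intros)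
  then have "((\<lambda>r. F (of_real r * w)) \<longlongrightarrow> F w) (at_left 1)"
    by simp
  moreover have "\<forall>\<^sub>F r in at_left 1. F (of_real r * w)
      = cinner (abs_circle_L2 (\<lambda>z. F (of_real r * z))) (abs_circle_L2 (\<lambda>z. 1 / (1 - cnj w * z)))"
    using at_left_1_unit_interval
  proof eventually_elim
    case (elim r)
    then show ?case
      using circle_Cauchy_formula[OF continuous_dilate[OF F, of r] holomorphic_dilate[OF F, of r] w]
      by (subst cinner_L2[OF square_integrable_dilate[OF F] square_integrable_kernel[OF w]])
         (simp_all del: complex_cnj_divide)
  qed
  ultimately show "((\<lambda>r. cinner (abs_circle_L2 (\<lambda>z. F (of_real r * z))) (abs_circle_L2 (\<lambda>z. 1 / (1 - cnj w * z))))
      \<longlongrightarrow> F w) (at_left 1)"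
    by (rule Lim_transform_eventually)
qed

lemma has_boundary_function_cong:
  assumes "F holomorphic_on ball 0 1" "\<And>z. cmod z < 1 \<Longrightarrow> F z = G z" "has_boundary_function F f"
  shows "has_boundary_function G f"
  unfolding has_boundary_function_def
proof (rule Lim_transform_eventually[OF assms(3)[unfolded has_boundary_function_def]])
  show "\<forall>\<^sub>F r in at_left 1. abs_circle_L2 (\<lambda>z. F (of_real r * z)) = abs_circle_L2 (\<lambda>z. G (of_real r * z))"
    using at_left_1_unit_interval
  proof eventually_elim
    case (elim r)
    then show ?case
      by (intro abs_circle_L2_cong[symmetric] square_integrable_dilate assms)
         (auto simp: norm_mult assms(2))
  qed
qed

text \<open>
  The bound on the means is automatic: near radius 1 it comes from the convergence of the
  dilates, and on smaller radii from the continuity of \<open>F\<close>.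
\<close>

lemma hardy_functionI:
  assumes F: "F holomorphic_on ball 0 1" and f: "has_boundary_function F f"
  shows "hardy_function F"
proof -
  have "\<forall>\<^sub>F r in at_left 1. norm (abs_circle_L2 (\<lambda>z. F (of_real r * z))) < norm f + 1"
    using f unfolding has_boundary_function_def
    by (intro order_tendstoD(2)[OF tendsto_norm]) auto
  then obtain s where s: "s < 1"
    "\<And>r. s < r \<Longrightarrow> r < 1 \<Longrightarrow> norm (abs_circle_L2 (\<lambda>z. F (of_real r * z))) < norm f + 1"
    unfolding eventually_at_left_field by blast
  define t where "t = max 0 s"
  have t: "0 \<le> t" "t < 1" "s \<le> t"
    using s by (auto simp: t_def)
  have "continuous_on (cball 0 t) F"
    using t by (intro continuous_on_subset[OF holomorphic_on_imp_continuous_on[OF F]]) auto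
  then have "bounded (F ` cball 0 t)"
    by (intro compact_imp_bounded compact_continuous_image) auto
  then obtain B where B: "\<And>z. cmod z \<le> t \<Longrightarrow> cmod (F z) \<le> B"
    by (force simp: bounded_iff)
  have "(\<integral>z. (cmod (F (of_real r * z)))\<^sup>2 \<partial>circle_measure) \<le> (max (norm f + 1) B)\<^sup>2"
    if r: "r \<in> {0..<1}" for r
  proof -
    have sq: "square_integrable (\<lambda>z. F (of_real r * z))"
      using r by (intro square_integrable_dilate F) auto
    have "norm (abs_circle_L2 (\<lambda>z. F (of_real r * z))) \<le> max (norm f + 1) B"
    proof (cases "r \<le> t")
      case True
      then have "norm (abs_circle_L2 (\<lambda>z. F (of_real r * z))) \<le> B"
        using sq r by (intro norm_L2_le B) (auto simp: square_integrable_def norm_mult)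
      then show ?thesis
        by simp
    next
      case False
      then show ?thesis
        using s(2)[of r] r t by auto
    qed
    then show ?thesis
      unfolding norm_L2[OF sq, symmetric] by (intro power_mono) auto
  qed
  then show ?thesis
    unfolding hardy_function_def using F by (auto intro!: bdd_aboveI2[where M = "(max (norm f + 1) B)\<^sup>2"])
qed

text \<open>
  The value at \<open>w\<close> of the holomorphic function with boundary function \<open>f\<close>, written as a bounded
  functional so that it is defined without choosing that function.
\<close>

definition ev :: "hardy2 \<Rightarrow> complex \<Rightarrow> complex" where
  "ev f w = cinner (Rep_hardy2 f) (abs_circle_L2 (\<lambda>z. 1 / (1 - cnj w * z)))"

lemma ev_holomorphic: "ev f holomorphic_on ball 0 1"
  and ev_boundary: "has_boundary_function (ev f) (Rep_hardy2 f)"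
proof -
  obtain F where F: "hardy_function F" "has_boundary_function F (Rep_hardy2 f)"
    using Rep_hardy2[of f] by blast
  then have hol: "F holomorphic_on ball 0 1"
    by (simp add: hardy_function_def)
  have eq: "F z = ev f z" if "cmod z < 1" for z
    unfolding ev_def using boundary_function_Cauchy[OF hol F(2) that] by simp
  show "ev f holomorphic_on ball 0 1"
    using hol by (rule holomorphic_transform) (simp add: eq)
  show "has_boundary_function (ev f) (Rep_hardy2 f)"
    by (rule has_boundary_function_cong[OF hol eq F(2)])
qed

lemma ev_continuous: "continuous_on (ball 0 1) (ev f)"
  by (rule holomorphic_on_imp_continuous_on[OF ev_holomorphic])

lemma hardy2_eqI:
  assumes "\<And>z. cmod z < 1 \<Longrightarrow> ev f z = ev g z"
  shows "f = g"
proof -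
  have "has_boundary_function (ev g) (Rep_hardy2 f)"
    by (rule has_boundary_function_cong[OF ev_holomorphic assms ev_boundary])
  then have "Rep_hardy2 f = Rep_hardy2 g"
    using ev_boundary[of g] tendsto_unique[OF trivial_limit_at_left_real]
    unfolding has_boundary_function_def by blast
  then show ?thesis
    by (simp add: Rep_hardy2_inject)
qed

lemma ev_add: "ev (f + g) z = ev f z + ev g z"
  by (simp add: ev_def plus_hardy2.rep_eq cinner_add_left)

lemma ev_scaleC: "ev (c *\<^sub>C f) z = c * ev f z"
  by (simp add: ev_def scaleC_hardy2.rep_eq cinner_scaleC_left)

lemma ev_zero [simp]: "ev 0 z = 0"
  by (simp add: ev_def zero_hardy2.rep_eq)

lemma ev_diff: "ev (f - g) z = ev f z - ev g z"
proof -
  have "f - g = f + (-1) *\<^sub>C g"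
    by (simp add: scaleC_minus_one)
  then show ?thesis
    by (simp only: ev_add ev_scaleC) simp
qed

lemma ev_minus: "ev (- f) z = - ev f z"
  using ev_scaleC[of "-1" f z] by (simp add: scaleC_minus_one)

lemma ev_sum: "ev (\<Sum>i\<in>A. f i) z = (\<Sum>i\<in>A. ev (f i) z)"
  by (induction A rule: infinite_finite_induct) (simp_all add: ev_add)

lemma
  assumes F: "F holomorphic_on ball 0 1" and f: "has_boundary_function F f"
  shows Rep_Abs_hardy2: "Rep_hardy2 (Abs_hardy2 f) = f"
    and ev_Abs_hardy2: "cmod z < 1 \<Longrightarrow> ev (Abs_hardy2 f) z = F z"
proof -
  show R: "Rep_hardy2 (Abs_hardy2 f) = f"
    using hardy_functionI[OF F f] f by (intro Abs_hardy2_inverse) auto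
  show "ev (Abs_hardy2 f) z = F z" if "cmod z < 1"
    unfolding ev_def R by (rule boundary_function_Cauchy[OF F f that])
qed

section \<open>Multiplication and division\<close>

lemma uniform_dilation_limit:
  assumes \<psi>: "continuous_on {z. \<rho> \<le> cmod z \<and> cmod z \<le> 1} \<psi>" and \<rho>: "\<rho> < 1" and e: "e > 0"
  shows "\<forall>\<^sub>F r in at_left 1. \<forall>z. cmod z = 1 \<longrightarrow> cmod (\<psi> (of_real r * z) - \<psi> z) \<le> e"
proof -
  let ?A = "{z. \<rho> \<le> cmod z \<and> cmod z \<le> 1}"
  have "?A = cball 0 1 - ball 0 \<rho>"
    by auto
  then have "compact ?A"
    by (simp add: compact_diff)
  then have "uniformly_continuous_on ?A \<psi>"
    by (rule compact_uniformly_continuous[OF \<psi>])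
  then obtain d where d: "d > 0" "\<And>x y. x \<in> ?A \<Longrightarrow> y \<in> ?A \<Longrightarrow> dist y x < d \<Longrightarrow> dist (\<psi> y) (\<psi> x) < e"
    using e unfolding uniformly_continuous_on_def by meson
  have "\<forall>\<^sub>F r in at_left 1. max 0 (max \<rho> (1 - d)) < r \<and> r < 1"
    using eventually_at_left_real[of "max 0 (max \<rho> (1 - d))" 1] \<rho> d(1) by (auto elim: eventually_mono)
  then show ?thesis
  proof eventually_elim
    case (elim r)
    have "cmod (\<psi> (of_real r * z) - \<psi> z) \<le> e" if z: "cmod z = 1" for z
    proof -
      have "of_real r * z - z = of_real (r - 1) * z"
        by (simp add: algebra_simps)
      then have "dist (of_real r * z) z = 1 - r"
        using z elim by (simp only: dist_norm norm_mult norm_of_real) simp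
      then have "dist (\<psi> (of_real r * z)) (\<psi> z) < e"
        using z elim \<rho> by (intro d(2)) (auto simp: norm_mult)
      then show ?thesis
        by (simp add: dist_norm)
    qed
    then show ?case
      by blast
  qed
qed

text \<open>
  Continuity of \<open>\<psi>\<close> is asked for near the circle only, so that \<open>\<psi>\<close> may have poles in the disc, as in
  the division by \<open>a - z\<close> below.  The difference of the dilate of \<open>\<psi> F\<close> and \<open>\<psi> f\<close> is split as
  \<open>\<psi>\<^sub>r (F\<^sub>r - f) + (\<psi>\<^sub>r - \<psi>) f\<close>; the first term is small in $L^2$ since \<open>\<psi>\<^sub>r\<close> is bounded, the second
  since \<open>\<psi>\<^sub>r\<close> converges uniformly.
\<close>

lemma has_boundary_function_mult:
  assumes F: "F holomorphic_on ball 0 1" and f: "has_boundary_function F f"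
    and \<psi>: "continuous_on {z. \<rho> \<le> cmod z \<and> cmod z \<le> 1} \<psi>" and \<rho>: "\<rho> < 1"
    and G: "\<And>z. \<rho> < cmod z \<Longrightarrow> cmod z < 1 \<Longrightarrow> G z = \<psi> z * F z"
  shows "has_boundary_function G (abs_circle_L2 (\<lambda>z. \<psi> z * rep_circle_L2 f z))"
proof -
  have \<psi>1: "continuous_on (sphere 0 1) \<psi>"
    by (rule continuous_on_subset[OF \<psi>]) (use \<rho> in auto)
  obtain B where B: "\<And>z. cmod z = 1 \<Longrightarrow> cmod (\<psi> z) \<le> B"
    using bounded_on_circle[OF \<psi>1] by blast
  let ?F = "\<lambda>r z. F (complex_of_real r * z)" and ?f = "rep_circle_L2 f"
  have lim: "((\<lambda>r. norm (abs_circle_L2 (?F r) - f)) \<longlongrightarrow> 0) (at_left 1)"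
    using f unfolding has_boundary_function_def by (simp add: LIM_zero_iff tendsto_norm_zero_iff)
  have "((\<lambda>r. abs_circle_L2 (\<lambda>z. G (of_real r * z)) - abs_circle_L2 (\<lambda>z. \<psi> z * ?f z)) \<longlongrightarrow> 0) (at_left 1)"
    unfolding tendsto_iff dist_norm
  proof (intro allI impI)
    fix \<epsilon> :: real assume \<epsilon>: "\<epsilon> > 0"
    define \<delta> where "\<delta> = min 1 (\<epsilon> / (2 * (norm f + 1)))"
    have \<delta>: "\<delta> > 0" "\<delta> \<le> 1" "\<delta> * norm f < \<epsilon> / 2"
    proof -
      show "\<delta> > 0" "\<delta> \<le> 1"
        using \<epsilon> by (auto simp: \<delta>_def intro!: divide_pos_pos add_nonneg_pos)
      have nf: "norm f + 1 \<noteq> 0"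
        using norm_ge_zero[of f] by linarith
      have "\<delta> * (norm f + 1) \<le> \<epsilon> / (2 * (norm f + 1)) * (norm f + 1)"
        by (intro mult_right_mono) (auto simp: \<delta>_def)
      also have "\<dots> = \<epsilon> / 2"
        using nf by (metis mult_divide_mult_cancel_right times_divide_eq_left)
      finally show "\<delta> * norm f < \<epsilon> / 2"
        using \<open>\<delta> > 0\<close> by (simp add: algebra_simps)
    qed
    have B0: "0 \<le> B"
      using order_trans[OF norm_ge_zero B[of 1]] by simp
    have "\<forall>\<^sub>F r in at_left 1. norm (abs_circle_L2 (?F r) - f) < \<epsilon> / (2 * (B + 1))"
      using \<epsilon> B0 by (intro order_tendstoD(2)[OF lim]) (auto intro!: divide_pos_pos)
    then show "\<forall>\<^sub>F r in at_left 1. norm (abs_circle_L2 (\<lambda>z. G (of_real r * z))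
        - abs_circle_L2 (\<lambda>z. \<psi> z * ?f z) - 0) < \<epsilon>"
      using uniform_dilation_limit[OF \<psi> \<rho> \<delta>(1)] eventually_at_left_real[OF \<rho>] at_left_1_unit_interval
    proof eventually_elim
      case (elim r)
      then have r: "0 < r" "r < 1" "\<rho> < r"
        using \<rho> by auto
      let ?\<psi> = "\<lambda>z. \<psi> (of_real r * z)"
      have \<psi>r: "continuous_on (sphere 0 1) ?\<psi>"
        by (rule continuous_on_compose2[OF \<psi>]) (use r in \<open>auto intro!: continuous_intros simp: norm_mult\<close>)
      have sqF: "square_integrable (?F r)"
        using r by (intro square_integrable_dilate F) auto
      have sqd: "square_integrable (\<lambda>z. ?F r z - ?f z)"
        by (rule square_integrable_diff[OF sqF]) simp
      have \<psi>m: "?\<psi> \<in> borel_measurable circle_measure" "(\<lambda>z. ?\<psi> z - \<psi> z) \<in> borel_measurable circle_measure"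
        using \<psi>r \<psi>1 by (auto intro!: circle_measurable_continuous continuous_intros)
      have \<psi>B: "cmod (?\<psi> z) \<le> B + 1" if "cmod z = 1" for z
        using B[OF that] elim(2) that \<delta>(2) norm_triangle_ineq[of "\<psi> z" "?\<psi> z - \<psi> z"] by fastforce
      have sq1: "square_integrable (\<lambda>z. ?\<psi> z * (?F r z - ?f z))"
        by (rule square_integrable_mult_bounded[OF \<psi>m(1) \<psi>B sqd])
      have sq2: "square_integrable (\<lambda>z. (?\<psi> z - \<psi> z) * ?f z)"
        using elim(2) by (intro square_integrable_mult_bounded[OF \<psi>m(2), of \<delta>]) auto
      have sq3: "square_integrable (\<lambda>z. \<psi> z * ?f z)"
        by (rule square_integrable_mult_bounded[OF circle_measurable_continuous[OF \<psi>1] B]) auto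
      have "abs_circle_L2 (\<lambda>z. G (of_real r * z)) =
          abs_circle_L2 (\<lambda>z. (?\<psi> z * (?F r z - ?f z) + (?\<psi> z - \<psi> z) * ?f z) + \<psi> z * ?f z)"
        using r by (intro abs_circle_L2_cong square_integrable_add sq1 sq2 sq3)
          (auto simp: G norm_mult algebra_simps)
      also have "\<dots> = abs_circle_L2 (\<lambda>z. ?\<psi> z * (?F r z - ?f z)) + abs_circle_L2 (\<lambda>z. (?\<psi> z - \<psi> z) * ?f z)
          + abs_circle_L2 (\<lambda>z. \<psi> z * ?f z)"
        by (simp add: L2_add square_integrable_add sq1 sq2 sq3)
      finally have "norm (abs_circle_L2 (\<lambda>z. G (of_real r * z)) - abs_circle_L2 (\<lambda>z. \<psi> z * ?f z))
          \<le> norm (abs_circle_L2 (\<lambda>z. ?\<psi> z * (?F r z - ?f z))) + norm (abs_circle_L2 (\<lambda>z. (?\<psi> z - \<psi> z) * ?f z))"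
        by (simp add: norm_triangle_ineq)
      also have "\<dots> \<le> (B + 1) * norm (abs_circle_L2 (\<lambda>z. ?F r z - ?f z)) + \<delta> * norm (abs_circle_L2 ?f)"
        using elim(2)
        by (intro add_mono norm_L2_mult_le[OF \<psi>m(1) \<psi>B sqd] norm_L2_mult_le[OF \<psi>m(2)]) auto
      also have "abs_circle_L2 (\<lambda>z. ?F r z - ?f z) = abs_circle_L2 (?F r) - f"
        by (subst L2_diff[OF sqF]) simp_all
      also have "(B + 1) * norm (abs_circle_L2 (?F r) - f) + \<delta> * norm (abs_circle_L2 ?f) < \<epsilon>"
      proof -
        have "(B + 1) * norm (abs_circle_L2 (?F r) - f) \<le> (B + 1) * (\<epsilon> / (2 * (B + 1)))"
          using elim(1) B0 by (intro mult_left_mono) auto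
        also have "\<dots> = \<epsilon> / 2"
          using B0 by (simp add: field_simps)
        finally show ?thesis
          using \<delta>(3) by simp
      qed
      finally show ?case
        by simp
    qed
  qed
  then show ?thesis
    unfolding has_boundary_function_def by (simp add: LIM_zero_iff)
qed

definition disk_algebra :: "(complex \<Rightarrow> complex) \<Rightarrow> bool" where
  "disk_algebra \<psi> \<longleftrightarrow> continuous_on (cball 0 1) \<psi> \<and> \<psi> holomorphic_on ball 0 1"

definition hmult :: "(complex \<Rightarrow> complex) \<Rightarrow> hardy2 \<Rightarrow> hardy2" where
  "hmult \<psi> f = Abs_hardy2 (abs_circle_L2 (\<lambda>z. \<psi> z * rep_circle_L2 (Rep_hardy2 f) z))"

definition hardy_of :: "(complex \<Rightarrow> complex) \<Rightarrow> hardy2" where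
  "hardy_of \<psi> = Abs_hardy2 (abs_circle_L2 \<psi>)"

lemma
  assumes "disk_algebra \<psi>"
  shows Rep_hmult: "Rep_hardy2 (hmult \<psi> f) = abs_circle_L2 (\<lambda>z. \<psi> z * rep_circle_L2 (Rep_hardy2 f) z)"
    and ev_hmult: "cmod z < 1 \<Longrightarrow> ev (hmult \<psi> f) z = \<psi> z * ev f z"
proof -
  have hol: "(\<lambda>z. \<psi> z * ev f z) holomorphic_on ball 0 1"
    using assms by (auto simp: disk_algebra_def intro!: holomorphic_intros ev_holomorphic)
  have "{z. 0 \<le> cmod z \<and> cmod z \<le> 1} = cball 0 1"
    by auto
  then have bd: "has_boundary_function (\<lambda>z. \<psi> z * ev f z) (abs_circle_L2 (\<lambda>z. \<psi> z * rep_circle_L2 (Rep_hardy2 f) z))"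
    using assms by (intro has_boundary_function_mult[OF ev_holomorphic ev_boundary, where \<rho> = 0]) (auto simp: disk_algebra_def)
  show "Rep_hardy2 (hmult \<psi> f) = abs_circle_L2 (\<lambda>z. \<psi> z * rep_circle_L2 (Rep_hardy2 f) z)"
    unfolding hmult_def by (rule Rep_Abs_hardy2[OF hol bd])
  show "ev (hmult \<psi> f) z = \<psi> z * ev f z" if "cmod z < 1"
    unfolding hmult_def by (rule ev_Abs_hardy2[OF hol bd that])
qed

lemma disk_algebra_square_integrable: "disk_algebra \<psi> \<Longrightarrow> square_integrable \<psi>"
  unfolding disk_algebra_def by (rule square_integrable_continuous) (auto intro: continuous_on_subset)

lemma
  assumes "disk_algebra \<psi>"
  shows Rep_hardy_of: "Rep_hardy2 (hardy_of \<psi>) = abs_circle_L2 \<psi>"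
    and ev_hardy_of: "cmod z < 1 \<Longrightarrow> ev (hardy_of \<psi>) z = \<psi> z"
proof -
  have hol: "\<psi> holomorphic_on ball 0 1"
    using assms by (simp add: disk_algebra_def)
  have 1: "square_integrable (\<lambda>_. 1)"
    by (rule square_integrable_continuous) simp
  have "has_boundary_function (\<lambda>_. 1) (abs_circle_L2 (\<lambda>_. 1))"
    by (simp add: has_boundary_function_def)
  moreover have "{z. 0 \<le> cmod z \<and> cmod z \<le> 1} = cball 0 1"
    by auto
  ultimately have "has_boundary_function \<psi> (abs_circle_L2 (\<lambda>z. \<psi> z * rep_circle_L2 (abs_circle_L2 (\<lambda>_. 1)) z))"
    using assms by (intro has_boundary_function_mult[where \<rho> = 0 and F = "\<lambda>_. 1"]) (auto simp: disk_algebra_def)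
  moreover have "abs_circle_L2 (\<lambda>z. \<psi> z * rep_circle_L2 (abs_circle_L2 (\<lambda>_. 1)) z) = abs_circle_L2 \<psi>"
  proof (rule abs_circle_L2_eqI)
    have "continuous_on (sphere 0 1) \<psi>"
      using assms unfolding disk_algebra_def by (auto intro: continuous_on_subset)
    then show "square_integrable (\<lambda>z. \<psi> z * rep_circle_L2 (abs_circle_L2 (\<lambda>_. 1)) z)"
      using bounded_on_circle square_integrable_mult_bounded circle_measurable_continuous square_integrable_rep
      by metis
    show "AE z in circle_measure. \<psi> z * rep_circle_L2 (abs_circle_L2 (\<lambda>_. 1)) z = \<psi> z"
      using rep_abs_circle_L2[OF 1] by eventually_elim simp
  qed (rule disk_algebra_square_integrable[OF assms])
  ultimately have bd: "has_boundary_function \<psi> (abs_circle_L2 \<psi>)"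
    by simp
  show "Rep_hardy2 (hardy_of \<psi>) = abs_circle_L2 \<psi>"
    unfolding hardy_of_def by (rule Rep_Abs_hardy2[OF hol bd])
  show "ev (hardy_of \<psi>) z = \<psi> z" if "cmod z < 1"
    unfolding hardy_of_def by (rule ev_Abs_hardy2[OF hol bd that])
qed

lemma disk_algebra_kernel: "cmod w < 1 \<Longrightarrow> disk_algebra (\<lambda>z. 1 / (1 - cnj w * z))"
  unfolding disk_algebra_def
  by (intro conjI continuous_kernel holomorphic_intros) (use kernel_denominator_nonzero in auto)

abbreviation szego :: "complex \<Rightarrow> hardy2" where
  "szego w \<equiv> hardy_of (\<lambda>z. 1 / (1 - cnj w * z))"

lemma cinner_szego:
  assumes "cmod w < 1"
  shows "cinner f (szego w) = ev f w"
  by (simp add: cinner_hardy2.rep_eq Rep_hardy_of[OF disk_algebra_kernel[OF assms]] ev_def)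

lemma norm_hardy2_Rep: "norm f = norm (Rep_hardy2 f)"
  by (simp add: norm_eq_sqrt_inner inner_eq_Re_cinner cinner_hardy2.rep_eq)

lemma norm_szego_le: "cmod w < 1 \<Longrightarrow> norm (szego w) \<le> 1 / (1 - cmod w)"
  by (simp add: norm_hardy2_Rep Rep_hardy_of[OF disk_algebra_kernel] norm_kernel_le)

lemma ev_bound:
  assumes "cmod w < 1"
  shows "cmod (ev f w) \<le> norm f / (1 - cmod w)"
proof -
  have "cmod (ev f w) \<le> norm f * norm (szego w)"
    unfolding cinner_szego[OF assms, symmetric] by (rule cinner_Cauchy_Schwarz)
  also have "\<dots> \<le> norm f * (1 / (1 - cmod w))"
    by (intro mult_left_mono norm_szego_le assms) simp
  finally show ?thesis
    by simp
qed

text \<open>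
  The quotient has a removable singularity at \<open>a\<close>, and near the circle it is the product with
  the continuous function \<open>1 / (a - z)\<close>.
\<close>

lemma hardy_divide:
  assumes a: "cmod a < 1" and h: "ev h a = 0"
  shows "\<exists>g. \<forall>z. cmod z < 1 \<longrightarrow> (a - z) * ev g z = ev h z"
proof -
  define G where "G z = - (if z = a then deriv (ev h) a else (ev h z - ev h a) / (z - a))" for z
  have G: "(a - z) * G z = ev h z" for z
    by (simp add: G_def h divide_simps) (simp add: algebra_simps)
  have hol: "G holomorphic_on ball 0 1"
    unfolding G_def using a by (intro holomorphic_intros pole_lemma ev_holomorphic) auto
  define \<rho> where "\<rho> = (cmod a + 1) / 2"
  have \<rho>: "cmod a < \<rho>" "\<rho> < 1"
    using a by (auto simp: \<rho>_def)
  have "has_boundary_function G (abs_circle_L2 (\<lambda>z. 1 / (a - z) * rep_circle_L2 (Rep_hardy2 h) z))"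
  proof (rule has_boundary_function_mult[OF ev_holomorphic ev_boundary _ \<rho>(2)])
    show "continuous_on {z. \<rho> \<le> cmod z \<and> cmod z \<le> 1} (\<lambda>z. 1 / (a - z))"
      using \<rho> by (intro continuous_intros) auto
    show "G z = 1 / (a - z) * ev h z" if "\<rho> < cmod z" "cmod z < 1" for z
      using \<rho> that G[of z, symmetric] by auto
  qed
  then show ?thesis
    using ev_Abs_hardy2[OF hol] G by metis
qed

section \<open>Mobius multipliers and their adjoints\<close>

lemma cinner_ext:
  fixes x y :: "'a::complex_inner"
  assumes "\<And>z. cinner x z = cinner y z"
  shows "x = y"
proof -
  have "cinner (x - y) (x - y) = 0"
    by (simp add: cinner_diff_left assms)
  then show ?thesis
    by (simp add: cinner_self)
qed

lemma disk_algebra_mult: "disk_algebra f \<Longrightarrow> disk_algebra g \<Longrightarrow> disk_algebra (\<lambda>z. f z * g z)"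
  by (auto simp: disk_algebra_def intro!: continuous_intros holomorphic_intros)

lemma disk_algebra_diff: "disk_algebra f \<Longrightarrow> disk_algebra g \<Longrightarrow> disk_algebra (\<lambda>z. f z - g z)"
  by (auto simp: disk_algebra_def intro!: continuous_intros holomorphic_intros)

lemma disk_algebra_power: "disk_algebra f \<Longrightarrow> disk_algebra (\<lambda>z. f z ^ n)"
  by (auto simp: disk_algebra_def intro!: continuous_intros holomorphic_intros)

lemma disk_algebra_const: "disk_algebra (\<lambda>_. c)"
  by (auto simp: disk_algebra_def)

lemma disk_algebra_ident: "disk_algebra (\<lambda>z. z)"
  by (auto simp: disk_algebra_def)

lemma disk_algebra_inverse:
  assumes "disk_algebra f" "\<And>z. cmod z \<le> 1 \<Longrightarrow> f z \<noteq> 0"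
  shows "disk_algebra (\<lambda>z. 1 / f z)"
  using assms unfolding disk_algebra_def
  by (auto intro!: continuous_intros holomorphic_intros)

lemma disk_algebra_involution:
  assumes "cmod a < 1"
  shows "disk_algebra (disk_involution a)"
  using disk_algebra_mult[OF disk_algebra_diff[OF disk_algebra_const disk_algebra_ident] disk_algebra_kernel[OF assms], of a]
  by (simp add: disk_involution_def[abs_def])

lemma disk_involution_on_circle:
  assumes "cmod a < 1" "cmod z = 1"
  shows "cmod (disk_involution a z) = 1"
proof -
  have "z * cnj z = 1"
    using assms by (simp add: complex_norm_square[symmetric])
  then have "1 - cnj a * z = - (z * cnj (a - z))"
    by (simp add: algebra_simps)
  then have "cmod (1 - cnj a * z) = cmod (a - z)"
    using assms by (simp add: norm_mult del: complex_cnj_diff)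
  moreover have "a \<noteq> z"
    using assms by auto
  ultimately show ?thesis
    by (simp add: disk_involution_def norm_divide)
qed

lemma disk_involution_in_disk:
  assumes "cmod a < 1" "cmod z < 1"
  shows "cmod (disk_involution a z) < 1"
proof -
  have "disk_involution a z = - Moebius_function 0 a z"
    by (simp add: disk_involution_def Moebius_function_simple minus_divide_left)
  then show ?thesis
    using Moebius_function_norm_lt_1[OF assms, of 0] by simp
qed

lemma disk_involution_self [simp]: "disk_involution a a = 0"
  by (simp add: disk_involution_def)

lemma one_minus_norm_square_nonzero:
  assumes "cmod a < 1"
  shows "1 - cnj a * a \<noteq> 0" "1 - a * cnj a \<noteq> 0"
  using kernel_denominator_nonzero[of a a] assms by (simp_all add: mult.commute)

abbreviation mob :: "complex \<Rightarrow> hardy2 \<Rightarrow> hardy2" where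
  "mob a \<equiv> hmult (disk_involution a)"

lemma ev_mob: "cmod a < 1 \<Longrightarrow> cmod z < 1 \<Longrightarrow> ev (mob a f) z = disk_involution a z * ev f z"
  by (rule ev_hmult[OF disk_algebra_involution])

lemma hmult_add: "disk_algebra \<psi> \<Longrightarrow> hmult \<psi> (f + g) = hmult \<psi> f + hmult \<psi> g"
  by (rule hardy2_eqI) (simp add: ev_hmult ev_add distrib_left)

lemma hmult_scaleC: "disk_algebra \<psi> \<Longrightarrow> hmult \<psi> (c *\<^sub>C f) = c *\<^sub>C hmult \<psi> f"
  by (rule hardy2_eqI) (simp add: ev_hmult ev_scaleC)

lemma hmult_isometry:
  assumes \<psi>: "disk_algebra \<psi>" and unimodular: "\<And>z. cmod z = 1 \<Longrightarrow> cmod (\<psi> z) = 1"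
  shows "cinner (hmult \<psi> f) (hmult \<psi> g) = cinner f g"
proof -
  let ?f = "rep_circle_L2 (Rep_hardy2 f)" and ?g = "rep_circle_L2 (Rep_hardy2 g)"
  have m: "\<psi> \<in> borel_measurable circle_measure"
    using disk_algebra_square_integrable[OF \<psi>] by (simp add: square_integrable_def)
  have sq: "square_integrable (\<lambda>z. \<psi> z * ?f z)" "square_integrable (\<lambda>z. \<psi> z * ?g z)"
    using unimodular by (auto intro!: square_integrable_mult_bounded[OF m, of 1])
  have "cinner (hmult \<psi> f) (hmult \<psi> g) = (\<integral>z. \<psi> z * ?f z * cnj (\<psi> z * ?g z) \<partial>circle_measure)"
    unfolding cinner_hardy2.rep_eq Rep_hmult[OF \<psi>] by (rule cinner_L2[OF sq])
  also have "\<dots> = (\<integral>z. ?f z * cnj (?g z) \<partial>circle_measure)"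
  proof (rule Bochner_Integration.integral_cong[OF refl])
    fix z assume "z \<in> space circle_measure"
    then have "\<psi> z * cnj (\<psi> z) = 1"
      using unimodular[of z] by (simp add: space_circle_measure complex_norm_square[symmetric])
    then show "\<psi> z * ?f z * cnj (\<psi> z * ?g z) = ?f z * cnj (?g z)"
      by (simp add: mult.left_commute mult.commute)
  qed
  also have "\<dots> = cinner f g"
    unfolding cinner_hardy2.rep_eq by (subst cinner_L2[symmetric]) simp_all
  finally show ?thesis .
qed

lemma mob_isometry: "cmod a < 1 \<Longrightarrow> cinner (mob a f) (mob a g) = cinner f g"
  by (rule hmult_isometry[OF disk_algebra_involution disk_involution_on_circle])

text \<open>
  The adjoint of \<open>mob a\<close> projects \<open>cnj (disk_involution a) f\<close> to the Hardy space.  As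
  \<open>cnj (disk_involution a z) = (1 - cnj a * z) / (a - z)\<close> on the circle, the projection removes the pole
  at \<open>a\<close>; the equation is this, cleared of the denominator.
\<close>

definition mob_adj :: "complex \<Rightarrow> hardy2 \<Rightarrow> hardy2" where
  "mob_adj a f = (SOME g. \<forall>z. cmod z < 1 \<longrightarrow>
     (a - z) * ev g z = (1 - cnj a * z) * ev f z - (1 - cnj a * a) * ev f a)"

lemma ev_mob_adj:
  assumes a: "cmod a < 1" and z: "cmod z < 1"
  shows "(a - z) * ev (mob_adj a f) z = (1 - cnj a * z) * ev f z - (1 - cnj a * a) * ev f a"
proof -
  have da: "disk_algebra (\<lambda>z. 1 - cnj a * z)"
    by (intro disk_algebra_diff disk_algebra_mult disk_algebra_const disk_algebra_ident)
  define h where "h = hmult (\<lambda>z. 1 - cnj a * z) f - ((1 - cnj a * a) * ev f a) *\<^sub>C hardy_of (\<lambda>_. 1)"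
  have h: "ev h z = (1 - cnj a * z) * ev f z - (1 - cnj a * a) * ev f a" if "cmod z < 1" for z
    using that by (simp add: h_def ev_diff ev_hmult[OF da] ev_scaleC ev_hardy_of[OF disk_algebra_const])
  have "\<exists>g. \<forall>z. cmod z < 1 \<longrightarrow> (a - z) * ev g z = ev h z"
    using a by (intro hardy_divide) (simp_all add: h)
  then have "\<exists>g. \<forall>z. cmod z < 1 \<longrightarrow> (a - z) * ev g z = (1 - cnj a * z) * ev f z - (1 - cnj a * a) * ev f a"
    by (simp add: h)
  from someI_ex[OF this] show ?thesis
    using z unfolding mob_adj_def by blast
qed

text \<open>
  The defect of \<open>mob a\<close> from being onto is the line of the kernel at \<open>a\<close>: removing the value
  at \<open>a\<close> makes a function divisible by \<open>disk_involution a\<close>.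
\<close>

lemma mob_mob_adj:
  assumes "cmod a < 1"
  shows "f = mob a (mob_adj a f) + ((1 - cnj a * a) * ev f a) *\<^sub>C szego a"
proof (rule hardy2_eqI)
  fix z assume z: "cmod z < 1"
  have "1 - cnj a * z \<noteq> 0"
    using assms z kernel_denominator_nonzero by auto
  then show "ev f z = ev (mob a (mob_adj a f) + ((1 - cnj a * a) * ev f a) *\<^sub>C szego a) z"
    using ev_mob_adj[OF assms z, of f]
    by (simp add: ev_add ev_mob[OF assms z] ev_scaleC ev_hardy_of[OF disk_algebra_kernel[OF assms] z] disk_involution_def)
       (simp add: divide_simps)
qed

text \<open>
  Pair the decomposition \<open>mob_mob_adj\<close> with \<open>mob a g\<close>.  The kernel term drops out because
  \<open>mob a g\<close> vanishes at \<open>a\<close>, and the isometry cancels \<open>mob a\<close> in the other term.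
\<close>

lemma mob_adj_adjoint:
  assumes a: "cmod a < 1"
  shows "cinner (mob_adj a f) g = cinner f (mob a g)"
proof -
  have "cinner (szego a) (mob a g) = 0"
    using cinner_szego[OF a, of "mob a g"] cinner_commute[of "szego a"] by (simp add: ev_mob[OF a a])
  then show ?thesis
    by (subst (2) mob_mob_adj[OF a]) (simp add: cinner_add_left cinner_scaleC_left mob_isometry[OF a])
qed

lemma mob_adj_add: "cmod a < 1 \<Longrightarrow> mob_adj a (f + g) = mob_adj a f + mob_adj a g"
  by (rule cinner_ext) (simp add: mob_adj_adjoint cinner_add_left)

lemma mob_adj_scaleC: "cmod a < 1 \<Longrightarrow> mob_adj a (c *\<^sub>C f) = c *\<^sub>C mob_adj a f"
  by (rule cinner_ext) (simp add: mob_adj_adjoint cinner_scaleC_left)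

lemma norm_mob:
  assumes "cmod a < 1"
  shows "norm (mob a f) = norm f"
  using mob_isometry[OF assms, of f f] by (simp add: norm_eq_sqrt_inner inner_eq_Re_cinner)

lemma norm_mob_adj_le:
  assumes "cmod a < 1"
  shows "norm (mob_adj a f) \<le> norm f"
proof -
  have "complex_of_real ((norm (mob_adj a f))\<^sup>2) = cinner f (mob a (mob_adj a f))"
    by (simp only: mob_adj_adjoint[OF assms, symmetric] cinner_self)
  then have "(norm (mob_adj a f))\<^sup>2 = cmod (cinner f (mob a (mob_adj a f)))"
    using norm_of_real[of "(norm (mob_adj a f))\<^sup>2", where 'a = complex] by simp
  also have "\<dots> \<le> norm f * norm (mob_adj a f)"
    using cinner_Cauchy_Schwarz norm_mob[OF assms] by metis
  finally show ?thesis
    by (cases "norm (mob_adj a f) = 0") (auto simp: power2_eq_square)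
qed

section \<open>The orthonormal systems\<close>

lemma normalizing_factor_square:
  assumes "cmod a < 1"
  shows "of_real (sqrt (1 - (cmod a)\<^sup>2)) * of_real (sqrt (1 - (cmod a)\<^sup>2)) = 1 - cnj a * a"
proof -
  have "0 < 1 - (cmod a)\<^sup>2"
    using assms abs_square_less_1[of "cmod a"] by simp
  then show ?thesis
    by (simp add: of_real_mult[symmetric] mult.commute[of "cnj a"] complex_norm_square[symmetric] del: of_real_mult)
qed

lemma disk_algebra_normalized_kernel:
  assumes "cmod a < 1"
  shows "disk_algebra (normalized_kernel a)"
  unfolding normalized_kernel_def[abs_def]
  by (rule disk_algebra_mult[OF disk_algebra_const disk_algebra_kernel[OF assms]])

lemma ev_hardy_basis:
  assumes a: "cmod a < 1" and z: "cmod z < 1"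
  shows "ev (hardy_basis a m) z = disk_involution a z ^ m * normalized_kernel a z"
proof -
  have eq: "hardy_basis a m = hardy_of (\<lambda>z. disk_involution a z ^ m * normalized_kernel a z)"
    by (simp add: hardy_basis_def hardy_of_def)
  show ?thesis
    unfolding eq using z a
    by (intro ev_hardy_of disk_algebra_mult disk_algebra_power disk_algebra_involution disk_algebra_normalized_kernel)
qed

lemma hardy_basis_0:
  assumes "cmod a < 1"
  shows "hardy_basis a 0 = of_real (sqrt (1 - (cmod a)\<^sup>2)) *\<^sub>C szego a"
  by (rule hardy2_eqI)
     (simp add: ev_hardy_basis[OF assms] ev_scaleC ev_hardy_of[OF disk_algebra_kernel[OF assms]] normalized_kernel_def)

lemma hardy_basis_Suc: "cmod a < 1 \<Longrightarrow> hardy_basis a (Suc m) = mob a (hardy_basis a m)"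
  by (rule hardy2_eqI) (simp add: ev_hardy_basis ev_mob)

lemma cinner_hardy_basis_0:
  assumes "cmod a < 1"
  shows "cinner f (hardy_basis a 0) = of_real (sqrt (1 - (cmod a)\<^sup>2)) * ev f a"
  by (simp add: hardy_basis_0[OF assms] cinner_scaleC_right cinner_szego[OF assms])

text \<open>
  The isometry \<open>mob a\<close> lowers both indices by one, which reduces everything to inner products with
  \<open>hardy_basis a 0\<close>, that is, to values at \<open>a\<close>.
\<close>

lemma hardy_basis_orthonormal:
  assumes a: "cmod a < 1"
  shows "orthonormal_seq (hardy_basis a)"
proof -
  note s = normalizing_factor_square[OF a]
  have 00: "cinner (hardy_basis a 0) (hardy_basis a 0) = 1"
    using one_minus_norm_square_nonzero[OF a] s
    by (simp add: cinner_hardy_basis_0[OF a] ev_hardy_basis[OF a a] normalized_kernel_def mult.assoc[symmetric])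
  have S0: "cinner (hardy_basis a (Suc n)) (hardy_basis a 0) = 0" for n
    by (simp add: cinner_hardy_basis_0[OF a] hardy_basis_Suc[OF a] ev_mob[OF a a])
  have 0: "cinner (hardy_basis a m) (hardy_basis a 0) = (if m = 0 then 1 else 0)" for m
    using 00 S0 by (cases m) auto
  have "cinner (hardy_basis a m) (hardy_basis a n) = (if m = n then 1 else 0)" for m n
  proof (induction n arbitrary: m)
    case (Suc n)
    show ?case
    proof (cases m)
      case 0
      then show ?thesis
        using S0[of n] cinner_commute[of "hardy_basis a 0"] by simp
    next
      case (Suc k)
      then show ?thesis
        using Suc.IH[of k] by (simp add: hardy_basis_Suc[OF a] mob_isometry[OF a])
    qed
  qed (simp add: 0)
  then show ?thesis
    by (simp add: orthonormal_seq_def)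
qed

lemma cinner_mob_adj_power:
  assumes "cmod a < 1"
  shows "cinner ((mob_adj a ^^ n) f) (hardy_basis a 0) = cinner f (hardy_basis a n)"
proof -
  have "cinner ((mob_adj a ^^ n) f) (hardy_basis a m) = cinner f (hardy_basis a (n + m))" for m
    by (induction n arbitrary: m) (simp_all add: mob_adj_adjoint[OF assms] hardy_basis_Suc[OF assms, symmetric])
  then show ?thesis
    by simp
qed

lemma norm_mob_adj_power_le: "cmod a < 1 \<Longrightarrow> norm ((mob_adj a ^^ n) f) \<le> norm f"
  by (induction n) (auto intro: order_trans[OF norm_mob_adj_le])

text \<open>
  Iterating \<open>mob_mob_adj\<close> splits off one coefficient at a time; the remainder keeps the
  factor \<open>disk_involution a z ^ n\<close>, which is what makes it tend to zero.
\<close>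

lemma hardy_expansion:
  assumes a: "cmod a < 1" and z: "cmod z < 1"
  shows "ev f z = (\<Sum>m<n. cinner f (hardy_basis a m) * ev (hardy_basis a m) z)
      + disk_involution a z ^ n * ev ((mob_adj a ^^ n) f) z"
proof (induction n)
  case (Suc n)
  note s = normalizing_factor_square[OF a]
  let ?g = "(mob_adj a ^^ n) f"
  have "?g = mob a (mob_adj a ?g) + cinner ?g (hardy_basis a 0) *\<^sub>C hardy_basis a 0"
  proof -
    have eq: "of_real (sqrt (1 - (cmod a)\<^sup>2)) * ev ?g a * of_real (sqrt (1 - (cmod a)\<^sup>2)) = (1 - cnj a * a) * ev ?g a"
      unfolding s[symmetric] by (simp only: mult_ac)
    have "cinner ?g (hardy_basis a 0) *\<^sub>C hardy_basis a 0
        = (of_real (sqrt (1 - (cmod a)\<^sup>2)) * ev ?g a * of_real (sqrt (1 - (cmod a)\<^sup>2))) *\<^sub>C szego a"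
      unfolding cinner_hardy_basis_0[OF a] unfolding hardy_basis_0[OF a] scaleC_scaleC ..
    also have "\<dots> = ((1 - cnj a * a) * ev ?g a) *\<^sub>C szego a"
      by (simp only: eq)
    finally show ?thesis
      using mob_mob_adj[OF a, of ?g] by (simp only:)
  qed
  then have "ev ?g z = disk_involution a z * ev ((mob_adj a ^^ Suc n) f) z
      + cinner f (hardy_basis a n) * normalized_kernel a z"
    by (subst (asm) cinner_mob_adj_power[OF a])
       (metis (no_types, lifting) ev_add ev_mob[OF a z] ev_scaleC ev_hardy_basis[OF a z] funpow.simps(2) comp_apply mult_1 power_0)
  then show ?case
    using Suc.IH by (simp add: ev_hardy_basis[OF a z] algebra_simps)
qed simp

section \<open>The Hardy space is complete\<close>

text \<open>
  At centre 0 the basis functions are \<open>(- z) ^ m\<close>, and on the circle of radius \<open>r\<close> the remainder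
  of the expansion is of order \<open>r ^ n\<close> uniformly.  So the dilate is the limit of the partial sums with
  coefficients \<open>c m * r ^ m\<close>, whose norms Bessel's inequality bounds by the norm of \<open>f\<close>.
\<close>

lemma norm_dilate_le:
  assumes r: "0 \<le> r" "r < 1"
  shows "norm (abs_circle_L2 (\<lambda>z. ev f (of_real r * z))) \<le> norm f"
proof (rule LIMSEQ_le_const)
  define c where "c m = cinner f (hardy_basis 0 m)" for m
  define s where "s n = (\<Sum>m<n. (c m * of_real r ^ m) *\<^sub>C hardy_basis 0 m)" for n
  have da: "disk_algebra (\<lambda>z. \<Sum>m<n. (c m * of_real r ^ m) * (- z) ^ m)" for n
    unfolding disk_algebra_def by (intro conjI continuous_intros holomorphic_intros)
  have evb: "ev (hardy_basis 0 m) z = (- z) ^ m" if "cmod z < 1" for m z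
    using that by (simp add: ev_hardy_basis disk_involution_def normalized_kernel_def)
  have s_eq: "s n = hardy_of (\<lambda>z. \<Sum>m<n. (c m * of_real r ^ m) * (- z) ^ m)" for n
    by (rule hardy2_eqI) (simp add: s_def ev_sum ev_scaleC evb ev_hardy_of[OF da])
  have sqF: "square_integrable (\<lambda>z. ev f (of_real r * z))"
    by (rule square_integrable_dilate[OF ev_holomorphic r])
  have err: "norm (abs_circle_L2 (\<lambda>z. ev f (of_real r * z)) - Rep_hardy2 (s n)) \<le> r ^ n * (norm f / (1 - r))" for n
  proof -
    have sq: "square_integrable (\<lambda>z. \<Sum>m<n. (c m * of_real r ^ m) * (- z) ^ m)"
      by (rule disk_algebra_square_integrable[OF da])
    have "norm (abs_circle_L2 (\<lambda>z. ev f (of_real r * z) - (\<Sum>m<n. (c m * of_real r ^ m) * (- z) ^ m)))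
        \<le> r ^ n * (norm f / (1 - r))"
    proof (rule norm_L2_le)
      show "(\<lambda>z. ev f (of_real r * z) - (\<Sum>m<n. (c m * of_real r ^ m) * (- z) ^ m)) \<in> borel_measurable circle_measure"
        using square_integrable_diff[OF sqF sq] by (simp add: square_integrable_def)
    next
      fix z :: complex assume z: "cmod z = 1"
      have rz: "cmod (of_real r * z) = r"
        using z r by (simp add: norm_mult)
      have "ev f (of_real r * z) - (\<Sum>m<n. (c m * of_real r ^ m) * (- z) ^ m)
          = (- (of_real r * z)) ^ n * ev ((mob_adj 0 ^^ n) f) (of_real r * z)"
        using hardy_expansion[of 0 "of_real r * z" f n] rz r
        by (simp add: evb c_def disk_involution_def mult.assoc power_mult_distrib[symmetric])
      also have "cmod \<dots> \<le> r ^ n * (norm ((mob_adj 0 ^^ n) f) / (1 - r))"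
        using ev_bound[of "of_real r * z" "(mob_adj 0 ^^ n) f"] r
        unfolding norm_mult norm_power norm_minus_cancel rz[unfolded norm_mult]
        by (intro mult_left_mono) auto
      also have "\<dots> \<le> r ^ n * (norm f / (1 - r))"
        using r by (intro mult_left_mono divide_right_mono norm_mob_adj_power_le) auto
      finally show "cmod (ev f (of_real r * z) - (\<Sum>m<n. (c m * of_real r ^ m) * (- z) ^ m)) \<le> r ^ n * (norm f / (1 - r))" .
    qed
    then show ?thesis
      by (simp add: s_eq Rep_hardy_of[OF da] L2_diff[OF sqF sq])
  qed
  have s_le: "norm (s n) \<le> norm f" for n
  proof (rule power2_le_imp_le)
    have "(norm (s n))\<^sup>2 = (\<Sum>m<n. (cmod (c m * of_real r ^ m))\<^sup>2)"
      unfolding s_def by (rule norm_orthonormal_sum[OF hardy_basis_orthonormal]) auto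
    also have "\<dots> \<le> (\<Sum>m<n. (cmod (c m))\<^sup>2)"
      using r by (intro sum_mono power_mono) (auto simp: norm_mult norm_power power_le_one mult_left_le)
    also have "\<dots> \<le> (norm f)\<^sup>2"
      unfolding c_def by (rule Bessel[OF hardy_basis_orthonormal]) simp
    finally show "(norm (s n))\<^sup>2 \<le> (norm f)\<^sup>2" .
  qed simp
  show "\<exists>N. \<forall>n\<ge>N. norm (abs_circle_L2 (\<lambda>z. ev f (of_real r * z))) \<le> r ^ n * (norm f / (1 - r)) + norm f"
  proof (intro exI[of _ 0] allI impI)
    fix n
    show "norm (abs_circle_L2 (\<lambda>z. ev f (of_real r * z))) \<le> r ^ n * (norm f / (1 - r)) + norm f"
      using err[of n] s_le[of n] norm_triangle_ineq2[of "abs_circle_L2 (\<lambda>z. ev f (of_real r * z))" "Rep_hardy2 (s n)"]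
      by (simp add: norm_hardy2_Rep)
  qed
  show "(\<lambda>n. r ^ n * (norm f / (1 - r)) + norm f) \<longlonglongrightarrow> norm f"
    using r by (auto intro!: tendsto_eq_intros LIMSEQ_power_zero)
qed


lemma Rep_hardy2_diff: "Rep_hardy2 (f - g) = Rep_hardy2 f - Rep_hardy2 g"
  unfolding minus_hardy2_def plus_hardy2.rep_eq scaleC_hardy2.rep_eq by (simp add: scaleC_minus_one)

text \<open>
  The limit of boundary functions in $L^2$ is a boundary function: evaluations are bounded uniformly
  on smaller discs, so the values converge locally uniformly to a holomorphic function, and since
  dilation is a contraction (\<open>norm_dilate_le\<close>) the limit along the sequence may be interchanged with the
  radial limit.
\<close>

instance hardy2 :: complete_space
proof
  fix X :: "nat \<Rightarrow> hardy2"
  assume X: "Cauchy X"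
  have dist_Rep: "norm (Rep_hardy2 f - Rep_hardy2 g) = norm (f - g)" for f g
    by (simp add: norm_hardy2_Rep[of "f - g"] Rep_hardy2_diff)
  have "Cauchy (\<lambda>n. Rep_hardy2 (X n))"
    using X unfolding Cauchy_def dist_norm dist_Rep .
  then obtain g where g: "(\<lambda>n. Rep_hardy2 (X n)) \<longlonglongrightarrow> g"
    using Cauchy_convergent convergent_def by blast
  define F where "F w = cinner g (abs_circle_L2 (\<lambda>z. 1 / (1 - cnj w * z)))" for w
  let ?d = "\<lambda>n. norm (Rep_hardy2 (X n) - g)"
  have d0: "?d \<longlonglongrightarrow> 0"
    using g by (simp add: LIM_zero_iff tendsto_norm_zero_iff)
  have F_close: "cmod (ev (X n) w - F w) \<le> ?d n / (1 - s)" if "cmod w \<le> s" "s < 1" for n w s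
  proof -
    have w: "cmod w < 1"
      using that by simp
    have "cmod (ev (X n) w - F w) \<le> ?d n * norm (abs_circle_L2 (\<lambda>z. 1 / (1 - cnj w * z)))"
      unfolding ev_def F_def cinner_diff_left[symmetric] by (rule cinner_Cauchy_Schwarz)
    also have "\<dots> \<le> ?d n * (1 / (1 - cmod w))"
      by (intro mult_left_mono norm_kernel_le w) simp
    also have "\<dots> \<le> ?d n * (1 / (1 - s))"
      using that by (intro mult_left_mono divide_left_mono) auto
    finally show ?thesis
      by simp
  qed
  have unif: "uniform_limit (cball 0 s) (\<lambda>n. ev (X n)) F sequentially" if s: "s < 1" for s
    unfolding uniform_limit_iff
  proof (intro allI impI)
    fix e :: real assume "e > 0"
    then have "\<forall>\<^sub>F n in sequentially. ?d n < e * (1 - s)"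
      using s by (intro order_tendstoD(2)[OF d0]) simp
    then show "\<forall>\<^sub>F n in sequentially. \<forall>w\<in>cball 0 s. dist (ev (X n) w) (F w) < e"
    proof eventually_elim
      case (elim n)
      then have "?d n / (1 - s) < e"
        using s by (simp add: pos_divide_less_eq)
      show ?case
      proof
        fix w :: complex assume "w \<in> cball 0 s"
        then have "cmod (ev (X n) w - F w) \<le> ?d n / (1 - s)"
          using s by (intro F_close) auto
        then show "dist (ev (X n) w) (F w) < e"
          using \<open>?d n / (1 - s) < e\<close> by (simp add: dist_norm)
      qed
    qed
  qed
  have hol: "F holomorphic_on ball 0 1"
  proof (rule holomorphic_uniform_sequence[OF open_ball ev_holomorphic])
    fix w :: complex assume w: "w \<in> ball 0 1"
    define d where "d = (1 - cmod w) / 2"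
    have "cball w d \<subseteq> cball 0 ((1 + cmod w) / 2)"
    proof
      fix z assume "z \<in> cball w d"
      then show "z \<in> cball 0 ((1 + cmod w) / 2)"
        using norm_triangle_ineq2[of z w] by (simp add: d_def dist_norm norm_minus_commute field_simps)
    qed
    moreover have "(1 + cmod w) / 2 < 1"
      using w by simp
    moreover from this have "cball 0 ((1 + cmod w) / 2) \<subseteq> ball (0::complex) 1"
      by auto
    moreover have "0 < d"
      using w by (simp add: d_def)
    ultimately show "\<exists>d>0. cball w d \<subseteq> ball 0 1 \<and> uniform_limit (cball w d) (\<lambda>n. ev (X n)) F sequentially"
      using uniform_limit_on_subset[OF unif] by (metis subset_trans)
  qed
  let ?D = "\<lambda>G r. abs_circle_L2 (\<lambda>z. G (complex_of_real r * z))"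
  have dil_lim: "(\<lambda>m. ?D (ev (X m)) r) \<longlonglongrightarrow> ?D F r" if r: "0 \<le> r" "r < 1" for r
  proof -
    have "norm (?D (ev (X m)) r - ?D F r) \<le> ?d m / (1 - r)" for m
      unfolding L2_diff[OF square_integrable_dilate[OF ev_holomorphic r] square_integrable_dilate[OF hol r], symmetric]
    proof (rule norm_L2_le)
      show "(\<lambda>z. ev (X m) (of_real r * z) - F (of_real r * z)) \<in> borel_measurable circle_measure"
        using square_integrable_diff[OF square_integrable_dilate[OF ev_holomorphic r] square_integrable_dilate[OF hol r]]
        by (simp add: square_integrable_def)
      show "cmod (ev (X m) (of_real r * z) - F (of_real r * z)) \<le> ?d m / (1 - r)" if "cmod z = 1" for z
        using that r by (intro F_close) (auto simp: norm_mult)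
    qed
    moreover have "(\<lambda>m. ?d m / (1 - r)) \<longlonglongrightarrow> 0"
      by (rule tendsto_divide_zero[OF d0])
    ultimately have "(\<lambda>m. ?D (ev (X m)) r - ?D F r) \<longlonglongrightarrow> 0"
      by (rule Lim_null_comparison[OF always_eventually[OF allI]])
    then show ?thesis
      by (rule LIM_zero_cancel)
  qed
  have dil_close: "norm (?D (ev (X n)) r - ?D F r) \<le> ?d n" if r: "0 \<le> r" "r < 1" for r n
  proof (rule LIMSEQ_le[OF tendsto_norm[OF tendsto_diff[OF tendsto_const dil_lim[OF r]]]
        tendsto_norm[OF tendsto_diff[OF tendsto_const g]]])
    have "norm (?D (ev (X n)) r - ?D (ev (X m)) r) \<le> norm (Rep_hardy2 (X n) - Rep_hardy2 (X m))" for m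
      using norm_dilate_le[OF r, of "X n - X m"]
      unfolding L2_diff[OF square_integrable_dilate[OF ev_holomorphic r] square_integrable_dilate[OF ev_holomorphic r], symmetric]
        dist_Rep ev_diff .
    then show "\<exists>N. \<forall>m\<ge>N. norm (?D (ev (X n)) r - ?D (ev (X m)) r) \<le> norm (Rep_hardy2 (X n) - Rep_hardy2 (X m))"
      by blast
  qed
  have bd: "has_boundary_function F g"
    unfolding has_boundary_function_def tendsto_iff
  proof (intro allI impI)
    fix e :: real assume e: "e > 0"
    then obtain n where n: "?d n < e / 3"
      using order_tendstoD(2)[OF d0, of "e / 3"] eventually_sequentially by auto
    have "\<forall>\<^sub>F r in at_left 1. dist (?D (ev (X n)) r) (Rep_hardy2 (X n)) < e / 3"
      using ev_boundary[of "X n"] e unfolding has_boundary_function_def by (intro tendstoD) auto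
    then show "\<forall>\<^sub>F r in at_left 1. dist (?D F r) g < e"
      using at_left_1_unit_interval
    proof eventually_elim
      case (elim r)
      have "dist (?D F r) (?D (ev (X n)) r) \<le> ?d n"
        using elim dil_close[of r n] by (simp add: dist_norm norm_minus_commute)
      then show ?case
        using dist_triangle[of "?D F r" g "?D (ev (X n)) r"]
          dist_triangle[of "?D (ev (X n)) r" g "Rep_hardy2 (X n)"] n elim(1)
        unfolding dist_norm[of "Rep_hardy2 (X n)" g] by linarith
    qed
  qed
  have "?d = (\<lambda>n. norm (X n - Abs_hardy2 g))"
    using Rep_Abs_hardy2[OF hol bd] dist_Rep by metis
  then have "X \<longlonglongrightarrow> Abs_hardy2 g"
    using d0 by (simp add: LIM_zero_iff tendsto_norm_zero_iff)
  then show "convergent X"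
    by (auto simp: convergent_def)
qed

instance hardy2 :: banach ..

section \<open>The conjugations\<close>

text \<open>
  When all coefficients vanish, the value at \<open>z\<close> equals the remainder of \<open>hardy_expansion\<close> for
  every \<open>n\<close>, and this tends to zero because \<open>disk_involution a z\<close> lies in the disc.
\<close>

lemma hardy_basis_total:
  assumes a: "cmod a < 1" and orth: "\<And>m. cinner f (hardy_basis a m) = 0"
  shows "f = 0"
proof (rule hardy2_eqI)
  fix z assume z: "cmod z < 1"
  let ?w = "cmod (disk_involution a z)" and ?B = "norm f / (1 - cmod z)"
  have "cmod (ev f z) \<le> ?w ^ n * ?B" for n
  proof -
    have "cmod (ev f z) = ?w ^ n * cmod (ev ((mob_adj a ^^ n) f) z)"
      using hardy_expansion[OF a z, of f n] orth by (simp add: norm_mult norm_power)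
    also have "cmod (ev ((mob_adj a ^^ n) f) z) \<le> norm ((mob_adj a ^^ n) f) / (1 - cmod z)"
      by (rule ev_bound[OF z])
    also have "\<dots> \<le> ?B"
      using z by (intro divide_right_mono norm_mob_adj_power_le a) auto
    finally show ?thesis
      by (simp add: mult_left_mono)
  qed
  moreover have "(\<lambda>n. ?w ^ n * ?B) \<longlonglongrightarrow> 0"
    using disk_involution_in_disk[OF a z] by (intro tendsto_mult_left_zero LIMSEQ_power_zero) auto
  ultimately have "cmod (ev f z) \<le> 0"
    by (intro LIMSEQ_le_const) auto
  then show "ev f z = ev 0 z"
    by simp
qed

lemma hardy_basis_ext:
  assumes "cmod a < 1" "\<And>m. cinner f (hardy_basis a m) = cinner g (hardy_basis a m)"
  shows "f = g"
  using hardy_basis_total[OF assms(1), of "f - g"] assms(2) by (simp add: cinner_diff_left)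

lemma hardy_basis_sums_iff:
  assumes a: "cmod a < 1"
  shows "(\<lambda>m. \<mu> m *\<^sub>C hardy_basis a m) sums f \<longleftrightarrow> (\<forall>m. cinner f (hardy_basis a m) = \<mu> m)"
proof
  assume "(\<lambda>m. \<mu> m *\<^sub>C hardy_basis a m) sums f"
  then show "\<forall>m. cinner f (hardy_basis a m) = \<mu> m"
    using orthonormal_sums_coefficient[OF hardy_basis_orthonormal[OF a]] by blast
next
  assume c: "\<forall>m. cinner f (hardy_basis a m) = \<mu> m"
  have "summable (\<lambda>m. \<mu> m *\<^sub>C hardy_basis a m)"
    using orthonormal_expansion_summable[OF hardy_basis_orthonormal[OF a], of f] c by simp
  then obtain g where g: "(\<lambda>m. \<mu> m *\<^sub>C hardy_basis a m) sums g"
    by (auto simp: summable_def)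
  then have "g = f"
    using orthonormal_sums_coefficient[OF hardy_basis_orthonormal[OF a] g] c
    by (intro hardy_basis_ext[OF a]) simp
  then show "(\<lambda>m. \<mu> m *\<^sub>C hardy_basis a m) sums f"
    using g by simp
qed

text \<open>
  The changed coefficients are still square summable, so by completeness they belong to a vector,
  and by totality to only one.
\<close>

lemma cinner_C_conj_basis:
  assumes \<omega>: "cmod \<omega> = 1" and a: "cmod a < 1"
  shows "cinner (C_conj \<omega> a f) (hardy_basis a m) = cnj (cinner f (hardy_basis a m)) * cnj \<omega> ^ m"
proof -
  let ?c = "\<lambda>m. cinner f (hardy_basis a m)"
  have "summable (\<lambda>m. (cmod (?c m))\<^sup>2)"
    by (rule summableI_nonneg_bounded[where x = "(norm f)\<^sup>2"]) (simp_all add: Bessel[OF hardy_basis_orthonormal[OF a]])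
  then have "summable (\<lambda>m. (cmod (cnj (?c m) * cnj \<omega> ^ m))\<^sup>2)"
    by (simp add: norm_mult norm_power \<omega>)
  from orthonormal_summable[OF hardy_basis_orthonormal[OF a] this]
  obtain g where g: "(\<lambda>m. (cnj (?c m) * cnj \<omega> ^ m) *\<^sub>C hardy_basis a m) sums g"
    by (auto simp: summable_def)
  have "C_conj \<omega> a f = g"
    unfolding C_conj_def
  proof (rule the_equality)
    show "\<exists>\<mu>. (\<lambda>m. \<mu> m *\<^sub>C hardy_basis a m) sums f \<and> (\<lambda>m. (cnj (\<mu> m) * cnj \<omega> ^ m) *\<^sub>C hardy_basis a m) sums g"
      using g by (intro exI[of _ ?c]) (simp add: hardy_basis_sums_iff[OF a])
  next
    fix g' assume "\<exists>\<mu>. (\<lambda>m. \<mu> m *\<^sub>C hardy_basis a m) sums f \<and> (\<lambda>m. (cnj (\<mu> m) * cnj \<omega> ^ m) *\<^sub>C hardy_basis a m) sums g'"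
    then obtain \<mu> where "\<forall>m. ?c m = \<mu> m" "\<forall>m. cinner g' (hardy_basis a m) = cnj (\<mu> m) * cnj \<omega> ^ m"
      unfolding hardy_basis_sums_iff[OF a] by blast
    then show "g' = g"
      using g unfolding hardy_basis_sums_iff[OF a] by (intro hardy_basis_ext[OF a]) simp
  qed
  then show ?thesis
    using g unfolding hardy_basis_sums_iff[OF a] by simp
qed

lemma hardy_basis_Parseval:
  assumes a: "cmod a < 1"
  shows "(\<lambda>m. cinner f (hardy_basis a m) * cnj (cinner g (hardy_basis a m))) sums cinner f g"
proof -
  have "(\<lambda>m. cinner f (hardy_basis a m) *\<^sub>C hardy_basis a m) sums f"
    by (simp add: hardy_basis_sums_iff[OF a])
  from bounded_linear.sums[OF bounded_linear_cinner_left this, of g]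
  show ?thesis
    by (simp add: cinner_scaleC_left cinner_commute[of "hardy_basis a _" g])
qed

lemma conjugation_C_conj:
  assumes \<omega>: "cmod \<omega> = 1" and a: "cmod a < 1"
  shows "conjugation (C_conj \<omega> a)"
  unfolding conjugation_def
proof (intro conjI allI)
  note [simp] = cinner_C_conj_basis[OF \<omega> a]
  have \<omega>1: "\<omega> ^ m * cnj \<omega> ^ m = 1" for m
    using \<omega> by (simp add: power_mult_distrib[symmetric] complex_norm_square[symmetric])
  show "C_conj \<omega> a (x + y) = C_conj \<omega> a x + C_conj \<omega> a y" for x y
    by (rule hardy_basis_ext[OF a]) (simp add: cinner_add_left distrib_right)
  show "C_conj \<omega> a (c *\<^sub>C x) = cnj c *\<^sub>C C_conj \<omega> a x" for c x
    by (rule hardy_basis_ext[OF a]) (simp add: cinner_scaleC_left)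
  show "C_conj \<omega> a \<circ> C_conj \<omega> a = id"
  proof
    fix x
    show "(C_conj \<omega> a \<circ> C_conj \<omega> a) x = id x"
      by (rule hardy_basis_ext[OF a]) (simp add: \<omega>1 mult.assoc)
  qed
  show "cinner (C_conj \<omega> a x) (C_conj \<omega> a y) = cinner y x" for x y
  proof -
    have "cinner (C_conj \<omega> a x) (hardy_basis a m) * cnj (cinner (C_conj \<omega> a y) (hardy_basis a m))
        = cinner y (hardy_basis a m) * cnj (cinner x (hardy_basis a m)) * (\<omega> ^ m * cnj \<omega> ^ m)" for m
      by simp
    then have "(\<lambda>m. cinner y (hardy_basis a m) * cnj (cinner x (hardy_basis a m)))
        sums cinner (C_conj \<omega> a x) (C_conj \<omega> a y)"
      using hardy_basis_Parseval[OF a, of "C_conj \<omega> a x" "C_conj \<omega> a y"]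
      by (simp only: \<omega>1 mult_1_right)
    then show ?thesis
      using hardy_basis_Parseval[OF a, of y x] by (rule sums_unique2)
  qed
qed

lemma C_conj_mob:
  assumes \<omega>: "cmod \<omega> = 1" and a: "cmod a < 1"
  shows "C_conj \<omega> a (mob a f) = cnj \<omega> *\<^sub>C mob a (C_conj \<omega> a f)"
proof (rule hardy_basis_ext[OF a])
  fix m
  have 0: "cinner (mob a g) (hardy_basis a 0) = 0" for g
    by (simp add: cinner_hardy_basis_0[OF a] ev_mob[OF a a])
  show "cinner (C_conj \<omega> a (mob a f)) (hardy_basis a m) = cinner (cnj \<omega> *\<^sub>C mob a (C_conj \<omega> a f)) (hardy_basis a m)"
  proof (cases m)
    case (Suc k)
    have S: "cinner (mob a g) (hardy_basis a (Suc k)) = cinner g (hardy_basis a k)" for g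
      by (simp add: hardy_basis_Suc[OF a] mob_isometry[OF a])
    then show ?thesis
      unfolding Suc cinner_C_conj_basis[OF \<omega> a] cinner_scaleC_left S by simp
  qed (simp add: cinner_C_conj_basis[OF \<omega> a] cinner_scaleC_left 0)
qed

section \<open>The operator and its adjoint\<close>

lemma hardy_projection_eqI:
  assumes "\<And>g. cinner (f - Rep_hardy2 h) (Rep_hardy2 g) = 0"
  shows "hardy_projection f = h"
  unfolding hardy_projection_def
proof (rule the_equality)
  fix h' assume "\<forall>g. cinner (f - Rep_hardy2 h') (Rep_hardy2 g) = 0"
  then have "cinner f (Rep_hardy2 g) = cinner h' g" for g
    by (simp add: cinner_diff_left cinner_hardy2.rep_eq)
  moreover have "cinner f (Rep_hardy2 g) = cinner h g" for g
    using assms by (simp add: cinner_diff_left cinner_hardy2.rep_eq)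
  ultimately show "h' = h"
    by (intro cinner_ext) metis
qed (use assms in blast)

abbreviation shift :: "hardy2 \<Rightarrow> hardy2" where
  "shift \<equiv> hmult (\<lambda>z. z)"

definition bshift :: "hardy2 \<Rightarrow> hardy2" where
  "bshift f = - mob_adj 0 f"

lemma shift_eq: "shift f = - mob 0 f"
  by (rule hardy2_eqI)
     (simp add: ev_hmult[OF disk_algebra_ident] ev_minus ev_mob disk_involution_def)

lemma bshift_adjoint: "cinner (bshift f) g = cinner f (shift g)"
  by (simp add: bshift_def shift_eq cinner_minus_left cinner_minus_right mob_adj_adjoint)

lemma shift_adjoint: "cinner (shift f) g = cinner f (bshift g)"
  using bshift_adjoint[of g f] cinner_commute by metis

lemma ev_shift: "cmod z < 1 \<Longrightarrow> ev (shift f) z = z * ev f z"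
  by (rule ev_hmult[OF disk_algebra_ident])

lemma ev_bshift: "cmod z < 1 \<Longrightarrow> z * ev (bshift f) z = ev f z - ev f 0"
  using ev_mob_adj[of 0 z f] by (simp add: bshift_def ev_minus)

lemma shift_isometry: "cinner (shift f) (shift g) = cinner f g"
  by (rule hmult_isometry[OF disk_algebra_ident])

text \<open>
  With \<open>S\<close> the shift and \<open>M\<^sub>b\<close> multiplication by \<open>disk_involution b\<close>, these are
  \<open>S + cnj q M\<^sub>b\<^sup>*\<close> and \<open>S\<^sup>* + q M\<^sub>b\<close>: the Toeplitz operator and its adjoint in a form that only
  involves holomorphic functions.
\<close>

definition toep :: "complex \<Rightarrow> complex \<Rightarrow> hardy2 \<Rightarrow> hardy2" where
  "toep q b f = shift f + cnj q *\<^sub>C mob_adj b f"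

definition toep_adj :: "complex \<Rightarrow> complex \<Rightarrow> hardy2 \<Rightarrow> hardy2" where
  "toep_adj q b f = bshift f + q *\<^sub>C mob b f"

lemma toeplitz_eq_toep:
  assumes b: "cmod b < 1"
  shows "toeplitz (\<lambda>z. z + cnj (q * disk_involution b z)) = toep q b"
proof
  fix f
  let ?f = "rep_circle_L2 (Rep_hardy2 f)" and ?\<phi> = "disk_involution b"
  have \<phi>: "disk_algebra ?\<phi>"
    by (rule disk_algebra_involution[OF b])
  have m: "(\<lambda>z. z) \<in> borel_measurable circle_measure" "?\<phi> \<in> borel_measurable circle_measure"
    using disk_algebra_square_integrable[OF disk_algebra_ident] disk_algebra_square_integrable[OF \<phi>]
    by (simp_all add: square_integrable_def)
  have cm: "(\<lambda>z. cnj (?\<phi> z)) \<in> borel_measurable circle_measure"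
    by (rule borel_measurable_continuous_on[OF _ m(2)]) (intro continuous_intros)
  have sq1: "square_integrable (\<lambda>z. z * ?f z)"
    by (rule square_integrable_mult_bounded[OF m(1), of 1]) auto
  have sq2: "square_integrable (\<lambda>z. cnj (?\<phi> z) * ?f z)"
    by (rule square_integrable_mult_bounded[OF cm, of 1]) (simp_all add: disk_involution_on_circle[OF b])
  have sqg: "square_integrable (\<lambda>z. ?\<phi> z * rep_circle_L2 (Rep_hardy2 g) z)" for g
    by (rule square_integrable_mult_bounded[OF m(2), of 1]) (simp_all add: disk_involution_on_circle[OF b])
  have "(\<lambda>z. (z + cnj (q * ?\<phi> z)) * ?f z) = (\<lambda>z. z * ?f z + cnj q * (cnj (?\<phi> z) * ?f z))"
    by (auto simp: algebra_simps)
  then have L: "abs_circle_L2 (\<lambda>z. (z + cnj (q * ?\<phi> z)) * ?f z)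
      = Rep_hardy2 (shift f) + cnj q *\<^sub>C abs_circle_L2 (\<lambda>z. cnj (?\<phi> z) * ?f z)"
    by (simp add: L2_add[OF sq1 square_integrable_scale[OF sq2]] L2_scale[OF sq2] Rep_hmult[OF disk_algebra_ident])
  have proj: "cinner (abs_circle_L2 (\<lambda>z. cnj (?\<phi> z) * ?f z)) (Rep_hardy2 g) = cinner (mob_adj b f) g" for g
  proof -
    let ?g = "rep_circle_L2 (Rep_hardy2 g)"
    have "cinner (abs_circle_L2 (\<lambda>z. cnj (?\<phi> z) * ?f z)) (Rep_hardy2 g)
        = cinner (abs_circle_L2 (\<lambda>z. cnj (?\<phi> z) * ?f z)) (abs_circle_L2 ?g)"
      by simp
    also have "\<dots> = (\<integral>z. cnj (?\<phi> z) * ?f z * cnj (?g z) \<partial>circle_measure)"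
      by (rule cinner_L2[OF sq2]) simp
    also have "\<dots> = (\<integral>z. ?f z * cnj (?\<phi> z * ?g z) \<partial>circle_measure)"
      by (simp add: mult_ac)
    also have "\<dots> = cinner (abs_circle_L2 ?f) (abs_circle_L2 (\<lambda>z. ?\<phi> z * ?g z))"
      by (rule cinner_L2[symmetric]) (simp_all add: sqg)
    also have "\<dots> = cinner f (mob b g)"
      by (simp add: cinner_hardy2.rep_eq Rep_hmult[OF \<phi>])
    finally show ?thesis
      by (simp add: mob_adj_adjoint[OF b])
  qed
  show "toeplitz (\<lambda>z. z + cnj (q * ?\<phi> z)) f = toep q b f"
    unfolding toeplitz_def L
  proof (rule hardy_projection_eqI)
    fix g
    show "cinner (Rep_hardy2 (shift f) + cnj q *\<^sub>C abs_circle_L2 (\<lambda>z. cnj (?\<phi> z) * ?f z)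
        - Rep_hardy2 (toep q b f)) (Rep_hardy2 g) = 0"
      by (simp add: toep_def plus_hardy2.rep_eq scaleC_hardy2.rep_eq cinner_diff_left cinner_add_left
        cinner_scaleC_left proj) (simp add: cinner_hardy2.rep_eq)
  qed
qed

lemma toep_adjoint:
  assumes "cmod b < 1"
  shows "cinner (toep q b f) g = cinner f (toep_adj q b g)"
  by (simp add: toep_def toep_adj_def cinner_add_left cinner_add_right cinner_scaleC_left
    cinner_scaleC_right shift_adjoint mob_adj_adjoint[OF assms])

lemma cadjoint_toep: "cmod b < 1 \<Longrightarrow> cadjoint (toep q b) = toep_adj q b"
  by (rule cadjoint_eqI) (rule toep_adjoint)

lemma bounded_operator_toep:
  assumes b: "cmod b < 1"
  shows "bounded_operator (toep q b)"
proof -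
  have scaleC: "toep q b (c *\<^sub>C f) = c *\<^sub>C toep q b f" for c f
    by (simp add: toep_def hmult_scaleC[OF disk_algebra_ident] mob_adj_scaleC[OF b] scaleC_add_right
      scaleC_scaleC mult.commute)
  have "bounded_linear (toep q b)"
  proof (rule bounded_linear_intro[where K = "1 + cmod q"])
    show "toep q b (f + g) = toep q b f + toep q b g" for f g
      by (simp add: toep_def hmult_add[OF disk_algebra_ident] mob_adj_add[OF b] scaleC_add_right)
    show "toep q b (r *\<^sub>R f) = r *\<^sub>R toep q b f" for r f
      by (simp add: scaleR_eq_scaleC scaleC)
    show "norm (toep q b f) \<le> norm f * (1 + cmod q)" for f
    proof -
      have "norm (toep q b f) \<le> norm (mob 0 f) + cmod q * norm (mob_adj b f)"
        unfolding toep_def shift_eq by (rule order_trans[OF norm_triangle_ineq]) (simp add: norm_scaleC)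
      also have "\<dots> \<le> norm f + cmod q * norm f"
        by (intro add_mono mult_left_mono norm_mob_adj_le b) (simp_all add: norm_mob)
      finally show ?thesis
        by (simp add: algebra_simps)
    qed
  qed
  then show ?thesis
    by (simp add: bounded_operator_def scaleC)
qed

section \<open>Normality\<close>

text \<open>
  A normal operator satisfies $\|T u\| = \|T^* u\|$.  For the constant function \<open>u = 1\<close> the squares of
  the two sides are \<open>1 + (cmod b)\<^sup>2\<close> and \<open>1\<close>.
\<close>

lemma normal_toep_imp_zero:
  assumes q: "cmod q = 1" and b: "cmod b < 1" and normal: "normal_operator (toep q b)"
  shows "b = 0"
proof -
  define u where "u = szego 0"
  have u: "cinner f u = ev f 0" for f
    using cinner_szego[of 0 f] by (simp add: u_def)
  have u': "cinner u f = cnj (ev f 0)" for f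
    using u[of f] cinner_commute[of u f] by simp
  have evu: "ev u 0 = 1"
    using ev_hardy_of[OF disk_algebra_kernel[of 0], of 0] by (simp add: u_def)
  have qq: "q * cnj q = 1"
    using q by (simp add: complex_norm_square[symmetric])
  have Au: "mob_adj b u = cnj b *\<^sub>C u"
    by (rule cinner_ext)
       (simp add: mob_adj_adjoint[OF b] cinner_scaleC_left u' ev_mob[OF b] disk_involution_def)
  have Bu: "bshift u = 0"
    by (rule cinner_ext) (simp add: bshift_adjoint u' ev_shift)
  have "cinner (toep_adj q b u) (toep_adj q b u) = cinner (toep q b (toep_adj q b u)) u"
    by (simp add: toep_adjoint[OF b])
  also have "toep q b (toep_adj q b u) = toep_adj q b (toep q b u)"
    using normal unfolding normal_operator_def cadjoint_toep[OF b] by (auto simp: fun_eq_iff)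
  also have "cinner \<dots> u = cinner (toep q b u) (toep q b u)"
    using toep_adjoint[OF b, of q u "toep q b u"] cinner_commute by metis
  also have "\<dots> = 1 + b * cnj b"
    using qq by (simp add: toep_def Au cinner_add_left cinner_add_right cinner_scaleC_left cinner_scaleC_right
      shift_isometry u u' evu ev_shift ev_add ev_scaleC mult_ac)
  also have "cinner (toep_adj q b u) (toep_adj q b u) = 1"
    using qq by (simp add: toep_adj_def Bu cinner_scaleC_left cinner_scaleC_right mob_isometry[OF b] u evu mult.commute[of "cnj q" q])
  finally show "b = 0"
    by simp
qed

section \<open>Eigenvalues of UET operators\<close>

lemma conjugationD:
  assumes "conjugation C"
  shows "C (x + y) = C x + C y" "C (c *\<^sub>C x) = cnj c *\<^sub>C C x" "C (C x) = x" "cinner (C x) (C y) = cinner y x"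
    "C 0 = 0"
proof -
  show *: "C (x + y) = C x + C y" "C (c *\<^sub>C x) = cnj c *\<^sub>C C x" "C (C x) = x" "cinner (C x) (C y) = cinner y x"
    for x y c
    using assms by (auto simp: conjugation_def fun_eq_iff)
  show "C 0 = 0"
    using *(2)[of 0 0] by simp
qed

text \<open>
  The antilinear map \<open>C\<close> carries the kernel of $T^* - \bar w$ to that of $C T^* C - w$, and the
  unitary carries the latter to the kernel of $T - w$.  Thus the two defect spaces of a UET operator
  vanish together.
\<close>

lemma UET_eigenvector:
  fixes T :: "'a::complex_inner \<Rightarrow> 'a"
  assumes "UET T" and g: "cadjoint T g = cnj w *\<^sub>C g" "g \<noteq> 0"
  shows "\<exists>f. f \<noteq> 0 \<and> T f = w *\<^sub>C f"
proof -
  obtain C U where C: "conjugation C" and U: "unitary_operator U" and T: "T = inv U \<circ> (C \<circ> cadjoint T \<circ> C) \<circ> U"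
    using assms(1) unfolding UET_def unitarily_equivalent_def by blast
  have bij: "bij U" and scaleC: "U (c *\<^sub>C x) = c *\<^sub>C U x" for c x
    using U by (auto simp: unitary_operator_def bounded_operator_def)
  define f where "f = inv U (C g)"
  have Uf: "U f = C g"
    using bij by (simp add: f_def surj_f_inv_f bij_is_surj)
  have "T f = inv U (C (cadjoint T (C (U f))))"
    using fun_cong[OF T, of f] by (simp add: comp_def)
  also have "\<dots> = inv U (w *\<^sub>C U f)"
    by (simp add: Uf conjugationD[OF C] g(1))
  also have "\<dots> = w *\<^sub>C f"
    using bij by (simp add: scaleC[symmetric] inv_f_f bij_is_inj)
  finally have "T f = w *\<^sub>C f" .
  moreover have "f \<noteq> 0"
  proof
    assume "f = 0"
    then have "C g = 0"
      using scaleC[of 0 0] Uf by simp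
    then show False
      using conjugationD(3)[OF C, of g] conjugationD(5)[OF C] g(2) by simp
  qed
  ultimately show ?thesis
    by blast
qed

lemma complex_symmetric_imp_UET:
  fixes T :: "'a::complex_inner \<Rightarrow> 'a"
  assumes "complex_symmetric T"
  shows "UET T"
proof -
  obtain C where C: "conjugation C" "bounded_operator T" "C \<circ> T \<circ> C = cadjoint T"
    using assms by (auto simp: complex_symmetric_def C_symmetric_def)
  have "bounded_linear (id :: 'a \<Rightarrow> 'a)"
    by (simp add: id_def bounded_linear_ident)
  then have "unitary_operator (id :: 'a \<Rightarrow> 'a)"
    by (simp add: unitary_operator_def bounded_operator_def)
  moreover have "T = inv id \<circ> (C \<circ> cadjoint T \<circ> C) \<circ> id"
    unfolding C(3)[symmetric] by (simp add: fun_eq_iff inv_id conjugationD[OF C(1)])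
  ultimately show ?thesis
    using C unfolding UET_def unitarily_equivalent_def by blast
qed

section \<open>Kernels at a point with two preimages in the disc\<close>

text \<open>
  The numbers \<open>z1\<close> and \<open>z2\<close> are the two solutions of \<open>\<phi>(z) = w\<close> for the rational extension
  \<open>z + cnj q * (1 - cnj b * z) / (b - z)\<close> of the symbol \<open>\<phi>\<close>.  Multiplying the eigenvalue equation by
  \<open>b - z\<close> shows that \<open>(z - z1) (z - z2) f(z)\<close> is constant; since \<open>z1\<close> lies in the disc, the constant
  is zero.
\<close>

lemma toep_no_eigenvector:
  assumes q: "cmod q = 1" and b: "cmod b < 1"
    and z: "cmod z1 < 1" "cmod z2 < 1" "z1 + z2 = w + (b - cnj q * cnj b)" "z1 * z2 = w * b - cnj q"
    and f: "toep q b f = w *\<^sub>C f"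
  shows "f = 0"
proof -
  have root: "(z - z1) * (z - z2) * ev f z = - (cnj q * (1 - cnj b * b) * ev f b)" if zd: "cmod z < 1" for z
  proof -
    have "z * ev f z + cnj q * ev (mob_adj b f) z = w * ev f z"
      using arg_cong[OF f, of "\<lambda>g. ev g z"] zd by (simp add: toep_def ev_add ev_scaleC ev_shift)
    then have "(b - z) * z * ev f z + cnj q * ((b - z) * ev (mob_adj b f) z) = (b - z) * (w * ev f z)"
      by (metis distrib_left mult.assoc mult.left_commute)
    then have "((b - z) * z + cnj q * (1 - cnj b * z) - (b - z) * w) * ev f z = cnj q * (1 - cnj b * b) * ev f b"
      unfolding ev_mob_adj[OF b zd] by (simp add: algebra_simps)
    moreover have "(z - z1) * (z - z2) = - ((b - z) * z + cnj q * (1 - cnj b * z) - (b - z) * w)"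
    proof -
      have "(z - z1) * (z - z2) = z * z - (z1 + z2) * z + z1 * z2"
        by (simp add: algebra_simps)
      then show ?thesis
        unfolding z by (simp add: algebra_simps)
    qed
    ultimately show ?thesis
      by (simp only: mult_minus_left)
  qed
  have "ev f b = 0"
    using root[OF z(1)] q one_minus_norm_square_nonzero[OF b] by (auto simp: mult.commute)
  then have zero: "ev f z = 0" if "cmod z < 1" "z \<noteq> z1" "z \<noteq> z2" for z
    using root[OF that(1)] that by simp
  show "f = 0"
  proof (rule hardy2_eqI)
    fix z0 :: complex assume z0: "cmod z0 < 1"
    have "isCont (ev f) z0"
      using z0 ev_continuous continuous_on_interior by fastforce
    then have "(ev f \<longlongrightarrow> ev f z0) (at z0)"
      by (simp add: isCont_def)
    moreover have "\<forall>\<^sub>F z in at z0. ev f z = 0"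
    proof -
      have "\<forall>\<^sub>F z in at z0. z \<in> ball 0 1"
        using z0 by (intro eventually_at_in_open') auto
      moreover have "\<forall>\<^sub>F z in at z0. z \<noteq> z1" "\<forall>\<^sub>F z in at z0. z \<noteq> z2"
        by (rule eventually_neq_at_within)+
      ultimately show ?thesis
        by eventually_elim (simp add: zero)
    qed
    then have "(ev f \<longlongrightarrow> 0) (at z0)"
      by (rule tendsto_eventually)
    ultimately show "ev f z0 = ev 0 z0"
      using tendsto_unique[OF at_neq_bot] by simp
  qed
qed

text \<open>
  On the circle \<open>cnj (\<phi> z - w)\<close> equals
  \<open>cnj z * (1 - cnj z1 * z) * (1 - cnj z2 * z) / (1 - cnj b * z)\<close>.  The eigenvector is the function whose
  product with it is \<open>cnj z\<close>, which is orthogonal to the Hardy space; it is holomorphic across the circle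
  because both roots lie in the disc.
\<close>

lemma toep_adj_eigenvector:
  assumes b: "cmod b < 1"
    and z: "cmod z1 < 1" "cmod z2 < 1" "z1 + z2 = w + (b - cnj q * cnj b)" "z1 * z2 = w * b - cnj q"
  shows "\<exists>g. g \<noteq> 0 \<and> toep_adj q b g = cnj w *\<^sub>C g"
proof -
  define G where "G z = (1 - cnj b * z) * (1 / (1 - cnj z1 * z) * (1 / (1 - cnj z2 * z)))" for z
  have da: "disk_algebra G"
    unfolding G_def
    by (intro disk_algebra_mult disk_algebra_kernel z disk_algebra_diff disk_algebra_const disk_algebra_ident)
  define g where "g = hardy_of G"
  have g: "ev g z = G z" if "cmod z < 1" for z
    unfolding g_def by (rule ev_hardy_of[OF da that])
  have G0: "G 0 = 1"
    by (simp add: G_def)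
  have zc: "cnj z1 + cnj z2 = cnj w + (cnj b - q * b)" "cnj z1 * cnj z2 = cnj w * cnj b - q"
    using arg_cong[OF z(3), of cnj] arg_cong[OF z(4), of cnj] by simp_all
  have "shift (toep_adj q b g) = shift (cnj w *\<^sub>C g)"
  proof (rule hardy2_eqI)
    fix z assume zd: "cmod z < 1"
    have n: "1 - cnj b * z \<noteq> 0" "1 - cnj z1 * z \<noteq> 0" "1 - cnj z2 * z \<noteq> 0"
      using kernel_denominator_nonzero zd b z by auto
    have "(1 - cnj b * z) + q * z * (b - z) - cnj w * z * (1 - cnj b * z)
        = 1 - (cnj z1 + cnj z2) * z + (cnj z1 * cnj z2) * z * z"
      unfolding zc by (simp add: algebra_simps)
    also have "\<dots> = (1 - cnj z1 * z) * (1 - cnj z2 * z)"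
      by (simp add: algebra_simps)
    finally have e: "(1 - cnj b * z) + q * z * (b - z) - cnj w * z * (1 - cnj b * z) = (1 - cnj z1 * z) * (1 - cnj z2 * z)" .
    have "G z + z * (q * (disk_involution b z * G z)) - z * (cnj w * G z)
        = ((1 - cnj b * z) + q * z * (b - z) - cnj w * z * (1 - cnj b * z)) * (1 / (1 - cnj z1 * z) * (1 / (1 - cnj z2 * z)))"
      using n by (simp add: G_def disk_involution_def divide_simps)
    also have "\<dots> = 1"
      unfolding e using n by simp
    finally have "G z - 1 + z * (q * (disk_involution b z * G z)) = z * (cnj w * G z)"
      by (simp add: algebra_simps)
    then show "ev (shift (toep_adj q b g)) z = ev (shift (cnj w *\<^sub>C g)) z"
      using ev_bshift[OF zd, of g]
      by (simp add: ev_shift[OF zd] toep_adj_def ev_add ev_scaleC ev_mob[OF b zd] g[OF zd] g[of 0] G0 distrib_left)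
  qed
  then have "toep_adj q b g = cnj w *\<^sub>C g"
    using shift_isometry cinner_ext by metis
  moreover have "g \<noteq> 0"
    using g[of 0] G0 by auto
  ultimately show ?thesis
    by blast
qed

text \<open>
  Put \<open>R(z) = cnj q * (1 - cnj b * z) / (b - z)\<close> and \<open>\<beta> = b - cnj q * cnj b\<close>.  Two numbers satisfy the
  relations for some \<open>w\<close> iff \<open>z2 = R(z1) + \<beta>\<close> (for \<open>z1 \<noteq> b\<close>), and \<open>R\<close> maps the disc onto the exterior of the
  circle.  So it suffices to find a value \<open>\<rho>\<close> of \<open>R\<close> outside the circle with \<open>\<beta> + \<rho>\<close> inside, and such \<open>\<rho>\<close>
  exist in the direction opposite to \<open>\<beta>\<close>, because \<open>\<beta> \<noteq> 0\<close> and \<open>cmod \<beta> < 2\<close>.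
\<close>

lemma two_roots_in_disk:
  assumes q: "cmod q = 1" and b: "cmod b < 1" and ne: "b - cnj q * cnj b \<noteq> 0"
  shows "\<exists>w z1 z2. cmod z1 < 1 \<and> cmod z2 < 1 \<and> z1 + z2 = w + (b - cnj q * cnj b) \<and> z1 * z2 = w * b - cnj q"
proof -
  define \<beta> where "\<beta> = b - cnj q * cnj b"
  define n where "n = cmod \<beta>"
  have n: "0 < n" "n < 4"
  proof -
    show "0 < n"
      using ne by (simp add: n_def \<beta>_def)
    have "n \<le> cmod b + cmod b"
      unfolding n_def \<beta>_def using norm_triangle_ineq4[of b "cnj q * cnj b"] q by (simp add: norm_mult)
    then show "n < 4"
      using b by simp
  qed
  \<comment> \<open>This has modulus \<open>1 + n / 2\<close>, so that \<open>\<beta> + \<rho>\<close> has modulus \<open>\<bar>n / 2 - 1\<bar>\<close>.\<close>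
  define \<rho> where "\<rho> = - of_real (1 / n + 1 / 2) * \<beta>"
  have \<rho>: "cmod \<rho> > 1"
  proof -
    have "cmod \<rho> = (1 / n + 1 / 2) * n"
      using n by (simp add: \<rho>_def norm_mult n_def[symmetric] del: of_real_add of_real_divide)
    also have "\<dots> = 1 + n / 2"
      using n by (simp add: field_simps)
    finally show ?thesis
      using n by simp
  qed
  have z2: "cmod (\<beta> + \<rho>) < 1"
  proof -
    have "\<beta> + \<rho> = of_real (1 / 2 - 1 / n) * \<beta>"
      by (simp add: \<rho>_def algebra_simps)
    then have "cmod (\<beta> + \<rho>) = \<bar>1 / 2 - 1 / n\<bar> * n"
      by (simp add: norm_mult n_def[symmetric] del: of_real_diff of_real_divide)
    also have "\<dots> = \<bar>(1 / 2 - 1 / n) * n\<bar>"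
      using n by (simp add: abs_mult)
    also have "(1 / 2 - 1 / n) * n = n / 2 - 1"
      using n by (simp add: field_simps)
    also have "\<bar>n / 2 - 1\<bar> < 1"
      using n by simp
    finally show ?thesis .
  qed
  define d where "d = \<rho> - cnj q * cnj b"
  \<comment> \<open>The solution of \<open>R(z1) = \<rho>\<close>.\<close>
  define z1 where "z1 = (\<rho> * b - cnj q) / d"
  have qq: "q * cnj q = 1"
    using q by (simp add: complex_norm_square[symmetric])
  have "(cmod d)\<^sup>2 - (cmod (\<rho> * b - cnj q))\<^sup>2 = ((cmod \<rho>)\<^sup>2 - 1) * (1 - (cmod b)\<^sup>2)"
  proof -
    have "complex_of_real ((cmod d)\<^sup>2 - (cmod (\<rho> * b - cnj q))\<^sup>2)
        = \<rho> * cnj \<rho> + (q * cnj q) * (b * cnj b) - (\<rho> * cnj \<rho>) * (b * cnj b) - q * cnj q"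
      unfolding of_real_diff complex_norm_square d_def by (simp add: algebra_simps)
    also have "\<dots> = complex_of_real (((cmod \<rho>)\<^sup>2 - 1) * (1 - (cmod b)\<^sup>2))"
      unfolding qq of_real_mult of_real_diff complex_norm_square by (simp add: algebra_simps)
    finally show ?thesis
      by (simp only: of_real_eq_iff)
  qed
  moreover have "((cmod \<rho>)\<^sup>2 - 1) * (1 - (cmod b)\<^sup>2) > 0"
    using \<rho> b abs_square_less_1[of "cmod b"] one_less_power[OF \<rho>, of 2] by simp
  ultimately have "(cmod (\<rho> * b - cnj q))\<^sup>2 < (cmod d)\<^sup>2"
    by simp
  then have less: "cmod (\<rho> * b - cnj q) < cmod d"
    by (simp add: power_less_imp_less_base)
  then have d: "d \<noteq> 0"
    by auto
  have z1: "cmod z1 < 1"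
    using less d by (simp add: z1_def norm_divide)
  have z1d: "z1 * d = \<rho> * b - cnj q"
    using d by (simp add: z1_def)
  show ?thesis
  proof (intro exI conjI)
    show "cmod z1 < 1" "cmod (\<beta> + \<rho>) < 1"
      by fact+
    show "z1 + (\<beta> + \<rho>) = (z1 + \<rho>) + (b - cnj q * cnj b)"
      by (simp add: \<beta>_def)
    have "z1 * (\<beta> + \<rho>) = z1 * b + z1 * d"
      by (simp add: \<beta>_def d_def algebra_simps)
    then show "z1 * (\<beta> + \<rho>) = (z1 + \<rho>) * b - cnj q"
      unfolding z1d by (simp add: algebra_simps)
  qed
qed

lemma UET_toep_imp:
  assumes q: "cmod q = 1" and b: "cmod b < 1" and uet: "UET (toep q b)"
  shows "b = cnj q * cnj b"
proof (rule ccontr)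
  assume "b \<noteq> cnj q * cnj b"
  then obtain w z1 z2 where z: "cmod z1 < 1" "cmod z2 < 1" "z1 + z2 = w + (b - cnj q * cnj b)" "z1 * z2 = w * b - cnj q"
    using two_roots_in_disk[OF q b] by auto
  from toep_adj_eigenvector[OF b z] obtain g where "g \<noteq> 0" "cadjoint (toep q b) g = cnj w *\<^sub>C g"
    unfolding cadjoint_toep[OF b] by blast
  from UET_eigenvector[OF uet this(2,1)] show False
    using toep_no_eigenvector[OF q b z] by blast
qed

section \<open>The symmetric case\<close>

text \<open>
  When \<open>q * b = cnj b\<close>, the map \<open>z \<mapsto> cnj (q * disk_involution b z)\<close> is an antiholomorphic involution of
  the disc.  Its fixed point is the real multiple \<open>x * b\<close> of \<open>b\<close>, where \<open>x\<close> is the smaller root of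
  $|b|^2 x^2 - 2x + 1$ (and \<open>x = 1/2\<close> if \<open>b = 0\<close>); the two equations express this without
  denominators.
\<close>

lemma reflection_fixed_point:
  assumes q: "cmod q = 1" and b: "cmod b < 1" and e: "q * b = cnj b"
  obtains a where "cmod a < 1" "q * a = cnj a" "cnj b * (1 + a * cnj a) = 2 * cnj a"
proof -
  define s where "s = sqrt (1 - (cmod b)\<^sup>2)"
  define x where "x = 1 / (1 + s)"
  have s: "0 \<le> s" "s\<^sup>2 = 1 - (cmod b)\<^sup>2"
    using b abs_square_less_1[of "cmod b"] by (auto simp: s_def)
  have x: "0 \<le> x" "x \<le> 1" "x * (1 + s) = 1"
    using s by (auto simp: x_def)
  have quad: "1 + x\<^sup>2 * (cmod b)\<^sup>2 = 2 * x"
  proof -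
    have "(cmod b)\<^sup>2 = (1 + s) * (1 - s)"
      using s(2) by (simp add: power2_eq_square algebra_simps)
    then have "x\<^sup>2 * (cmod b)\<^sup>2 = x * ((x * (1 + s)) * (1 - s))"
      by (simp add: power2_eq_square mult_ac)
    also have "\<dots> = 2 * x - (x + x * s)"
      unfolding x(3) by (simp add: algebra_simps)
    also have "x + x * s = 1"
      using x(3) by (simp add: algebra_simps)
    finally show ?thesis
      by simp
  qed
  show ?thesis
  proof
    let ?a = "of_real x * b"
    show "cmod ?a < 1"
      using b x mult_left_le_one_le[of "cmod b" x] by (simp add: norm_mult mult.commute)
    show "q * ?a = cnj ?a"
      using e by (simp add: mult.left_commute)
    have "?a * cnj ?a = of_real (x\<^sup>2 * (cmod b)\<^sup>2)"
      unfolding of_real_mult complex_norm_square by (simp add: power2_eq_square mult_ac)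
    then have "1 + ?a * cnj ?a = of_real (2 * x)"
      using quad by (metis of_real_1 of_real_add)
    then show "cnj b * (1 + ?a * cnj ?a) = 2 * cnj ?a"
      by (simp del: of_real_mult add: of_real_mult[of 2 x])
  qed
qed

text \<open>
  The coordinate \<open>disk_involution a\<close> centred at the fixed point \<open>a\<close> turns the antiholomorphic involution
  into \<open>z \<mapsto> \<omega> * cnj z\<close> with \<open>\<omega> = - cnj q\<close>.  The identity is the complex conjugate of this statement,
  cleared of one denominator.
\<close>

lemma involution_intertwining:
  assumes q: "cmod q = 1" and b: "cmod b < 1" and e: "q * b = cnj b"
    and a: "cmod a < 1" "q * a = cnj a" "cnj b * (1 + a * cnj a) = 2 * cnj a" and z: "cmod z < 1"
  shows "q * (disk_involution b z * (1 + a * q * disk_involution a z)) = cnj a + q * disk_involution a z"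
proof -
  have n: "1 - cnj a * z \<noteq> 0" "1 - cnj b * z \<noteq> 0"
    using kernel_denominator_nonzero a b z by auto
  have 1: "a * q = cnj a"
    using a(2) by (simp add: mult.commute)
  have main: "(cnj b - q * z) * (1 + a * cnj a - 2 * cnj a * z) = (1 - cnj b * z) * (2 * cnj a - cnj a * cnj a * z - q * z)"
  proof -
    have 2: "q * (a * cnj a) = cnj a * cnj a"
      using a(2) by (metis mult.assoc)
    have 3: "cnj b * (cnj a * cnj a) + cnj b * q = 2 * (q * cnj a)"
    proof -
      have "cnj b * (cnj a * cnj a) + cnj b * q = q * (cnj b * (1 + a * cnj a))"
        unfolding 2[symmetric] by (simp add: algebra_simps)
      then show ?thesis
        by (simp add: a(3))
    qed
    have "(cnj b - q * z) * (1 + a * cnj a - 2 * cnj a * z)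
        = cnj b * (1 + a * cnj a) - (q + q * (a * cnj a) + 2 * cnj a * cnj b) * z + 2 * (q * cnj a) * z * z"
      by (simp add: algebra_simps)
    also have "\<dots> = 2 * cnj a - (q + cnj a * cnj a + 2 * cnj a * cnj b) * z
        + (cnj b * (cnj a * cnj a) + cnj b * q) * z * z"
      unfolding 2 3 a(3) ..
    finally show ?thesis
      by (simp add: algebra_simps)
  qed
  have l: "1 + a * q * disk_involution a z = (1 + a * cnj a - 2 * cnj a * z) / (1 - cnj a * z)"
    unfolding 1 disk_involution_def using n by (simp add: field_simps)
  have r: "cnj a + q * disk_involution a z = (2 * cnj a - cnj a * cnj a * z - q * z) / (1 - cnj a * z)"
    unfolding disk_involution_def using n a(2) by (simp add: field_simps)
  have m: "q * disk_involution b z = (cnj b - q * z) / (1 - cnj b * z)"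
    unfolding disk_involution_def using e by (simp add: field_simps)
  have "q * disk_involution b z * (1 + a * q * disk_involution a z)
      = ((cnj b - q * z) * (1 + a * cnj a - 2 * cnj a * z)) / ((1 - cnj b * z) * (1 - cnj a * z))"
    unfolding l m by simp
  also have "\<dots> = (2 * cnj a - cnj a * cnj a * z - q * z) / (1 - cnj a * z)"
    unfolding main using n by simp
  finally show ?thesis
    unfolding r by (simp add: mult.assoc)
qed

text \<open>
  Let \<open>M = mob a\<close>.  Since \<open>disk_involution a\<close> is its own inverse, the shift is \<open>disk_involution a\<close>
  applied to \<open>M\<close>, in the sense that \<open>S (1 - cnj a * M) = a - M\<close>.  The conjugation turns \<open>M\<close> into \<open>- q M\<close>
  and scalars into their conjugates, so that it turns \<open>S\<close> into multiplication by
  \<open>(cnj a + q * disk_involution a) / (1 + a * q * disk_involution a)\<close>, which is \<open>q * disk_involution b\<close> by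
  \<open>involution_intertwining\<close>.
\<close>

lemma C_conj_shift:
  assumes q: "cmod q = 1" and b: "cmod b < 1" and e: "q * b = cnj b"
    and a: "cmod a < 1" "q * a = cnj a" "cnj b * (1 + a * cnj a) = 2 * cnj a"
  shows "C_conj (- cnj q) a (shift f) = q *\<^sub>C mob b (C_conj (- cnj q) a f)"
proof -
  let ?C = "C_conj (- cnj q) a"
  have \<omega>: "cmod (- cnj q) = 1"
    using q by simp
  note C = conjugationD[OF conjugation_C_conj[OF \<omega> a(1)]]
  have Cmob: "?C (mob a h) = (- q) *\<^sub>C mob a (?C h)" for h
    using C_conj_mob[OF \<omega> a(1), of h] by simp
  have le: "cmod (disk_involution a z) \<le> 1" if "cmod z \<le> 1" for z
    using disk_involution_in_disk[OF a(1), of z] disk_involution_on_circle[OF a(1), of z] that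
    by (cases "cmod z = 1") auto
  have ne: "1 - cnj a * disk_involution a z \<noteq> 0" if "cmod z \<le> 1" for z
    using kernel_denominator_nonzero[OF a(1) le[OF that]] .
  have da: "disk_algebra (\<lambda>z. 1 / (1 - cnj a * disk_involution a z))"
    by (intro disk_algebra_inverse ne disk_algebra_diff disk_algebra_mult disk_algebra_const disk_algebra_involution a(1))
  \<comment> \<open>Every \<open>f\<close> has the form \<open>(1 - cnj a * M) g\<close>, so the operator identity may be tested on such vectors.\<close>
  define g where "g = hmult (\<lambda>z. 1 / (1 - cnj a * disk_involution a z)) f"
  have ev_g: "ev f z = (1 - cnj a * disk_involution a z) * ev g z" if "cmod z < 1" for z
    using ne[of z] that by (simp add: g_def ev_hmult[OF da])
  have f: "f = g + (- cnj a) *\<^sub>C mob a g"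
    by (rule hardy2_eqI) (simp add: ev_add ev_scaleC ev_mob[OF a(1)] ev_g algebra_simps)
  have Sf: "shift f = a *\<^sub>C g + (-1) *\<^sub>C mob a g"
  proof (rule hardy2_eqI)
    fix z assume z: "cmod z < 1"
    have "z * (1 - cnj a * disk_involution a z) = a - disk_involution a z"
      using kernel_denominator_nonzero[OF a(1), of z] z by (simp add: disk_involution_def field_simps)
    then have "z * ev f z = (a - disk_involution a z) * ev g z"
      by (simp only: ev_g[OF z] mult.assoc[symmetric])
    then show "ev (shift f) z = ev (a *\<^sub>C g + (-1) *\<^sub>C mob a g) z"
      using z by (simp add: ev_shift ev_add ev_scaleC ev_mob[OF a(1)] algebra_simps)
  qed
  have "?C f = ?C g + (a * q) *\<^sub>C mob a (?C g)"
    by (subst f) (simp add: C Cmob scaleC_scaleC)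
  then have "q * (disk_involution b z * ev (?C f) z) = (cnj a + q * disk_involution a z) * ev (?C g) z"
    if "cmod z < 1" for z
    using involution_intertwining[OF q b e a that] that
    by (simp add: ev_add ev_scaleC ev_mob[OF a(1)]) (metis (no_types, lifting) distrib_right mult.assoc mult_1)
  then have "q *\<^sub>C mob b (?C f) = cnj a *\<^sub>C ?C g + q *\<^sub>C mob a (?C g)"
    by (intro hardy2_eqI) (simp add: ev_add ev_scaleC ev_mob[OF a(1)] ev_mob[OF b] algebra_simps)
  also have "\<dots> = ?C (shift f)"
    unfolding Sf by (simp add: C Cmob scaleC_scaleC)
  finally show ?thesis ..
qed

text \<open>
  The conjugation exchanges the shift with \<open>q\<close> times multiplication by \<open>disk_involution b\<close>.  As \<open>C\<close> is
  antiunitary, it exchanges the adjoints in the same way, and hence the two summands of the operator with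
  those of its adjoint.
\<close>

lemma toep_C_symmetric:
  assumes q: "cmod q = 1" and b: "cmod b < 1" and e: "q * b = cnj b"
  shows "\<exists>\<omega> a. cmod \<omega> = 1 \<and> cmod a < 1 \<and> C_symmetric (C_conj \<omega> a) (toep q b)"
proof -
  obtain a where a: "cmod a < 1" "q * a = cnj a" "cnj b * (1 + a * cnj a) = 2 * cnj a"
    using reflection_fixed_point[OF q b e] .
  let ?C = "C_conj (- cnj q) a"
  have \<omega>: "cmod (- cnj q) = 1"
    using q by simp
  note C = conjugationD[OF conjugation_C_conj[OF \<omega> a(1)]]
  note S = C_conj_shift[OF q b e a]
  have qq: "q * cnj q = 1"
    using q by (simp add: complex_norm_square[symmetric])
  have swap: "cinner (?C x) y = cinner (?C y) x" for x y
    using C(4)[of x "?C y"] by (simp add: C)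
  have CS: "?C (shift (?C f)) = q *\<^sub>C mob b f" for f
    by (simp add: S C)
  have mobC: "mob b (?C f) = cnj q *\<^sub>C ?C (shift f)" for f
    by (simp add: S scaleC_scaleC qq mult.commute[of "cnj q"])
  have CA: "?C (mob_adj b (?C f)) = cnj q *\<^sub>C bshift f" for f
  proof (rule cinner_ext)
    fix g
    have "cinner (?C (mob_adj b (?C f))) g = cinner (?C g) (mob_adj b (?C f))"
      by (rule swap)
    also have "\<dots> = cinner (mob b (?C g)) (?C f)"
      using mob_adj_adjoint[OF b, of "?C f" "?C g"] cinner_commute by metis
    also have "\<dots> = cnj q * cinner f (shift g)"
      by (simp add: mobC cinner_scaleC_left C)
    finally show "cinner (?C (mob_adj b (?C f))) g = cinner (cnj q *\<^sub>C bshift f) g"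
      by (simp add: cinner_scaleC_left bshift_adjoint)
  qed
  have "?C \<circ> toep q b \<circ> ?C = toep_adj q b"
    by (rule ext) (simp add: toep_def toep_adj_def C CS CA scaleC_scaleC qq add.commute)
  then have "C_symmetric ?C (toep q b)"
    unfolding C_symmetric_def cadjoint_toep[OF b] using bounded_operator_toep[OF b] by blast
  then show ?thesis
    using \<omega> a(1) by blast
qed

section \<open>Winding numbers\<close>

lemma ex_sum_product: "\<exists>z1 z2 :: complex. z1 + z2 = s \<and> z1 * z2 = p"
proof (intro exI conjI)
  let ?r = "csqrt (s\<^sup>2 - 4 * p)"
  show "(s + ?r) / 2 + (s - ?r) / 2 = s"
    by (simp add: field_simps)
  have "(s + ?r) / 2 * ((s - ?r) / 2) = (s\<^sup>2 - ?r\<^sup>2) / 4"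
    by (simp add: power2_eq_square algebra_simps)
  then show "(s + ?r) / 2 * ((s - ?r) / 2) = p"
    by simp
qed

lemma winding_number_unit_circle:
  assumes "cmod z \<noteq> 1"
  shows "winding_number (circlepath 0 1) z = (if cmod z < 1 then 1 else 0)"
proof (cases "cmod z < 1")
  case False
  then show ?thesis
    using assms by (auto intro!: winding_number_zero_outside[where s = "cball 0 1"])
qed (simp add: winding_number_circlepath)

text \<open>
  The argument principle for the rational function \<open>\<Phi> - w\<close>, where \<open>\<Phi>\<close> extends the symbol from the
  circle: it has the zeros \<open>z1\<close>, \<open>z2\<close> and the pole \<open>b\<close>, which always lies in the disc, whence the \<open>- 1\<close>.
\<close>

lemma winding_number_symbol:
  fixes q b :: complex
  defines "\<phi> \<equiv> (\<lambda>z. z + cnj (q * disk_involution b z))"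
  assumes q: "cmod q = 1" and b: "cmod b < 1"
    and z: "z1 + z2 = w + (b - cnj q * cnj b)" "z1 * z2 = w * b - cnj q"
  shows "w \<notin> path_image (\<phi> \<circ> circlepath 0 1) \<longleftrightarrow> cmod z1 \<noteq> 1 \<and> cmod z2 \<noteq> 1"
    and "cmod z1 \<noteq> 1 \<Longrightarrow> cmod z2 \<noteq> 1 \<Longrightarrow>
      winding_number (\<phi> \<circ> circlepath 0 1) w = (if cmod z1 < 1 then 1 else 0) + (if cmod z2 < 1 then 1 else 0) - 1"
    and "path (\<phi> \<circ> circlepath 0 1)" "pathfinish (\<phi> \<circ> circlepath 0 1) = pathstart (\<phi> \<circ> circlepath 0 1)"
proof -
  define \<Phi> where "\<Phi> z = z + cnj q * ((1 - cnj b * z) / (b - z))" for z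
  let ?c = "circlepath 0 1"
  have bz: "b \<noteq> z" if "cmod z = 1" for z
    using b that by auto
  have \<phi>\<Phi>: "\<phi> z = \<Phi> z" if zc: "cmod z = 1" for z
  proof -
    have "disk_involution b z * cnj (disk_involution b z) = 1"
      using disk_involution_on_circle[OF b zc] by (simp add: complex_norm_square[symmetric])
    then have "cnj (disk_involution b z) = 1 / disk_involution b z"
      by (metis mult.commute mult_zero_left nonzero_eq_divide_eq zero_neq_one)
    then have eq: "cnj (disk_involution b z) = (1 - cnj b * z) / (b - z)"
      by (simp add: disk_involution_def del: complex_cnj_divide)
    show ?thesis
      unfolding \<phi>_def \<Phi>_def complex_cnj_mult eq ..
  qed
  have c1: "cmod (?c t) = 1" for t
    by (simp add: circlepath)
  have \<gamma>: "\<phi> \<circ> ?c = \<Phi> \<circ> ?c"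
    using \<phi>\<Phi> c1 by auto
  have hol: "\<Phi> holomorphic_on - {b}"
    unfolding \<Phi>_def by (intro holomorphic_intros) auto
  have sub: "path_image ?c \<subseteq> - {b}"
    using b by auto
  have vp: "valid_path (\<Phi> \<circ> ?c)"
    by (rule valid_path_compose_holomorphic[OF _ hol _ sub]) auto
  show "path (\<phi> \<circ> ?c)"
    unfolding \<gamma> by (rule valid_path_imp_path[OF vp])
  show "pathfinish (\<phi> \<circ> ?c) = pathstart (\<phi> \<circ> ?c)"
    by (simp add: pathfinish_compose pathstart_compose)
  have fac: "\<Phi> z - w = (z - z1) * (z - z2) / (z - b)" if "z \<noteq> b" for z
  proof -
    have "(z - z1) * (z - z2) = z * z - (z1 + z2) * z + z1 * z2"
      by (simp add: algebra_simps)
    also have "\<dots> = (z - w) * (z - b) - cnj q * (1 - cnj b * z)"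
      unfolding z by (simp add: algebra_simps)
    finally show ?thesis
      using that by (simp add: \<Phi>_def divide_simps) (simp add: algebra_simps)
  qed
  have img: "w \<in> path_image (\<phi> \<circ> ?c) \<longleftrightarrow> (\<exists>z. cmod z = 1 \<and> \<Phi> z - w = 0)"
    unfolding \<gamma> path_image_compose by (auto simp: image_iff)
  show iff: "w \<notin> path_image (\<phi> \<circ> ?c) \<longleftrightarrow> cmod z1 \<noteq> 1 \<and> cmod z2 \<noteq> 1"
    unfolding img using fac bz by fastforce
  assume z12: "cmod z1 \<noteq> 1" "cmod z2 \<noteq> 1"
  then have w: "w \<notin> path_image (\<Phi> \<circ> ?c)"
    using iff \<gamma> by simp
  have cint: "((\<lambda>u. 1 / (u - p)) has_contour_integral (2 * pi * \<i> * winding_number ?c p)) ?c" if "cmod p \<noteq> 1" for p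
    using that by (intro has_contour_integral_winding_number) auto
  have "2 * pi * \<i> * winding_number (\<Phi> \<circ> ?c) w = contour_integral (\<Phi> \<circ> ?c) (\<lambda>u. 1 / (u - w))"
    using winding_number_valid_path[OF vp w] by simp
  also have "\<dots> = contour_integral ?c (\<lambda>u. deriv \<Phi> u * (1 / (\<Phi> u - w)))"
    by (rule contour_integral_comp_analyticW[OF _ _ sub]) (use hol in \<open>auto simp: analytic_on_open[OF open_Compl[OF closed_singleton]]\<close>)
  also have "\<dots> = contour_integral ?c (\<lambda>u. 1 / (u - z1) + 1 / (u - z2) - 1 / (u - b))"
  proof (rule contour_integral_cong[OF refl])
    fix u assume "u \<in> path_image ?c"
    then have u: "cmod u = 1"
      by auto
    have ub: "u \<noteq> b" "u \<noteq> z1" "u \<noteq> z2"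
      using u b z12 by auto
    have ev: "\<forall>\<^sub>F v in nhds u. (v - z1) * (v - z2) / (v - b) + w = \<Phi> v"
    proof (rule eventually_mono[OF eventually_nhds_in_open[of "- {b}" u]])
      show "(v - z1) * (v - z2) / (v - b) + w = \<Phi> v" if "v \<in> - {b}" for v
        using fac[of v, symmetric] that by simp
    qed (use ub in auto)
    have "((\<lambda>v. (v - z1) * (v - z2) / (v - b) + w) has_field_derivative
        (((u - z1) + (u - z2)) * (u - b) - (u - z1) * (u - z2)) / ((u - b) * (u - b))) (at u)"
      using ub by (auto intro!: derivative_eq_intros)
    then have "(\<Phi> has_field_derivative
        (((u - z1) + (u - z2)) * (u - b) - (u - z1) * (u - z2)) / ((u - b) * (u - b))) (at u)"
      using DERIV_cong_ev[OF refl ev refl] by blast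
    then have "deriv \<Phi> u = (((u - z1) + (u - z2)) * (u - b) - (u - z1) * (u - z2)) / ((u - b) * (u - b))"
      by (rule DERIV_imp_deriv)
    then show "deriv \<Phi> u * (1 / (\<Phi> u - w)) = 1 / (u - z1) + 1 / (u - z2) - 1 / (u - b)"
      using ub by (simp add: fac divide_simps)
  qed
  also have "\<dots> = 2 * pi * \<i> * winding_number ?c z1 + 2 * pi * \<i> * winding_number ?c z2 - 2 * pi * \<i> * winding_number ?c b"
    using z12 b by (intro contour_integral_unique has_contour_integral_diff has_contour_integral_add cint) auto
  also have "\<dots> = 2 * pi * \<i> * (winding_number ?c z1 + winding_number ?c z2 - winding_number ?c b)"
    by (simp add: algebra_simps)
  finally have "winding_number (\<Phi> \<circ> ?c) w = winding_number ?c z1 + winding_number ?c z2 - winding_number ?c b"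
    by simp
  then show "winding_number (\<phi> \<circ> ?c) w = (if cmod z1 < 1 then 1 else 0) + (if cmod z2 < 1 then 1 else 0) - 1"
    unfolding \<gamma> using z12 b by (simp add: winding_number_unit_circle)
qed

lemma disk_involution_norm_identity:
  "(cmod (1 - cnj b * z))\<^sup>2 - (cmod (b - z))\<^sup>2 = (1 - (cmod b)\<^sup>2) * (1 - (cmod z)\<^sup>2)"
proof -
  have "complex_of_real ((cmod (1 - cnj b * z))\<^sup>2 - (cmod (b - z))\<^sup>2)
      = of_real ((1 - (cmod b)\<^sup>2) * (1 - (cmod z)\<^sup>2))"
    unfolding of_real_diff of_real_mult of_real_1 complex_norm_square by (simp add: algebra_simps)
  then show ?thesis
    by (simp only: of_real_eq_iff)
qed

text \<open>
  In this case \<open>z2 = cnj q * (1 - cnj b * z1) / (b - z1)\<close>, and a Mobius map of this form exchanges the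
  disc and the exterior of its closure.
\<close>

lemma paired_roots:
  assumes q: "cmod q = 1" and b: "cmod b < 1"
    and z: "z1 + z2 = w" "z1 * z2 = w * b - cnj q" and e: "b = cnj q * cnj b"
  shows "cmod z1 < 1 \<Longrightarrow> cmod z2 > 1" and "cmod z1 > 1 \<Longrightarrow> cmod z2 < 1"
proof -
  have "z2 * (b - z1) = cnj q - z1 * b"
    using z by (auto simp: algebra_simps)
  also have "z1 * b = cnj q * (cnj b * z1)"
    by (subst e) (simp add: mult_ac)
  finally have "z2 * (b - z1) = cnj q * (1 - cnj b * z1)"
    by (simp add: algebra_simps)
  from arg_cong[OF this, of cmod] have eq: "cmod z2 * cmod (b - z1) = cmod (1 - cnj b * z1)"
    using q by (simp add: norm_mult)
  have b2: "0 < 1 - (cmod b)\<^sup>2"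
    using b abs_square_less_1[of "cmod b"] by simp
  have sq: "((cmod z2)\<^sup>2 - 1) * (cmod (b - z1))\<^sup>2 = (1 - (cmod b)\<^sup>2) * (1 - (cmod z1)\<^sup>2)"
    unfolding disk_involution_norm_identity[symmetric] eq[symmetric] by (simp add: power_mult_distrib algebra_simps)
  show "cmod z2 > 1" if "cmod z1 < 1"
  proof -
    have "0 < ((cmod z2)\<^sup>2 - 1) * (cmod (b - z1))\<^sup>2"
      unfolding sq using that b2 abs_square_less_1[of "cmod z1"] by simp
    then have "1 < (cmod z2)\<^sup>2"
      by (simp add: zero_less_mult_iff)
    then show ?thesis
      using power_le_one[of "cmod z2" 2] by force
  qed
  show "cmod z2 < 1" if "cmod z1 > 1"
  proof -
    have "((cmod z2)\<^sup>2 - 1) * (cmod (b - z1))\<^sup>2 < 0"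
      unfolding sq using that b2 one_less_power[of "cmod z1" 2] by (simp add: mult_less_0_iff)
    then have "(cmod z2)\<^sup>2 < 1"
      by (simp add: mult_less_0_iff)
    then show ?thesis
      using abs_square_less_1[of "cmod z2"] by simp
  qed
qed

lemma nowhere_winding_iff:
  fixes q b :: complex
  defines "\<phi> \<equiv> (\<lambda>z. z + cnj (q * disk_involution b z))"
  assumes q: "cmod q = 1" and b: "cmod b < 1"
  shows "nowhere_winding (\<phi> \<circ> circlepath 0 1) \<longleftrightarrow> b = cnj q * cnj b"
proof
  assume nw: "nowhere_winding (\<phi> \<circ> circlepath 0 1)"
  show "b = cnj q * cnj b"
  proof (rule ccontr)
    assume "b \<noteq> cnj q * cnj b"
    then obtain w z1 z2 where z: "cmod z1 < 1" "cmod z2 < 1" "z1 + z2 = w + (b - cnj q * cnj b)" "z1 * z2 = w * b - cnj q"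
      using two_roots_in_disk[OF q b] by auto
    have "w \<notin> path_image (\<phi> \<circ> circlepath 0 1)"
      unfolding \<phi>_def using winding_number_symbol(1)[OF q b z(3,4)] z(1,2) by auto
    moreover have "winding_number (\<phi> \<circ> circlepath 0 1) w = 1"
      unfolding \<phi>_def using winding_number_symbol(2)[OF q b z(3,4)] z(1,2) by simp
    ultimately show False
      using nw by (simp add: nowhere_winding_def)
  qed
next
  assume e: "b = cnj q * cnj b"
  show "nowhere_winding (\<phi> \<circ> circlepath 0 1)"
    unfolding nowhere_winding_def
  proof (intro conjI allI impI)
    show "path (\<phi> \<circ> circlepath 0 1)" "pathfinish (\<phi> \<circ> circlepath 0 1) = pathstart (\<phi> \<circ> circlepath 0 1)"
      using ex_sum_product[of "0 + (b - cnj q * cnj b)" "0 * b - cnj q"] winding_number_symbol(3,4)[OF q b]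
      unfolding \<phi>_def by blast+
    fix w assume w: "w \<notin> path_image (\<phi> \<circ> circlepath 0 1)"
    obtain z1 z2 where z: "z1 + z2 = w + (b - cnj q * cnj b)" "z1 * z2 = w * b - cnj q"
      using ex_sum_product by metis
    have ne: "cmod z1 \<noteq> 1" "cmod z2 \<noteq> 1"
      using w winding_number_symbol(1)[OF q b z] unfolding \<phi>_def by auto
    have z': "z1 + z2 = w"
      using z(1) e by simp
    have "cmod z1 < 1 \<and> \<not> cmod z2 < 1 \<or> \<not> cmod z1 < 1 \<and> cmod z2 < 1"
      using paired_roots[OF q b z' z(2) e] ne by force
    then show "winding_number (\<phi> \<circ> circlepath 0 1) w = 0"
      using winding_number_symbol(2)[OF q b z ne] ne unfolding \<phi>_def by auto
  qed
qed


theorem proposition3p3: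
  fixes q b :: complex and \<phi> :: "complex \<Rightarrow> complex"
  assumes "cmod q = 1" and "cmod b < 1"
    and "\<phi> = (\<lambda>z. z + cnj (q * disk_involution b z))"
  shows "(complex_symmetric (toeplitz \<phi>) \<longleftrightarrow> UET (toeplitz \<phi>)) \<and>
    (UET (toeplitz \<phi>) \<longleftrightarrow>
      normal_operator (toeplitz \<phi>) \<or>
      (\<exists>\<omega> a. cmod \<omega> = 1 \<and> cmod a < 1 \<and> C_symmetric (C_conj \<omega> a) (toeplitz \<phi>))) \<and>
    (normal_operator (toeplitz \<phi>) \<or>
      (\<exists>\<omega> a. cmod \<omega> = 1 \<and> cmod a < 1 \<and> C_symmetric (C_conj \<omega> a) (toeplitz \<phi>)) \<longleftrightarrow>
      nowhere_winding (\<phi> \<circ> circlepath 0 1)) \<and>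
    (nowhere_winding (\<phi> \<circ> circlepath 0 1) \<longleftrightarrow> q * b = cnj b)"
proof -
  note q = assms(1) and b = assms(2)
  let ?sym = "\<exists>\<omega> a. cmod \<omega> = 1 \<and> cmod a < 1 \<and> C_symmetric (C_conj \<omega> a) (toeplitz \<phi>)"
  have T: "toeplitz \<phi> = toep q b"
    unfolding assms(3) by (rule toeplitz_eq_toep[OF b])
  have e: "b = cnj q * cnj b \<longleftrightarrow> q * b = cnj b"
  proof -
    have "q * cnj q = 1"
      using q by (simp add: complex_norm_square[symmetric])
    then show ?thesis
      by (metis mult.assoc mult.commute mult_1)
  qed
  have ed: "nowhere_winding (\<phi> \<circ> circlepath 0 1) \<longleftrightarrow> q * b = cnj b"
    unfolding assms(3) nowhere_winding_iff[OF q b] by (rule e)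
  have ec: "q * b = cnj b \<Longrightarrow> ?sym"
    unfolding T by (rule toep_C_symmetric[OF q b])
  have ca: "?sym \<Longrightarrow> complex_symmetric (toeplitz \<phi>)"
    unfolding complex_symmetric_def using conjugation_C_conj by blast
  have ab: "complex_symmetric (toeplitz \<phi>) \<Longrightarrow> UET (toeplitz \<phi>)"
    by (rule complex_symmetric_imp_UET)
  have be: "UET (toeplitz \<phi>) \<Longrightarrow> q * b = cnj b"
    unfolding T e[symmetric] by (rule UET_toep_imp[OF q b])
  have ne: "normal_operator (toeplitz \<phi>) \<Longrightarrow> q * b = cnj b"
    unfolding T using normal_toep_imp_zero[OF q b] by simp
  show ?thesis
    using ed ec ca ab be ne by blast
qed

end
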